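(* Let $L = L_{\bar 0}\oplus L_{\bar 1}$ be a finite dimensional nilpotent Lie superalgebra over $\mathbb{F}$ of dimension $(m\mid n)$ with $\dim L' = (r\mid s)$ and $r+s\geq 1$. Then $$\dim \mathcal{M}(L)\leq \frac{1}{2}\left[(m+n+r+s-2)(m+n-r-s-1)\right]+n+1.$$ Moreover, if $r+s=1$, then equality holds if and only if $$L\cong \begin{cases} H(1,0)\oplus A_1 & \text{if } r=1,\ s=0,\\ H(0,1)\oplus A_2 & \text{if } r=0,\ s=1,\end{cases}$$ where $A_1$ and $A_2$ are abelian Lie superalgebras with $\dim A_1=(m-3\mid n)$ and $\dim A_2=(m-1\mid n-1)$ respectively, and $H(1,0)$, $H(0,1)$ are special Heisenberg Lie superalgebras (with even center) of total dimension $3$ and $2$ respectively.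
   Context: $\mathbb{F}$ is an algebraically closed field of characteristic zero; all Lie superalgebras are over $\mathbb{F}$ and finite dimensional (except free ones). The dimension of a Lie superalgebra $L=L_{\bar 0}\oplus L_{\bar 1}$ is written $(m\mid n)$ with $m=\dim L_{\bar 0}$, $n=\dim L_{\bar 1}$; when $\dim$ is compared with a single number it means total dimension. $L'=[L,L]$. $L$ is nilpotent if $C^k(L)=0$ for some positive integer $k$, where $C^0(L)=L$ and $C^{k}(L)=[L,C^{k-1}(L)]$. Given a free presentation $0\to R\to F\to L\to 0$ with $F$ a free Lie superalgebra on a $\mathbb{Z}_2$-graded set and $R$ the kernel, the (Schur) multiplier of $L$ is $\mathcal{M}(L)=([F,F]\cap R)/[F,R]$. The Lie superalgebra $H(m,n)$ has even basis $x_1,\dots,x_{2m},z$, odd basis $y_1,\dots,y_n$, and the only nonzero brackets of basis elements (up to graded skew-symmetry) are $[x_i,x_{m+i}]=z$ for $1\le i\le m$ and $[y_j,y_j]=z$ for $1\le j\le n$. Isomorphisms are homogeneous of degree $0$. *)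

theory Defs
  imports Complex_Main "HOL-Library.Z2" "HOL-Library.Product_Plus" "HOL-Library.Poly_Mapping"
    "HOL-Computational_Algebra.Polynomial"
begin

text \<open>A superalgebra lives in an ambient vector space, given by a type \<open>'a\<close> with the scalar
  multiplication \<open>scl\<close>; its underlying space is the sum \<open>carr\<close> of the two subspaces \<open>part 0\<close> and
  \<open>part 1\<close>, and nothing is required of \<open>brk\<close> outside of it.\<close>

record ('k, 'a) superalgebra =
  scl :: "'k \<Rightarrow> 'a \<Rightarrow> 'a"
  brk :: "'a \<Rightarrow> 'a \<Rightarrow> 'a"
  part :: "bit \<Rightarrow> 'a set"

definition carr :: "('k, 'a::ab_group_add) superalgebra \<Rightarrow> 'a set" where
  "carr L = {x + y | x y. x \<in> part L 0 \<and> y \<in> part L 1}"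

text \<open>\<open>koszul i j\<close> is $(-1)^{ij}$.\<close>

definition koszul :: "bit \<Rightarrow> bit \<Rightarrow> 'k::field" where
  "koszul i j = (if i = 1 \<and> j = 1 then - 1 else 1)"

locale lie_superalgebra = vector_space "scl L"
  for L :: "('k::field, 'a::ab_group_add) superalgebra" +
  assumes subspace_part: "subspace (part L i)"
    and part_Int: "part L 0 \<inter> part L 1 = {0}"
    and brk_add_left: "\<lbrakk>x \<in> carr L; y \<in> carr L; z \<in> carr L\<rbrakk> \<Longrightarrow> brk L (x + y) z = brk L x z + brk L y z"
    and brk_add_right: "\<lbrakk>x \<in> carr L; y \<in> carr L; z \<in> carr L\<rbrakk> \<Longrightarrow> brk L x (y + z) = brk L x y + brk L x z"
    and brk_scl_left: "\<lbrakk>x \<in> carr L; y \<in> carr L\<rbrakk> \<Longrightarrow> brk L (scl L c x) y = scl L c (brk L x y)"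
    and brk_scl_right: "\<lbrakk>x \<in> carr L; y \<in> carr L\<rbrakk> \<Longrightarrow> brk L x (scl L c y) = scl L c (brk L x y)"
    and brk_part: "\<lbrakk>x \<in> part L i; y \<in> part L j\<rbrakk> \<Longrightarrow> brk L x y \<in> part L (i + j)"
    and brk_skew: "\<lbrakk>x \<in> part L i; y \<in> part L j\<rbrakk> \<Longrightarrow> brk L x y = - scl L (koszul i j) (brk L y x)"
    and brk_jacobi: "\<lbrakk>x \<in> part L i; y \<in> part L j; z \<in> part L k\<rbrakk> \<Longrightarrow>
      brk L x (brk L y z) = brk L (brk L x y) z + scl L (koszul i j) (brk L y (brk L x z))"

text \<open>\<open>brk_span L A B\<close> is the subspace $[A,B]$.\<close>

definition brk_span :: "('k::field, 'a::ab_group_add) superalgebra \<Rightarrow> 'a set \<Rightarrow> 'a set \<Rightarrow> 'a set" where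
  "brk_span L A B = module.span (scl L) {brk L a b | a b. a \<in> A \<and> b \<in> B}"

definition derived :: "('k::field, 'a::ab_group_add) superalgebra \<Rightarrow> 'a set" where
  "derived L = brk_span L (carr L) (carr L)"

fun lower_central :: "('k::field, 'a::ab_group_add) superalgebra \<Rightarrow> nat \<Rightarrow> 'a set" where
  "lower_central L 0 = carr L"
| "lower_central L (Suc k) = brk_span L (carr L) (lower_central L k)"

definition nilpotent_lsa :: "('k::field, 'a::ab_group_add) superalgebra \<Rightarrow> bool" where
  "nilpotent_lsa L \<longleftrightarrow> (\<exists>k>0. lower_central L k = {0})"

definition abelian_lsa :: "('k, 'a::ab_group_add) superalgebra \<Rightarrow> bool" where
  "abelian_lsa L \<longleftrightarrow> (\<forall>x\<in>carr L. \<forall>y\<in>carr L. brk L x y = 0)"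

definition fin_dim :: "('k::field, 'a::ab_group_add) superalgebra \<Rightarrow> bool" where
  "fin_dim L \<longleftrightarrow> (\<exists>B. finite B \<and> carr L \<subseteq> module.span (scl L) B)"

text \<open>The pair $(\dim V_{\bar 0}, \dim V_{\bar 1})$ for a graded subspace \<open>V\<close> of \<open>L\<close>. As
  \<^const>\<open>vector_space.dim\<close> is \<open>0\<close> on infinite-dimensional spaces, it is only meaningful together
  with \<^const>\<open>fin_dim\<close>.\<close>

definition sdim :: "('k::field, 'a::ab_group_add) superalgebra \<Rightarrow> 'a set \<Rightarrow> nat \<times> nat" where
  "sdim L V = (vector_space.dim (scl L) (V \<inter> part L 0), vector_space.dim (scl L) (V \<inter> part L 1))"

definition lsa_hom ::
  "('k, 'a::ab_group_add) superalgebra \<Rightarrow> ('k, 'b::ab_group_add) superalgebra \<Rightarrow> ('a \<Rightarrow> 'b) \<Rightarrow> bool" where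
  "lsa_hom L K \<phi> \<longleftrightarrow>
     (\<forall>x\<in>carr L. \<forall>y\<in>carr L. \<phi> (x + y) = \<phi> x + \<phi> y) \<and>
     (\<forall>c. \<forall>x\<in>carr L. \<phi> (scl L c x) = scl K c (\<phi> x)) \<and>
     (\<forall>i. \<forall>x\<in>part L i. \<phi> x \<in> part K i) \<and>
     (\<forall>x\<in>carr L. \<forall>y\<in>carr L. \<phi> (brk L x y) = brk K (\<phi> x) (\<phi> y))"

definition lsa_isomorphic ::
  "('k, 'a::ab_group_add) superalgebra \<Rightarrow> ('k, 'b::ab_group_add) superalgebra \<Rightarrow> bool" where
  "lsa_isomorphic L K \<longleftrightarrow> (\<exists>\<phi>. lsa_hom L K \<phi> \<and> bij_betw \<phi> (carr L) (carr K))"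

definition direct_sum ::
  "('k, 'a) superalgebra \<Rightarrow> ('k, 'b) superalgebra \<Rightarrow> ('k, 'a \<times> 'b) superalgebra" where
  "direct_sum L K =
     \<lparr>scl = (\<lambda>c (x, y). (scl L c x, scl K c y)),
      brk = (\<lambda>(x, y) (x', y'). (brk L x x', brk K y y')),
      part = (\<lambda>i. part L i \<times> part K i)\<rparr>"

text \<open>The superalgebra with homogeneous basis \<open>I\<close>, where \<open>i \<in> I\<close> has parity \<open>d i\<close>, and with
  product extending \<open>c\<close> bilinearly.\<close>

definition pscale :: "'k::field \<Rightarrow> ('i \<Rightarrow>\<^sub>0 'k) \<Rightarrow> ('i \<Rightarrow>\<^sub>0 'k)" where
  "pscale a f = Poly_Mapping.map (\<lambda>b. a * b) f"

definition basis_superalgebra ::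
  "'i set \<Rightarrow> ('i \<Rightarrow> bit) \<Rightarrow> ('i \<Rightarrow> 'i \<Rightarrow> ('i \<Rightarrow>\<^sub>0 'k)) \<Rightarrow> ('k::field, 'i \<Rightarrow>\<^sub>0 'k) superalgebra" where
  "basis_superalgebra I d c =
     \<lparr>scl = pscale,
      brk = (\<lambda>f g. \<Sum>i\<in>Poly_Mapping.keys f. \<Sum>j\<in>Poly_Mapping.keys g.
               pscale (Poly_Mapping.lookup f i * Poly_Mapping.lookup g j) (c i j)),
      part = (\<lambda>e. {f. \<forall>i\<in>Poly_Mapping.keys f. i \<in> I \<and> d i = e})\<rparr>"

datatype heis_index = HX nat | HZ | HY nat

fun heis_parity :: "heis_index \<Rightarrow> bit" where
  "heis_parity (HX _) = 0"
| "heis_parity HZ = 0"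
| "heis_parity (HY _) = 1"

definition heis_basis :: "nat \<Rightarrow> nat \<Rightarrow> heis_index set" where
  "heis_basis m n = HX ` {1..2 * m} \<union> {HZ} \<union> HY ` {1..n}"

fun heis_const :: "nat \<Rightarrow> heis_index \<Rightarrow> heis_index \<Rightarrow> (heis_index \<Rightarrow>\<^sub>0 'k::field)" where
  "heis_const m (HX i) (HX j) =
     (if j = m + i then Poly_Mapping.single HZ 1
      else if i = m + j then - Poly_Mapping.single HZ 1 else 0)"
| "heis_const m (HY i) (HY j) = (if i = j then Poly_Mapping.single HZ 1 else 0)"
| "heis_const m _ _ = 0"

definition heisenberg :: "nat \<Rightarrow> nat \<Rightarrow> ('k::field, heis_index \<Rightarrow>\<^sub>0 'k) superalgebra" where
  "heisenberg m n = basis_superalgebra (heis_basis m n) heis_parity (heis_const m)"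

text \<open>The free nonassociative superalgebra on the set \<open>X\<close> graded by \<open>p\<close> has the nonassociative
  words in \<open>X\<close> as a basis. The free Lie superalgebra is its quotient by the ideal generated by the
  graded skew-symmetry and the graded Jacobi identities.\<close>

datatype (letters: 'x) word = Gen 'x | Mul "'x word" "'x word"

primrec word_parity :: "('x \<Rightarrow> bit) \<Rightarrow> 'x word \<Rightarrow> bit" where
  "word_parity p (Gen x) = p x"
| "word_parity p (Mul u v) = word_parity p u + word_parity p v"

definition free_nonassoc :: "'x set \<Rightarrow> ('x \<Rightarrow> bit) \<Rightarrow> ('k::field, 'x word \<Rightarrow>\<^sub>0 'k) superalgebra" where
  "free_nonassoc X p =
     basis_superalgebra {w. letters w \<subseteq> X} (word_parity p) (\<lambda>u v. Poly_Mapping.single (Mul u v) 1)"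

inductive_set lie_ideal :: "'x set \<Rightarrow> ('x \<Rightarrow> bit) \<Rightarrow> ('x word \<Rightarrow>\<^sub>0 'k::field) set"
  for X :: "'x set" and p :: "'x \<Rightarrow> bit" where
  skew: "\<lbrakk>a \<in> part (free_nonassoc X p) i; b \<in> part (free_nonassoc X p) j\<rbrakk> \<Longrightarrow>
    brk (free_nonassoc X p) a b + pscale (koszul i j) (brk (free_nonassoc X p) b a) \<in> lie_ideal X p"
| jacobi: "\<lbrakk>a \<in> part (free_nonassoc X p) i; b \<in> part (free_nonassoc X p) j;
      c \<in> part (free_nonassoc X p) k\<rbrakk> \<Longrightarrow>
    brk (free_nonassoc X p) a (brk (free_nonassoc X p) b c)
      - brk (free_nonassoc X p) (brk (free_nonassoc X p) a b) c
      - pscale (koszul i j) (brk (free_nonassoc X p) b (brk (free_nonassoc X p) a c)) \<in> lie_ideal X p"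
| zero: "0 \<in> lie_ideal X p"
| add: "\<lbrakk>a \<in> lie_ideal X p; b \<in> lie_ideal X p\<rbrakk> \<Longrightarrow> a + b \<in> lie_ideal X p"
| scale: "a \<in> lie_ideal X p \<Longrightarrow> pscale r a \<in> lie_ideal X p"
| left: "\<lbrakk>a \<in> carr (free_nonassoc X p); b \<in> lie_ideal X p\<rbrakk> \<Longrightarrow>
    brk (free_nonassoc X p) a b \<in> lie_ideal X p"
| right: "\<lbrakk>a \<in> lie_ideal X p; b \<in> carr (free_nonassoc X p)\<rbrakk> \<Longrightarrow>
    brk (free_nonassoc X p) a b \<in> lie_ideal X p"

primrec eval_word :: "('k, 'a) superalgebra \<Rightarrow> ('x \<Rightarrow> 'a) \<Rightarrow> 'x word \<Rightarrow> 'a" where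
  "eval_word L \<iota> (Gen x) = \<iota> x"
| "eval_word L \<iota> (Mul u v) = brk L (eval_word L \<iota> u) (eval_word L \<iota> v)"

definition eval_nonassoc ::
  "('k::field, 'a::ab_group_add) superalgebra \<Rightarrow> ('x \<Rightarrow> 'a) \<Rightarrow> ('x word \<Rightarrow>\<^sub>0 'k) \<Rightarrow> 'a" where
  "eval_nonassoc L \<iota> f =
     (\<Sum>w\<in>Poly_Mapping.keys f. scl L (Poly_Mapping.lookup f w) (eval_word L \<iota> w))"

text \<open>\<open>F\<close> is free on the set \<open>X\<close> graded by \<open>p\<close>, mapped into \<open>F\<close> by \<open>\<iota>\<close>: the morphism from the
  free nonassociative superalgebra to \<open>F\<close> extending \<open>\<iota>\<close> identifies \<open>F\<close> with the quotient by
  \<^const>\<open>lie_ideal\<close>. The universal property is proved as \<open>free_lsa_on_universal\<close> below.\<close>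

definition free_lsa_on ::
  "('k::field, 'f::ab_group_add) superalgebra \<Rightarrow> 'x set \<Rightarrow> ('x \<Rightarrow> bit) \<Rightarrow> ('x \<Rightarrow> 'f) \<Rightarrow> bool" where
  "free_lsa_on F X p \<iota> \<longleftrightarrow>
     lie_superalgebra F \<and> (\<forall>x\<in>X. \<iota> x \<in> part F (p x)) \<and>
     eval_nonassoc F \<iota> ` carr (free_nonassoc X p) = carr F \<and>
     {f \<in> carr (free_nonassoc X p). eval_nonassoc F \<iota> f = 0} = lie_ideal X p"

definition free_presentation ::
  "('k::field, 'f::ab_group_add) superalgebra \<Rightarrow> 'x set \<Rightarrow> ('x \<Rightarrow> bit) \<Rightarrow> ('x \<Rightarrow> 'f) \<Rightarrow> ('f \<Rightarrow> 'a)
    \<Rightarrow> ('k, 'a::ab_group_add) superalgebra \<Rightarrow> bool" where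
  "free_presentation F X p \<iota> \<phi> L \<longleftrightarrow>
     free_lsa_on F X p \<iota> \<and> lsa_hom F L \<phi> \<and> \<phi> ` carr F = carr L"

definition ker_in :: "('k, 'f::ab_group_add) superalgebra \<Rightarrow> ('f \<Rightarrow> 'a::zero) \<Rightarrow> 'f set" where
  "ker_in F \<phi> = {x \<in> carr F. \<phi> x = 0}"

text \<open>For subspaces \<open>B \<subseteq> A\<close>, \<open>S\<close> is a set of representatives in \<open>A\<close>, one for each element, of a basis
  of the quotient space \<open>A / B\<close>; hence \<open>quot_dim\<close> is the dimension of \<open>A / B\<close>. As for
  \<^const>\<open>vector_space.dim\<close>, it is \<open>0\<close> when the quotient is infinite-dimensional.\<close>

definition quot_basis ::
  "('k::field \<Rightarrow> 'a::ab_group_add \<Rightarrow> 'a) \<Rightarrow> 'a set \<Rightarrow> 'a set \<Rightarrow> 'a set \<Rightarrow> bool" where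
  "quot_basis sc A B S \<longleftrightarrow>
     S \<subseteq> A \<and> A \<subseteq> module.span sc (B \<union> S) \<and> (\<forall>s\<in>S. s \<notin> module.span sc (B \<union> (S - {s})))"

definition quot_fin_dim :: "('k::field \<Rightarrow> 'a::ab_group_add \<Rightarrow> 'a) \<Rightarrow> 'a set \<Rightarrow> 'a set \<Rightarrow> bool" where
  "quot_fin_dim sc A B \<longleftrightarrow> (\<exists>S. finite S \<and> quot_basis sc A B S)"

definition quot_dim :: "('k::field \<Rightarrow> 'a::ab_group_add \<Rightarrow> 'a) \<Rightarrow> 'a set \<Rightarrow> 'a set \<Rightarrow> nat" where
  "quot_dim sc A B = card (SOME S. quot_basis sc A B S)"

text \<open>The multiplier $([F,F] \cap R) / [F,R]$ of the presentation, where $R$ is the kernel.\<close>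

definition multiplier_fin_dim :: "('k::field, 'f::ab_group_add) superalgebra \<Rightarrow> ('f \<Rightarrow> 'a::zero) \<Rightarrow> bool" where
  "multiplier_fin_dim F \<phi> \<longleftrightarrow>
     quot_fin_dim (scl F) (derived F \<inter> ker_in F \<phi>) (brk_span F (carr F) (ker_in F \<phi>))"

definition multiplier_dim :: "('k::field, 'f::ab_group_add) superalgebra \<Rightarrow> ('f \<Rightarrow> 'a::zero) \<Rightarrow> nat" where
  "multiplier_dim F \<phi> =
     quot_dim (scl F) (derived F \<inter> ker_in F \<phi>) (brk_span F (carr F) (ker_in F \<phi>))"

lemma lookup_pscale [simp]: "Poly_Mapping.lookup (pscale a f) i = a * Poly_Mapping.lookup f i"
  unfolding pscale_def by (simp add: Poly_Mapping.map.rep_eq when_def)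

lemma vector_space_pscale: "vector_space (pscale :: 'k::field \<Rightarrow> ('i \<Rightarrow>\<^sub>0 'k) \<Rightarrow> _)"
  by unfold_locales (auto intro!: poly_mapping_eqI simp: lookup_add algebra_simps)

lemma bit_cases: "(i::bit) = 0 \<or> i = 1" by (cases i) auto

lemma (in lie_superalgebra) subspace_carr: "subspace (carr L)"
  using subspace_sums[OF subspace_part[of 0] subspace_part[of 1]] by (simp add: carr_def)

lemma (in lie_superalgebra) part_carr: "x \<in> part L i \<Longrightarrow> x \<in> carr L"
proof -
  assume x: "x \<in> part L i"
  have z: "0 \<in> part L 0" "0 \<in> part L 1" using subspace_part subspace_0 by auto
  have "x = x + 0" "x = 0 + x" by auto
  then show ?thesis unfolding carr_def using x z bit_cases[of i] by blast
qed

lemma (in lie_superalgebra) brk_carr: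
  assumes "x \<in> carr L" "y \<in> carr L" shows "brk L x y \<in> carr L"
proof -
  obtain a b c d where h: "x = a + b" "y = c + d" "a \<in> part L 0" "b \<in> part L 1" "c \<in> part L 0" "d \<in> part L 1"
    using assms unfolding carr_def by blast
  then have "brk L x y = brk L a c + brk L a d + (brk L b c + brk L b d)"
    using part_carr assms by (simp add: brk_add_left brk_add_right)
  moreover have "brk L a c \<in> carr L" "brk L a d \<in> carr L" "brk L b c \<in> carr L" "brk L b d \<in> carr L"
    using h by (blast intro: part_carr brk_part)+
  ultimately show ?thesis by (simp add: subspace_add[OF subspace_carr])
qed

lemma (in lie_superalgebra) brk_0:
  assumes "x \<in> carr L" shows "brk L 0 x = 0" "brk L x 0 = 0"
  using brk_scl_left[of 0 x 0] brk_scl_right[of x 0 0] assms subspace_0[OF subspace_carr] by auto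

lemma (in lie_superalgebra) brk_sum_left:
  assumes "\<And>i. i \<in> I \<Longrightarrow> f i \<in> carr L" "y \<in> carr L"
  shows "brk L (sum f I) y = (\<Sum>i\<in>I. brk L (f i) y)"
  using assms
proof (induction I rule: infinite_finite_induct)
  case (insert i I)
  then show ?case by (simp add: brk_add_left subspace_sum[OF subspace_carr])
qed (auto simp: brk_0)

lemma (in lie_superalgebra) brk_sum_right:
  assumes "\<And>i. i \<in> I \<Longrightarrow> f i \<in> carr L" "y \<in> carr L"
  shows "brk L y (sum f I) = (\<Sum>i\<in>I. brk L y (f i))"
  using assms
proof (induction I rule: infinite_finite_induct)
  case (insert i I)
  then show ?case by (simp add: brk_add_right subspace_sum[OF subspace_carr])
qed (auto simp: brk_0)

lemma carr_basis: "carr (basis_superalgebra I d c) = {f. Poly_Mapping.keys f \<subseteq> I}" (is "?l = ?r")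
proof
  show "?l \<subseteq> ?r" unfolding carr_def basis_superalgebra_def using Poly_Mapping.keys_add by fastforce
  show "?r \<subseteq> ?l"
  proof
    fix f :: "'a \<Rightarrow>\<^sub>0 'b" assume f: "f \<in> ?r"
    define q where "q e = Poly_Mapping.Abs_poly_mapping (\<lambda>i. if d i = e then Poly_Mapping.lookup f i else 0)" for e
    have l: "Poly_Mapping.lookup (q e) i = (if d i = e then Poly_Mapping.lookup f i else 0)" for e i
    proof -
      have "finite {i. (if d i = e then Poly_Mapping.lookup f i else 0) \<noteq> 0}"
        by (rule finite_subset[OF _ finite_keys[of f]]) (auto simp: in_keys_iff split: if_splits)
      then show ?thesis unfolding q_def by (simp add: Abs_poly_mapping_inverse)
    qed
    have "f = q 0 + q 1" by (rule poly_mapping_eqI) (use bit_cases in \<open>auto simp: lookup_add l\<close>)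
    moreover have "q e \<in> part (basis_superalgebra I d c) e" for e
      using f by (auto simp: basis_superalgebra_def in_keys_iff l split: if_splits)
    ultimately show "f \<in> ?l" unfolding carr_def by blast
  qed
qed

lemma carr_free: "carr (free_nonassoc X p) = {f. \<forall>w\<in>Poly_Mapping.keys f. letters w \<subseteq> X}"
  unfolding free_nonassoc_def carr_basis by auto

locale word_evaluation = lie_superalgebra K for K :: "('k::field, 'b::ab_group_add) superalgebra" +
  fixes X :: "'x set" and p and g
  assumes g: "x \<in> X \<Longrightarrow> g x \<in> part K (p x)"
begin

lemma ew: "letters w \<subseteq> X \<Longrightarrow> eval_word K g w \<in> part K (word_parity p w)"
proof (induction w)
  case (Mul u v)
  then show ?case using brk_part[of "eval_word K g u" _ "eval_word K g v"] by simp
qed (simp add: g)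

abbreviation "e \<equiv> eval_nonassoc K g"
abbreviation "N \<equiv> free_nonassoc X p :: ('k, 'x word \<Rightarrow>\<^sub>0 'k) superalgebra"

lemma e_super: "finite S \<Longrightarrow> Poly_Mapping.keys f \<subseteq> S \<Longrightarrow>
   e f = (\<Sum>w\<in>S. scl K (Poly_Mapping.lookup f w) (eval_word K g w))"
  unfolding eval_nonassoc_def
  by (rule sum.mono_neutral_left) (auto simp: in_keys_iff)

lemma e_add: "e (f + h) = e f + e h"
proof -
  let ?S = "Poly_Mapping.keys f \<union> Poly_Mapping.keys h"
  show ?thesis using Poly_Mapping.keys_add[of f h]
    by (simp add: e_super[of ?S] lookup_add scale_left_distrib sum.distrib)
qed

lemma e_scale: "e (pscale c f) = scl K c (e f)"
proof -
  have "Poly_Mapping.keys (pscale c f) \<subseteq> Poly_Mapping.keys f" by (auto simp: in_keys_iff)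
  then show ?thesis by (simp add: e_super[of "Poly_Mapping.keys f"] scale_sum_right)
qed

lemma e_0: "e 0 = 0" by (simp add: eval_nonassoc_def)
lemma e_minus: "e (- f) = - e f" using e_add[of f "-f"] by (simp add: e_0 minus_unique)
lemma e_diff: "e (f - h) = e f - e h" using e_add[of f "-h"] by (simp add: e_minus)
lemma e_sum: "e (sum f I) = (\<Sum>i\<in>I. e (f i))"
  by (induction I rule: infinite_finite_induct) (auto simp: e_0 e_add)
lemma e_single: "e (Poly_Mapping.single w 1) = eval_word K g w" by (simp add: eval_nonassoc_def)

lemma e_part: "f \<in> part N i \<Longrightarrow> e f \<in> part K i"
  unfolding eval_nonassoc_def free_nonassoc_def basis_superalgebra_def
  by (auto intro!: subspace_sum[OF subspace_part] subspace_scale[OF subspace_part] dest: ew)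

lemma e_carr: "f \<in> carr N \<Longrightarrow> e f \<in> carr K"
  unfolding carr_free eval_nonassoc_def
  by (auto intro!: subspace_sum[OF subspace_carr] subspace_scale[OF subspace_carr] dest: ew part_carr)

lemma e_brk: assumes "f \<in> carr N" "h \<in> carr N" shows "e (brk N f h) = brk K (e f) (e h)"
proof -
  have c: "eval_word K g w \<in> carr K" if "w \<in> Poly_Mapping.keys f \<union> Poly_Mapping.keys h" for w
    using assms that part_carr[OF ew] unfolding carr_free by blast
  then have c': "scl K a (eval_word K g w) \<in> carr K" if "w \<in> Poly_Mapping.keys f \<union> Poly_Mapping.keys h" for w a
    using that subspace_scale[OF subspace_carr] by auto
  have "brk K (e f) (e h) = (\<Sum>u\<in>Poly_Mapping.keys f. \<Sum>v\<in>Poly_Mapping.keys h. brk K (scl K (Poly_Mapping.lookup f u) (eval_word K g u)) (scl K (Poly_Mapping.lookup h v) (eval_word K g v)))"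
    unfolding eval_nonassoc_def using c'
    by (simp add: brk_sum_left brk_sum_right subspace_sum[OF subspace_carr]) (rule sum.swap)
  also have "\<dots> = e (brk N f h)"
    unfolding free_nonassoc_def basis_superalgebra_def using c c'
    by (simp add: e_sum e_scale e_single brk_scl_left brk_scl_right mult.commute cong: sum.cong)
  finally show ?thesis by simp
qed

lemma N_carr: "f \<in> part N i \<Longrightarrow> f \<in> carr N"
  unfolding carr_free by (auto simp: free_nonassoc_def basis_superalgebra_def)

lemma N_add: "f \<in> carr N \<Longrightarrow> h \<in> carr N \<Longrightarrow> f + h \<in> carr N"
  unfolding carr_free using Poly_Mapping.keys_add[of f h] by blast
lemma N_scale: "f \<in> carr N \<Longrightarrow> pscale c f \<in> carr N"
  unfolding carr_free by (auto simp: in_keys_iff)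
lemma N_0: "0 \<in> carr N" unfolding carr_free by auto
lemma N_minus: "f \<in> carr N \<Longrightarrow> - f \<in> carr N" unfolding carr_free by auto
lemma N_diff: "f \<in> carr N \<Longrightarrow> h \<in> carr N \<Longrightarrow> f - h \<in> carr N" using N_add[of f "-h"] N_minus by auto
lemma N_sum: "(\<And>i. i \<in> I \<Longrightarrow> f i \<in> carr N) \<Longrightarrow> sum f I \<in> carr N"
  by (induction I rule: infinite_finite_induct) (auto simp: N_0 N_add)
lemma N_brk: "f \<in> carr N \<Longrightarrow> h \<in> carr N \<Longrightarrow> brk N f h \<in> carr N"
proof -
  assume a: "f \<in> carr N" "h \<in> carr N"
  have s: "Poly_Mapping.single (Mul u v) 1 \<in> carr N" if "u \<in> Poly_Mapping.keys f" "v \<in> Poly_Mapping.keys h" for u v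
    using a that unfolding carr_free by auto
  have "brk N f h = (\<Sum>u\<in>Poly_Mapping.keys f. \<Sum>v\<in>Poly_Mapping.keys h.
      pscale (Poly_Mapping.lookup f u * Poly_Mapping.lookup h v) (Poly_Mapping.single (Mul u v) 1))"
    by (simp add: free_nonassoc_def basis_superalgebra_def)
  moreover have "\<dots> \<in> carr N"
    by (intro N_sum N_scale s)
  ultimately show ?thesis by simp
qed

lemma e_ideal: "f \<in> lie_ideal X p \<Longrightarrow> e f = 0 \<and> f \<in> carr N"
proof (induction rule: lie_ideal.induct)
  case (skew a i b j)
  note c = N_carr[OF skew(1)] N_carr[OF skew(2)]
  have "e (brk N a b + pscale (koszul i j) (brk N b a))
      = brk K (e a) (e b) + scl K (koszul i j) (brk K (e b) (e a))"
    by (simp add: e_add e_scale e_brk c)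
  also have "\<dots> = 0"
    by (subst brk_skew[OF e_part[OF skew(1)] e_part[OF skew(2)]]) (rule left_minus)
  finally show ?case by (simp add: N_add N_scale N_brk c)
next
  case (jacobi a i b j d k)
  note c = N_carr[OF jacobi(1)] N_carr[OF jacobi(2)] N_carr[OF jacobi(3)]
  have "e (brk N a (brk N b d) - brk N (brk N a b) d - pscale (koszul i j) (brk N b (brk N a d)))
      = brk K (e a) (brk K (e b) (e d)) - brk K (brk K (e a) (e b)) (e d)
        - scl K (koszul i j) (brk K (e b) (brk K (e a) (e d)))"
    by (simp add: e_diff e_scale e_brk N_brk c)
  also have "\<dots> = 0"
    by (subst brk_jacobi[OF e_part[OF jacobi(1)] e_part[OF jacobi(2)] e_part[OF jacobi(3)]])
      (simp only: add_diff_cancel_left' diff_self)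
  finally show ?case by (simp add: N_diff N_scale N_brk c)
next
  case (left a b) then show ?case by (simp add: e_brk N_brk brk_0 e_carr)
next
  case (right a b) then show ?case by (simp add: e_brk N_brk brk_0 e_carr)
qed (auto simp: e_0 e_add e_scale N_0 N_add N_scale)

end

lemma free_lsa_on_universal:
  assumes F: "free_lsa_on F X p \<iota>" and K: "lie_superalgebra K" and g: "\<And>x. x \<in> X \<Longrightarrow> g x \<in> part K (p x)"
  shows "\<exists>\<phi>. lsa_hom F K \<phi> \<and> (\<forall>x\<in>X. \<phi> (\<iota> x) = g x) \<and>
    (\<forall>\<psi>. lsa_hom F K \<psi> \<and> (\<forall>x\<in>X. \<psi> (\<iota> x) = g x) \<longrightarrow> (\<forall>y\<in>carr F. \<psi> y = \<phi> y))"
proof -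
  interpret F: word_evaluation F X p \<iota> using F by (simp add: free_lsa_on_def word_evaluation_def word_evaluation_axioms_def)
  interpret K: word_evaluation K X p g using K g by (simp add: word_evaluation_def word_evaluation_axioms_def)
  have surj: "F.e ` carr F.N = carr F" and ker: "{f \<in> carr F.N. F.e f = 0} = lie_ideal X p"
    using F by (auto simp: free_lsa_on_def)
  define \<phi> where "\<phi> y = K.e (SOME f. f \<in> carr F.N \<and> F.e f = y)" for y
  have \<phi>: "\<phi> (F.e f) = K.e f" if f: "f \<in> carr F.N" for f
  proof -
    define h where "h = (SOME h. h \<in> carr F.N \<and> F.e h = F.e f)"
    have h: "h \<in> carr F.N \<and> F.e h = F.e f" unfolding h_def by (rule someI[of _ f]) (use f in auto)
    then have "h - f \<in> lie_ideal X p" using f by (auto simp: F.N_diff F.e_diff simp flip: ker)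
    then have "K.e (h - f) = 0" using K.e_ideal by auto
    then show ?thesis unfolding \<phi>_def h_def[symmetric] by (simp add: K.e_diff)
  qed
  have ex: "\<exists>f\<in>carr F.N. y = F.e f" if "y \<in> carr F" for y using that surj by auto
  have gen: "Poly_Mapping.single (Gen x) 1 \<in> carr F.N" if "x \<in> X" for x using that by (auto simp: carr_free)
  have hom: "lsa_hom F K \<phi>"
    unfolding lsa_hom_def
  proof (intro conjI allI ballI)
    fix x y assume "x \<in> carr F" "y \<in> carr F"
    then obtain f h where c: "f \<in> carr F.N" "h \<in> carr F.N" and e: "x = F.e f" "y = F.e h"
      using ex by meson
    show "\<phi> (x + y) = \<phi> x + \<phi> y"
      unfolding e \<phi>[OF c(1)] \<phi>[OF c(2)] F.e_add[symmetric] \<phi>[OF F.N_add[OF c]] by (rule K.e_add)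
    show "\<phi> (brk F x y) = brk K (\<phi> x) (\<phi> y)"
      unfolding e \<phi>[OF c(1)] \<phi>[OF c(2)] F.e_brk[OF c, symmetric] \<phi>[OF F.N_brk[OF c]]
      by (rule K.e_brk[OF c])
  next
    fix a x assume "x \<in> carr F"
    then obtain f where c: "f \<in> carr F.N" and e: "x = F.e f" using ex by meson
    show "\<phi> (scl F a x) = scl K a (\<phi> x)"
      unfolding e \<phi>[OF c] F.e_scale[symmetric] \<phi>[OF F.N_scale[OF c]] by (rule K.e_scale)
  next
    fix i x assume x: "x \<in> part F i"
    then obtain f where f: "f \<in> carr F.N" "x = F.e f" using ex F.part_carr by meson
    then obtain a b where ab: "f = a + b" "a \<in> part F.N 0" "b \<in> part F.N 1" unfolding carr_def by blast
    have *: "F.e a \<in> part F 0" "F.e b \<in> part F 1" using ab F.e_part by auto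
    have xx: "x = F.e a + F.e b" using f ab F.e_add by simp
    have disj: "u = 0" if "u \<in> part F 0" "u \<in> part F 1" for u
      using that F.part_Int by (metis IntI singletonD)
    have "\<exists>h. h \<in> part F.N i \<and> x = F.e h"
    proof (cases "i = 0")
      case True
      then have "x - F.e a \<in> part F 0"
        using F.subspace_diff[OF F.subspace_part x[unfolded True] *(1)] by (simp only:)
      moreover have "x - F.e a = F.e b" unfolding xx by (rule add_diff_cancel_left')
      ultimately have "F.e b = 0" using disj *(2) by metis
      then have "x = F.e a" unfolding xx by simp
      then show ?thesis using ab(2) True by blast
    next
      case False
      then have i: "i = 1" using bit_cases by blast
      have "x - F.e b \<in> part F 1"
        using F.subspace_diff[OF F.subspace_part x[unfolded i] *(2)] by (simp only:)
      moreover have "x - F.e b = F.e a" unfolding xx by (rule add_diff_cancel_right')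
      ultimately have "F.e a = 0" using disj *(1) by metis
      then have "x = F.e b" unfolding xx by simp
      then show ?thesis using ab(3) i by blast
    qed
    then obtain h where h: "h \<in> part F.N i" and e: "x = F.e h" by blast
    show "\<phi> x \<in> part K i"
      unfolding e \<phi>[OF F.N_carr[OF h]] by (rule K.e_part[OF h])
  qed
  have ext: "\<phi> (\<iota> x) = g x" if "x \<in> X" for x
    using \<phi>[OF gen[OF that]] by (simp add: F.e_single K.e_single)
  have uniq: "\<psi> y = \<phi> y" if \<psi>: "lsa_hom F K \<psi>" "\<forall>x\<in>X. \<psi> (\<iota> x) = g x" and y: "y \<in> carr F" for \<psi> y
  proof -
    have z: "\<psi> 0 = 0"
    proof -
      have "\<psi> (0 + 0) = \<psi> 0 + \<psi> 0"
        using \<psi>(1) F.subspace_0[OF F.subspace_carr] unfolding lsa_hom_def by blast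
      then show ?thesis by simp
    qed
    have w: "\<psi> (eval_word F \<iota> w) = eval_word K g w" if "letters w \<subseteq> X" for w
      using that
    proof (induction w)
      case (Mul u v)
      then have "eval_word F \<iota> u \<in> carr F" "eval_word F \<iota> v \<in> carr F" using F.ew F.part_carr by auto
      then show ?case using Mul \<psi> by (simp add: lsa_hom_def)
    qed (use \<psi> in auto)
    have s: "\<psi> (sum t I) = (\<Sum>i\<in>I. \<psi> (t i))" if "\<And>i. i \<in> I \<Longrightarrow> t i \<in> carr F" for t :: "'x word \<Rightarrow> _" and I
      using that
    proof (induction I rule: infinite_finite_induct)
      case (insert i I)
      then show ?case using \<psi>(1) F.subspace_sum[OF F.subspace_carr, of I t] by (simp add: lsa_hom_def)
    qed (auto simp: z)
    obtain f where f: "f \<in> carr F.N" "y = F.e f" using ex y by meson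
    have l: "letters u \<subseteq> X" if "u \<in> Poly_Mapping.keys f" for u
      using that f(1) unfolding carr_free by blast
    then have c: "eval_word F \<iota> u \<in> carr F" if "u \<in> Poly_Mapping.keys f" for u
      using that F.part_carr[OF F.ew] by blast
    have "\<psi> (F.e f) = (\<Sum>u\<in>Poly_Mapping.keys f. \<psi> (scl F (Poly_Mapping.lookup f u) (eval_word F \<iota> u)))"
      unfolding eval_nonassoc_def by (rule s) (rule F.subspace_scale[OF F.subspace_carr c])
    also have "\<dots> = K.e f"
      unfolding eval_nonassoc_def
    proof (rule sum.cong)
      fix u assume u: "u \<in> Poly_Mapping.keys f"
      have "\<psi> (scl F a (eval_word F \<iota> u)) = scl K a (\<psi> (eval_word F \<iota> u))" for a
        using \<psi>(1) c[OF u] unfolding lsa_hom_def by blast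
      then show "\<psi> (scl F (Poly_Mapping.lookup f u) (eval_word F \<iota> u))
          = scl K (Poly_Mapping.lookup f u) (eval_word K g u)"
        using w[OF l[OF u]] by simp
    qed simp
    finally have "\<psi> (F.e f) = K.e f" .
    then show ?thesis using \<phi> f by simp
  qed
  show ?thesis
  proof (intro exI[of _ \<phi>] conjI ballI allI impI)
    show "\<psi> y = \<phi> y" if "lsa_hom F K \<psi> \<and> (\<forall>x\<in>X. \<psi> (\<iota> x) = g x)" "y \<in> carr F" for \<psi> y
      using that by (elim conjE) (rule uniq)
  qed (fact hom, erule ext)
qed

end

theory Submission
  imports Defs
begin

text \<open>Let \<open>R\<close> be the kernel of \<open>F \<rightarrow> L\<close>, \<open>g = m + n - r - s\<close> and \<open>d = r + s\<close>. Since \<open>F' / (F' \<inter> R)\<close> is \<open>L'\<close>, it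
  suffices to span \<open>F' / [F,R]\<close>. Choose homogeneous \<open>u\<close>, \<open>v\<close> with \<open>z = [u,v]\<close> outside \<open>[L,L']\<close>, and a
  hyperplane \<open>J \<supseteq> [L,L']\<close> of \<open>L'\<close> not containing \<open>z\<close>. Modulo \<open>[F,R]\<close>, \<open>F'\<close> is spanned by the brackets of
  a lifted homogeneous basis of \<open>L / L'\<close>, which number \<open>g(g-1)/2 + n - s\<close>, by the \<open>g(d-1)\<close> brackets of
  such a basis with a lifted basis of \<open>J\<close>, and, by the Jacobi identity, by only two further elements
  \<open>[u,[u,v]]\<close> and \<open>[v,[u,v]]\<close>. This gives the bound, improved by \<open>s\<close>; so equality never holds for \<open>s > 0\<close>.

  If \<open>d = 1\<close> and equality holds, then \<open>[u,[u,v]] \<notin> [F,R]\<close> whenever \<open>[u,v] \<noteq> 0\<close>. For odd \<open>u = v\<close> this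
  contradicts \<open>[u,[u,u]] = 0\<close>, and if the bracket form on \<open>L / L'\<close> had two orthogonal hyperbolic planes
  it would contradict the Jacobi identity. So the form is even of rank two and \<open>L\<close> is \<open>H(1,0)\<close> plus an
  abelian summand. Conversely, a scalar 2-cocycle \<open>f\<close> of \<open>L\<close> yields a central extension, hence a linear form on
  \<open>F\<close> with \<open>[a,b] \<mapsto> f(\<phi> a, \<phi> b)\<close>, which vanishes on \<open>[F,R]\<close>. The products \<open>\<alpha> \<and> \<beta>\<close> of coordinate forms
  give as many independent such forms as the bound requires.\<close>

section \<open>Linear algebra modulo a subspace\<close>

text \<open>\<open>F\<close> and [F,R] are in general infinite-dimensional, so dimensions cannot be
  subtracted; all counting is by sets independent modulo a subspace, compared through an exchange
  argument. The constants balance as follows. With m + n = g + d, the spanning set of F' / [F,R] has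
  g(g-1)/2 + n - s + g(d-1) + 2 elements, and removing the d elements needed for L' leaves exactly
  the claimed bound minus s. Equality therefore needs s = 0 and leaves no room for dropping either
  of the two further elements; this is what the extremal case exploits. In the lower bound for d =
  1, the pair y, w of the hyperbolic plane is lost, because [y,w] is not 0, while the two pairs of y
  and w with the central z = [y,w] are gained. The forms y* \<and> z* and w* \<and> z* are closed
  because the bracket is carried by y* \<and> w*, whose product with y* or w* vanishes. Brackets are
  unspecified outside \<open>carr\<close>, and the sign rules hold for homogeneous elements only,
  which is why nearly every statement is restricted to \<open>carr\<close> or to graded
  subspaces.\<close>

definition indep_mod ::
  "('k::field \<Rightarrow> 'a::ab_group_add \<Rightarrow> 'a) \<Rightarrow> 'a set \<Rightarrow> 'a set \<Rightarrow> bool" where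
  "indep_mod sc B S \<longleftrightarrow> (\<forall>s\<in>S. s \<notin> module.span sc (B \<union> (S - {s})))"

context vector_space
begin

lemma quot_basis_iff:
  "quot_basis scale A B S \<longleftrightarrow> S \<subseteq> A \<and> A \<subseteq> span (B \<union> S) \<and> indep_mod scale B S"
  unfolding quot_basis_def indep_mod_def by simp

lemma span_Un_cong_left: "span B = span C \<Longrightarrow> span (B \<union> S) = span (C \<union> S)"
  by (simp add: span_Un)

text \<open>A dependence involves only finitely many elements of \<open>S\<close>, so finite subsets
  suffice; these are built up one element at a time, each outside the span of its
  predecessors.\<close>

lemma independent_Un_indep_mod:
  assumes C: "independent C" and S: "indep_mod scale C S"
  shows "independent (C \<union> S)"
proof -
  have fin: "independent (C \<union> T)" if "finite T" "T \<subseteq> S" for T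
    using that
  proof (induction T)
    case (insert t T)
    have "t \<notin> span (C \<union> (S - {t}))" using S insert.prems unfolding indep_mod_def by blast
    moreover have "span (C \<union> T) \<subseteq> span (C \<union> (S - {t}))"
      using insert by (intro span_mono) blast
    ultimately have "t \<notin> span (C \<union> T)" by blast
    then show ?case using insert by (simp add: independent_insertI)
  qed (simp add: C)
  show ?thesis
    unfolding independent_explicit_finite_subsets
  proof (intro allI impI ballI)
    fix T u v
    assume T: "T \<subseteq> C \<union> S" "finite T" and u: "(\<Sum>v\<in>T. scale (u v) v) = 0" and v: "v \<in> T"
    have "independent T"
      by (rule independent_mono[OF fin[of "T \<inter> S"]]) (use T in auto)
    then show "u v = 0"
      using independent_explicit_finite_subsets T(2) u v by blast
  qed
qed

text \<open>Steinitz exchange modulo \<open>B\<close>, which may be infinite-dimensional. A linear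
  map that kills a basis \<open>C\<close> of \<open>B\<close> and fixes \<open>S\<close> sends
  \<open>span (C \<union> T)\<close> into the span of the image of \<open>T\<close>, so the ordinary
  exchange lemma applies.\<close>

lemma indep_mod_span_bound:
  assumes T: "finite T" and S: "indep_mod scale B S" and sub: "S \<subseteq> span (B \<union> T)"
  shows "finite S \<and> card S \<le> card T"
proof -
  obtain C where C: "C \<subseteq> span B" "independent C" "span B \<subseteq> span C"
    using maximal_independent_subset by blast
  have BC: "span B = span C"
    using C span_minimal[OF C(1) subspace_span] by blast
  have "indep_mod scale C S"
    using S unfolding indep_mod_def using span_Un_cong_left[OF BC] by metis
  note CS = independent_Un_indep_mod[OF C(2) this]
  have disj: "C \<inter> S = {}"
  proof -
    have "C \<subseteq> span (B \<union> X)" for X using C(1) span_mono[of B "B \<union> X"] by blast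
    then show ?thesis using S unfolding indep_mod_def by blast
  qed
  interpret vector_space_pair scale scale by unfold_locales
  obtain f where f: "Vector_Spaces.linear scale scale f" "\<forall>x\<in>C \<union> S. f x = (if x \<in> C then 0 else x)"
    using linear_independent_extend[OF CS, of "\<lambda>x. if x \<in> C then 0 else x"] by auto
  have z: "f x = 0" if "x \<in> span C" for x
    using linear_eq_0_on_span[OF f(1) _ that] f(2) by simp
  have "S = f ` S" using f(2) disj by force
  also have "\<dots> \<subseteq> f ` span (C \<union> T)" using sub span_Un_cong_left[OF BC] by blast
  also have "\<dots> = span (f ` C \<union> f ` T)"
    using linear_span_image[OF f(1), of "C \<union> T"] by (simp add: image_Un)
  also have "\<dots> \<subseteq> span (f ` T)"
    using z span_base[of _ C] by (intro span_minimal) (auto intro: span_base span_zero)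
  finally have "S \<subseteq> span (f ` T)" .
  moreover have "independent S" by (rule independent_mono[OF CS]) simp
  ultimately have "finite S \<and> card S \<le> card (f ` T)"
    using independent_span_bound[of "f ` T" S] T by simp
  then show ?thesis using card_image_le[OF T, of f] by linarith
qed

lemma quot_basis_exists:
  assumes "B \<subseteq> A" "subspace B" "subspace A"
  shows "\<exists>S. quot_basis scale A B S"
proof -
  obtain C where C: "C \<subseteq> B" "independent C" "B \<subseteq> span C"
    using maximal_independent_subset by blast
  obtain D where D: "C \<subseteq> D" "D \<subseteq> A" "independent D" "A \<subseteq> span D"
    using maximal_independent_subset_extend[of C A] C assms by blast
  have BC: "span B = span C"
    using C span_mono[OF C(1)] span_minimal[OF C(3) subspace_span] by blast
  have "indep_mod scale B (D - C)"
    unfolding indep_mod_def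
  proof
    fix s assume s: "s \<in> D - C"
    have "span (B \<union> (D - C - {s})) = span (C \<union> (D - C - {s}))"
      by (rule span_Un_cong_left[OF BC])
    also have "\<dots> \<subseteq> span (D - {s})" using s D(1) by (intro span_mono) blast
    finally show "s \<notin> span (B \<union> (D - C - {s}))"
      using D(3) s unfolding dependent_def by blast
  qed
  moreover
  have "span D \<subseteq> span (B \<union> (D - C))" using C(1) by (intro span_mono) blast
  then have "A \<subseteq> span (B \<union> (D - C))" using D(4) by (rule subset_trans[rotated])
  ultimately show ?thesis using D(2) unfolding quot_basis_iff by (intro exI[of _ "D - C"]) blast
qed

text \<open>\<open>quot_dim\<close> picks an arbitrary basis, so its value can be read off a given
  one only after the exchange bound has been applied in both directions.\<close>

lemma quot_dim_unique:
  assumes "finite S" "quot_basis scale A B S"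
  shows "quot_dim scale A B = card S"
proof -
  have u: "card T = card S" if "quot_basis scale A B T" for T
  proof -
    note q = assms(2)[unfolded quot_basis_iff] that[unfolded quot_basis_iff]
    have "finite T \<and> card T \<le> card S"
      by (rule indep_mod_span_bound[of S B T]) (use assms(1) q in auto)
    moreover have "finite S \<and> card S \<le> card T"
      by (rule indep_mod_span_bound[of T B S]) (use calculation q in auto)
    ultimately show ?thesis by simp
  qed
  have "quot_basis scale A B (SOME S. quot_basis scale A B S)"
    using someI[of "quot_basis scale A B"] assms(2) by blast
  then show ?thesis unfolding quot_dim_def by (rule u)
qed

text \<open>Independence adds up along the chain from \<open>B\<close> to \<open>A\<close> to the
  whole space: in a relation the \<open>Z\<close>-part lies in \<open>A\<close> and so vanishes,
  which leaves a relation within \<open>S\<close> modulo \<open>B\<close>.\<close>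

lemma indep_mod_Un:
  assumes A: "subspace A" "B \<subseteq> A" and S: "S \<subseteq> A" "indep_mod scale B S" and Z: "indep_mod scale A Z"
  shows "indep_mod scale B (S \<union> Z)" "S \<inter> Z = {}"
proof -
  have nz: "z \<notin> A" if "z \<in> Z" for z
    using that Z unfolding indep_mod_def by (meson UnCI span_base)
  then show "S \<inter> Z = {}" using S(1) by blast
  show "indep_mod scale B (S \<union> Z)"
    unfolding indep_mod_def
  proof
    fix s assume s: "s \<in> S \<union> Z"
    show "s \<notin> span (B \<union> (S \<union> Z - {s}))"
    proof (cases "s \<in> Z")
      case True
      have "span (B \<union> (S \<union> Z - {s})) \<subseteq> span (A \<union> (Z - {s}))"
        using A S by (intro span_mono) blast
      then show ?thesis using Z True unfolding indep_mod_def by blast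
    next
      case False
      show ?thesis
      proof
        assume "s \<in> span (B \<union> (S \<union> Z - {s}))"
        moreover have "B \<union> (S \<union> Z - {s}) = (B \<union> (S - {s})) \<union> Z" using False by blast
        ultimately have "s \<in> {x + y | x y. x \<in> span (B \<union> (S - {s})) \<and> y \<in> span Z}"
          using span_Un[of "B \<union> (S - {s})" Z] by simp
        then obtain x y where xy: "s = x + y" "x \<in> span (B \<union> (S - {s}))" "y \<in> span Z" by blast
        have "x \<in> A" using xy(2) span_minimal[of "B \<union> (S - {s})" A] A S by blast
        then have yA: "y \<in> A" using xy(1) subspace_diff[OF A(1), of s x] False s S(1) by auto
        have "independent Z"
        proof -
          have "span (Z - {z}) \<subseteq> span (A \<union> (Z - {z}))" for z by (intro span_mono) blast
          then show ?thesis using Z unfolding indep_mod_def dependent_def by blast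
        qed
        have "y = 0"
        proof (rule ccontr)
          assume "y \<noteq> 0"
          obtain T u where T: "finite T" "T \<subseteq> Z" "y = (\<Sum>a\<in>T. scale (u a) a)"
            using xy(3) unfolding span_explicit by blast
          with \<open>y \<noteq> 0\<close> obtain z where z: "z \<in> T" "u z \<noteq> 0"
            using sum.neutral[of T "\<lambda>a. scale (u a) a"] by force
          have "y = scale (u z) z + (\<Sum>a\<in>T - {z}. scale (u a) a)"
            using T(1,3) z(1) by (simp add: sum.remove)
          then have "scale (u z) z = y - (\<Sum>a\<in>T - {z}. scale (u a) a)" by simp
          moreover have "\<dots> \<in> span (A \<union> (Z - {z}))"
            using T(2) yA by (intro span_diff span_sum span_scale span_base) auto
          ultimately have "scale (u z) z \<in> span (A \<union> (Z - {z}))" by simp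
          then have "scale (inverse (u z)) (scale (u z) z) \<in> span (A \<union> (Z - {z}))" by (rule span_scale)
          then have "z \<in> span (A \<union> (Z - {z}))" using z(2) by simp
          then show False using Z z(1) T(2) unfolding indep_mod_def by blast
        qed
        then have "s \<in> span (B \<union> (S - {s}))" using xy by simp
        then show False using S(2) s False unfolding indep_mod_def by blast
      qed
    qed
  qed
qed

text \<open>Used with \<open>V\<close> = F', \<open>A\<close> the intersection of F' and R, and
  \<open>B\<close> = [F,R], where \<open>Z\<close> lifts a basis of L'. A spanning set of
  \<open>V\<close> modulo \<open>B\<close> then bounds the multiplier after the dimension of L' has
  been subtracted.\<close>

lemma quot_dim_bound:
  assumes B: "subspace B" "B \<subseteq> A" and A: "subspace A" "A \<subseteq> V" and T: "finite T" "V \<subseteq> span (B \<union> T)"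
    and Z: "Z \<subseteq> V" "indep_mod scale A Z"
  shows "quot_fin_dim scale A B \<and> quot_dim scale A B + card Z \<le> card T"
proof -
  obtain S where S: "quot_basis scale A B S" using quot_basis_exists[OF B(2,1) A(1)] by blast
  note q = S[unfolded quot_basis_iff]
  have i: "indep_mod scale B (S \<union> Z)" "S \<inter> Z = {}"
    using indep_mod_Un[of A B S Z] A B q Z by blast+
  have "finite (S \<union> Z) \<and> card (S \<union> Z) \<le> card T"
    by (rule indep_mod_span_bound[OF T(1) i(1)]) (use q Z A T in blast)
  then show ?thesis
    using S i(2) unfolding quot_fin_dim_def by (auto simp: quot_dim_unique card_Un_disjoint)
qed

lemma quot_dim_ge:
  assumes "quot_fin_dim scale A B" "S \<subseteq> A" "indep_mod scale B S"
  shows "card S \<le> quot_dim scale A B"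
proof -
  obtain T where T: "finite T" "quot_basis scale A B T" using assms(1) unfolding quot_fin_dim_def by blast
  have "card S \<le> card T"
    using indep_mod_span_bound[OF T(1) assms(3)] T(2) assms(2) unfolding quot_basis_iff by blast
  then show ?thesis using quot_dim_unique[OF T] by simp
qed

end

section \<open>Graded subspaces, epimorphisms and their kernels\<close>

definition graded :: "('k, 'a::ab_group_add) superalgebra \<Rightarrow> 'a set \<Rightarrow> bool" where
  "graded L A \<longleftrightarrow> (\<forall>x\<in>A. \<exists>a\<in>A \<inter> part L 0. \<exists>b\<in>A \<inter> part L 1. x = a + b)"

lemma gradedE:
  assumes "graded L A" "x \<in> A"
  obtains a b where "a \<in> A" "a \<in> part L 0" "b \<in> A" "b \<in> part L 1" "x = a + b"
  using assms unfolding graded_def by blast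

context lie_superalgebra
begin

lemma carr_add: "x \<in> carr L \<Longrightarrow> y \<in> carr L \<Longrightarrow> x + y \<in> carr L"
  using subspace_carr by (rule subspace_add)

lemma carr_scl: "x \<in> carr L \<Longrightarrow> scl L c x \<in> carr L"
  using subspace_carr by (rule subspace_scale)

lemma carr_diff: "x \<in> carr L \<Longrightarrow> y \<in> carr L \<Longrightarrow> x - y \<in> carr L"
  using subspace_carr by (rule subspace_diff)

lemma carr_neg: "x \<in> carr L \<Longrightarrow> - x \<in> carr L"
  using subspace_carr by (rule subspace_neg)

lemma carr_0: "0 \<in> carr L"
  using subspace_carr by (rule subspace_0)

lemma carr_span: "S \<subseteq> carr L \<Longrightarrow> span S \<subseteq> carr L"
  by (rule span_minimal[OF _ subspace_carr])

lemma part_disjoint: "x \<in> part L 0 \<Longrightarrow> x \<in> part L 1 \<Longrightarrow> x = 0"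
  using part_Int by blast

lemma graded_carr: "graded L (carr L)"
proof -
  have "\<exists>a\<in>carr L \<inter> part L 0. \<exists>b\<in>carr L \<inter> part L 1. x = a + b" if x: "x \<in> carr L" for x
  proof -
    obtain a b where "x = a + b" "a \<in> part L 0" "b \<in> part L 1"
      using x unfolding carr_def by blast
    then show ?thesis using part_carr by blast
  qed
  then show ?thesis unfolding graded_def by blast
qed

lemma graded_span:
  assumes "H \<subseteq> part L 0 \<union> part L 1"
  shows "graded L (span H)"
  unfolding graded_def
proof
  fix x assume "x \<in> span H"
  moreover have "H = (H \<inter> part L 0) \<union> (H \<inter> part L 1)" using assms by blast
  ultimately have "x \<in> {a + b | a b. a \<in> span (H \<inter> part L 0) \<and> b \<in> span (H \<inter> part L 1)}"
    using span_Un[of "H \<inter> part L 0" "H \<inter> part L 1"] by simp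
  then obtain a b where "x = a + b" "a \<in> span (H \<inter> part L 0)" "b \<in> span (H \<inter> part L 1)" by blast
  moreover have "span (H \<inter> part L i) \<subseteq> span H \<inter> part L i" for i
    using span_mono[of "H \<inter> part L i" H] span_minimal[OF _ subspace_part, of "H \<inter> part L i" i] by blast
  ultimately show "\<exists>a\<in>span H \<inter> part L 0. \<exists>b\<in>span H \<inter> part L 1. x = a + b" by blast
qed

lemma brk_minus_left: "x \<in> carr L \<Longrightarrow> y \<in> carr L \<Longrightarrow> brk L (- x) y = - brk L x y"
  using brk_scl_left[of x y "- 1"] by simp

lemma brk_minus_right: "x \<in> carr L \<Longrightarrow> y \<in> carr L \<Longrightarrow> brk L x (- y) = - brk L x y"
  using brk_scl_right[of x y "- 1"] by simp

lemma brk_diff_left: "x \<in> carr L \<Longrightarrow> y \<in> carr L \<Longrightarrow> z \<in> carr L \<Longrightarrow> brk L (x - y) z = brk L x z - brk L y z"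
  using brk_add_left[of x "- y" z] by (simp add: brk_minus_left carr_neg)

lemma brk_diff_right: "x \<in> carr L \<Longrightarrow> y \<in> carr L \<Longrightarrow> z \<in> carr L \<Longrightarrow> brk L z (x - y) = brk L z x - brk L z y"
  using brk_add_right[of z x "- y"] by (simp add: brk_minus_right carr_neg)

text \<open>The sign depends only on the first two arguments, so linearity allows an inhomogeneous
  third one.\<close>

lemma brk_jacobi_carr:
  assumes "x \<in> part L i" "y \<in> part L j" "z \<in> carr L"
  shows "brk L x (brk L y z) = brk L (brk L x y) z + scl L (koszul i j) (brk L y (brk L x z))"
proof -
  obtain a b where z: "z = a + b" "a \<in> part L 0" "b \<in> part L 1" using assms(3) unfolding carr_def by blast
  note c = part_carr[OF z(2)] part_carr[OF z(3)] part_carr[OF assms(1)] part_carr[OF assms(2)]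
  have "brk L x (brk L y z) = brk L x (brk L y a) + brk L x (brk L y b)"
    using c by (simp add: z(1) brk_add_right brk_carr)
  then show ?thesis
    using c unfolding brk_jacobi[OF assms(1,2) z(2)] brk_jacobi[OF assms(1,2) z(3)]
    by (simp add: z(1) brk_add_right brk_carr scale_right_distrib)
qed

lemma subspace_brk_span: "subspace (brk_span L A B)"
  unfolding brk_span_def by (rule subspace_span)

lemma brk_spanI: "a \<in> A \<Longrightarrow> b \<in> B \<Longrightarrow> brk L a b \<in> brk_span L A B"
  unfolding brk_span_def by (rule span_base) blast

lemma brk_span_least:
  assumes "subspace V" "\<And>a b. a \<in> A \<Longrightarrow> b \<in> B \<Longrightarrow> brk L a b \<in> V"
  shows "brk_span L A B \<subseteq> V"
  unfolding brk_span_def by (rule span_minimal) (use assms in auto)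

lemma brk_span_mono: "A \<subseteq> A' \<Longrightarrow> B \<subseteq> B' \<Longrightarrow> brk_span L A B \<subseteq> brk_span L A' B'"
  unfolding brk_span_def by (rule span_mono) blast

lemma brk_span_carr: "A \<subseteq> carr L \<Longrightarrow> B \<subseteq> carr L \<Longrightarrow> brk_span L A B \<subseteq> carr L"
  by (rule brk_span_least[OF subspace_carr]) (auto intro: brk_carr)

text \<open>Splitting both arguments into homogeneous components gives four brackets; in this way
  consequences of the sign rules reach all elements of graded subspaces.\<close>

lemma brk_homogeneous_least:
  assumes "graded L A" "graded L B" "A \<subseteq> carr L" "B \<subseteq> carr L" "subspace V"
    and h: "\<And>a b i j. a \<in> A \<Longrightarrow> a \<in> part L i \<Longrightarrow> b \<in> B \<Longrightarrow> b \<in> part L j \<Longrightarrow> brk L a b \<in> V"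
    and "x \<in> A" "y \<in> B"
  shows "brk L x y \<in> V"
proof -
  obtain a b where a: "a \<in> A" "a \<in> part L 0" "b \<in> A" "b \<in> part L 1" "x = a + b"
    using assms by (auto elim: gradedE)
  obtain c d where c: "c \<in> B" "c \<in> part L 0" "d \<in> B" "d \<in> part L 1" "y = c + d"
    using assms by (auto elim: gradedE)
  have "brk L x y = (brk L a c + brk L b c) + (brk L a d + brk L b d)"
    using a c assms(3,4) by (simp add: brk_add_left brk_add_right carr_add subset_iff)
  then show ?thesis using h a c subspace_add[OF assms(5)] by metis
qed

lemma brk_span_homogeneous_least:
  assumes "graded L A" "graded L B" "A \<subseteq> carr L" "B \<subseteq> carr L" "subspace V"
    and "\<And>a b i j. a \<in> A \<Longrightarrow> a \<in> part L i \<Longrightarrow> b \<in> B \<Longrightarrow> b \<in> part L j \<Longrightarrow> brk L a b \<in> V"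
  shows "brk_span L A B \<subseteq> V"
  by (rule brk_span_least[OF assms(5)]) (rule brk_homogeneous_least[OF assms(1-5)], use assms(6) in blast)

text \<open>The sign of the swap varies with the homogeneous components, so for general elements
  only membership in the span of the swapped brackets survives.\<close>

lemma brk_swap:
  assumes "graded L A" "graded L B" "A \<subseteq> carr L" "B \<subseteq> carr L" "x \<in> A" "y \<in> B"
  shows "brk L x y \<in> brk_span L B A"
proof (rule brk_homogeneous_least[OF assms(1-4) subspace_brk_span _ assms(5,6)])
  fix a b i j assume "a \<in> A" "a \<in> part L i" "b \<in> B" "b \<in> part L j"
  then show "brk L a b \<in> brk_span L B A"
    using brk_skew[of a i b j] subspace_neg[OF subspace_brk_span] subspace_scale[OF subspace_brk_span]
      brk_spanI[of b B a A] by metis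
qed

lemma graded_brk_span:
  assumes "graded L A" "graded L B" "A \<subseteq> carr L" "B \<subseteq> carr L"
  shows "graded L (brk_span L A B)"
proof -
  let ?H = "{brk L a b | a b i j. a \<in> A \<inter> part L i \<and> b \<in> B \<inter> part L j}"
  have sub: "?H \<subseteq> part L 0 \<union> part L 1"
  proof
    fix x assume "x \<in> ?H"
    then obtain e where "x \<in> part L e" using brk_part by blast
    then show "x \<in> part L 0 \<union> part L 1" using bit_cases[of e] by auto
  qed
  have "brk_span L A B \<subseteq> span ?H"
    by (rule brk_span_homogeneous_least[OF assms subspace_span]) (rule span_base, blast)
  moreover have "span ?H \<subseteq> brk_span L A B"
    by (rule span_minimal[OF _ subspace_brk_span]) (auto intro: brk_spanI)
  ultimately show ?thesis using graded_span[OF sub] by auto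
qed

lemma derived_carr: "derived L \<subseteq> carr L"
  unfolding derived_def by (rule brk_span_carr) auto

lemma graded_derived: "graded L (derived L)"
  unfolding derived_def by (rule graded_brk_span) (auto intro: graded_carr)

lemma subspace_derived: "subspace (derived L)"
  unfolding derived_def by (rule subspace_brk_span)

lemma brk_derived: "x \<in> carr L \<Longrightarrow> y \<in> carr L \<Longrightarrow> brk L x y \<in> derived L"
  unfolding derived_def by (rule brk_spanI)

lemma lower_central_Suc_subset: "lower_central L (Suc k) \<subseteq> lower_central L k"
proof (induction k)
  case 0 then show ?case using brk_span_carr by simp
next
  case (Suc k) then show ?case using brk_span_mono[OF order_refl Suc] by simp
qed

lemma lower_central_antimono: "k \<le> l \<Longrightarrow> lower_central L l \<subseteq> lower_central L k"
  using lift_Suc_antimono_le[of "lower_central L", OF lower_central_Suc_subset] .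

lemma basis_extending:
  assumes "subspace V" "A \<subseteq> V" "independent A"
  obtains B where "A \<subseteq> B" "B \<subseteq> V" "independent B" "V = span B"
proof -
  obtain B where B: "A \<subseteq> B" "B \<subseteq> V" "independent B" "V \<subseteq> span B"
    using maximal_independent_subset_extend[OF assms(2,3)] by blast
  then show thesis using that span_minimal[OF B(2) assms(1)] by blast
qed

lemma homogeneous_Un_independent:
  assumes "A \<subseteq> part L 0" "B \<subseteq> part L 1" "independent A" "independent B"
  shows "independent (A \<union> B)" "A \<inter> B = {}"
proof -
  have s: "span A \<subseteq> part L 0" "span B \<subseteq> part L 1"
    using assms span_minimal[OF _ subspace_part] by auto
  have nz: "0 \<notin> A" using assms(3) dependent_zero by blast
  show "A \<inter> B = {}" using assms(1,2) nz part_disjoint by blast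
  have im: "indep_mod (scl L) (span A) B"
    unfolding indep_mod_def
  proof (intro ballI notI)
    fix b assume b: "b \<in> B" "b \<in> span (span A \<union> (B - {b}))"
    then have "b \<in> {x + y | x y. x \<in> span (span A) \<and> y \<in> span (B - {b})}"
      using span_Un[of "span A" "B - {b}"] by simp
    then obtain x y where xy: "b = x + y" "x \<in> span A" "y \<in> span (B - {b})"
      by (auto simp: span_span)
    have "y \<in> span B" using xy(3) span_mono[of "B - {b}" B] by blast
    then have "b - y \<in> part L 1" using b s assms(2) subspace_diff[OF subspace_part] by blast
    moreover have "b - y = x" using xy(1) by simp
    ultimately have "x = 0" using part_disjoint s xy(2) by auto
    then show False using xy assms(4) b(1) unfolding dependent_def by simp
  qed
  have "indep_mod (scl L) A B"
    unfolding indep_mod_def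
  proof
    fix b assume "b \<in> B"
    then have "b \<notin> span (span A \<union> (B - {b}))" using im unfolding indep_mod_def by blast
    moreover have "span (A \<union> (B - {b})) \<subseteq> span (span A \<union> (B - {b}))"
      using span_superset[of A] by (intro span_mono) blast
    ultimately show "b \<notin> span (A \<union> (B - {b}))" by blast
  qed
  then show "independent (A \<union> B)" by (rule independent_Un_indep_mod[OF assms(3)])
qed

lemma graded_eq_span:
  assumes "graded L V" "subspace V" "V \<inter> part L 0 = span A" "V \<inter> part L 1 = span B"
  shows "V = span (A \<union> B)"
proof
  show "V \<subseteq> span (A \<union> B)"
  proof
    fix x assume "x \<in> V"
    then obtain a b where "a \<in> V" "a \<in> part L 0" "b \<in> V" "b \<in> part L 1" "x = a + b"
      using assms(1) by (auto elim: gradedE)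
    then have "a \<in> span A" "b \<in> span B" "x = a + b" using assms(3,4) by blast+
    then show "x \<in> span (A \<union> B)"
      using span_mono[of A "A \<union> B"] span_mono[of B "A \<union> B"] by (auto intro: span_add)
  qed
  have "A \<subseteq> V" "B \<subseteq> V" using assms(3,4) span_superset by blast+
  then show "span (A \<union> B) \<subseteq> V" using span_minimal[OF _ assms(2)] by blast
qed

lemma finite_independent_carr:
  assumes "fin_dim L" "A \<subseteq> carr L" "independent A"
  shows "finite A"
proof -
  obtain B where "finite B" "carr L \<subseteq> span B" using assms(1) unfolding fin_dim_def by blast
  then show ?thesis using independent_span_bound[of B A] assms by blast
qed

end

section \<open>Epimorphisms, preimages and lifting\<close>

locale lsa_epimorphism = F: lie_superalgebra F + L: lie_superalgebra L
  for F :: "('k::field, 'f::ab_group_add) superalgebra" and L :: "('k, 'a::ab_group_add) superalgebra" +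
  fixes \<phi> :: "'f \<Rightarrow> 'a"
  assumes hom: "lsa_hom F L \<phi>" and surj: "\<phi> ` carr F = carr L"
begin

lemma \<phi>_add: "x \<in> carr F \<Longrightarrow> y \<in> carr F \<Longrightarrow> \<phi> (x + y) = \<phi> x + \<phi> y"
  using hom unfolding lsa_hom_def by blast

lemma \<phi>_scl: "x \<in> carr F \<Longrightarrow> \<phi> (scl F c x) = scl L c (\<phi> x)"
  using hom unfolding lsa_hom_def by blast

lemma \<phi>_part: "x \<in> part F i \<Longrightarrow> \<phi> x \<in> part L i"
  using hom unfolding lsa_hom_def by blast

lemma \<phi>_brk: "x \<in> carr F \<Longrightarrow> y \<in> carr F \<Longrightarrow> \<phi> (brk F x y) = brk L (\<phi> x) (\<phi> y)"
  using hom unfolding lsa_hom_def by blast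

lemma \<phi>_carr: "x \<in> carr F \<Longrightarrow> \<phi> x \<in> carr L"
  using surj by blast

lemma \<phi>_0: "\<phi> 0 = 0"
  using \<phi>_scl[of 0 0] F.carr_0 by simp

lemma \<phi>_diff: "x \<in> carr F \<Longrightarrow> y \<in> carr F \<Longrightarrow> \<phi> (x - y) = \<phi> x - \<phi> y"
  using \<phi>_add[of "x - y" y] F.carr_diff by simp

lemma \<phi>_part_surj:
  assumes "x \<in> part L i"
  shows "\<exists>f\<in>part F i. \<phi> f = x"
proof -
  obtain f where "f \<in> carr F" "\<phi> f = x" using surj L.part_carr[OF assms] by (metis imageE)
  then obtain a b where f: "a \<in> part F 0" "b \<in> part F 1" "\<phi> (a + b) = x"
    unfolding carr_def by blast
  have e: "\<phi> a + \<phi> b = x" using f \<phi>_add F.part_carr by metis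
  note p = \<phi>_part[OF f(1)] \<phi>_part[OF f(2)]
  show ?thesis
  proof (cases "i = 0")
    case True
    have "x - \<phi> a \<in> part L 0" using assms True p L.subspace_diff[OF L.subspace_part] by blast
    moreover have "x - \<phi> a = \<phi> b" using e by auto
    ultimately have "\<phi> b = 0" using L.part_disjoint p by auto
    then show ?thesis using e f True by auto
  next
    case False
    then have i: "i = 1" using bit_cases by blast
    have "x - \<phi> b \<in> part L 1" using assms i p L.subspace_diff[OF L.subspace_part] by blast
    moreover have "x - \<phi> b = \<phi> a" using e by auto
    ultimately have "\<phi> a = 0" using L.part_disjoint p by auto
    then show ?thesis using e f i by auto
  qed
qed

text \<open>\<open>pre {0}\<close> is the kernel R and \<open>pre (derived L)\<close> is F' + R; the
  preimage of a hyperplane of L' containing [L,L'] will serve as an ideal of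
  \<open>F\<close>.\<close>

definition pre :: "'a set \<Rightarrow> 'f set" where
  "pre J = {x \<in> carr F. \<phi> x \<in> J}"

lemma ker_eq_pre: "ker_in F \<phi> = pre {0}"
  unfolding ker_in_def pre_def by simp

lemma pre_carr: "pre J \<subseteq> carr F"
  unfolding pre_def by blast

lemma subspace_pre: "L.subspace J \<Longrightarrow> F.subspace (pre J)"
  by (rule F.subspaceI)
    (auto simp: pre_def \<phi>_0 \<phi>_add \<phi>_scl F.carr_0 F.carr_add F.carr_scl
      intro: L.subspace_0 L.subspace_add L.subspace_scale)

lemma graded_pre:
  assumes J: "graded L J" "L.subspace J"
  shows "graded F (pre J)"
  unfolding graded_def
proof
  fix x assume x: "x \<in> pre J"
  then obtain a b where f: "a \<in> part F 0" "b \<in> part F 1" "x = a + b"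
    unfolding pre_def carr_def by blast
  have e: "\<phi> x = \<phi> a + \<phi> b" using f \<phi>_add F.part_carr by metis
  note p = \<phi>_part[OF f(1)] \<phi>_part[OF f(2)]
  have "\<phi> x \<in> J" using x unfolding pre_def by blast
  then obtain c d where c: "c \<in> J" "c \<in> part L 0" "d \<in> J" "d \<in> part L 1" "\<phi> x = c + d"
    using J(1) by (auto elim: gradedE)
  have e: "\<phi> a - c = d - \<phi> b" using e c(5) by (simp add: algebra_simps)
  have "\<phi> a - c \<in> part L 0" using p c L.subspace_diff[OF L.subspace_part] by blast
  moreover have "\<phi> a - c \<in> part L 1" unfolding e using p c L.subspace_diff[OF L.subspace_part] by blast
  ultimately have "\<phi> a - c = 0" using L.part_disjoint by blast
  then have "\<phi> a = c" "\<phi> b = d" using e by auto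
  then have "a \<in> pre J" "b \<in> pre J" using f c F.part_carr unfolding pre_def by auto
  then show "\<exists>a\<in>pre J \<inter> part F 0. \<exists>b\<in>pre J \<inter> part F 1. x = a + b" using f by blast
qed

lemma \<phi>_span:
  assumes "H \<subseteq> carr F" "x \<in> F.span H"
  shows "\<phi> x \<in> L.span (\<phi> ` H)"
proof -
  have "F.span H \<subseteq> pre (L.span (\<phi> ` H))"
    by (rule F.span_minimal[OF _ subspace_pre[OF L.subspace_span]])
      (use assms(1) in \<open>auto simp: pre_def intro: L.span_base\<close>)
  then show ?thesis using assms(2) unfolding pre_def by blast
qed

lemma span_lift:
  assumes "H \<subseteq> carr F" "y \<in> L.span (\<phi> ` H)"
  shows "\<exists>w\<in>F.span H. \<phi> w = y"
proof -
  have c: "F.span H \<subseteq> carr F" using assms(1) by (rule F.carr_span)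
  have "L.subspace (\<phi> ` F.span H)"
  proof (rule L.subspaceI)
    show "0 \<in> \<phi> ` F.span H" using \<phi>_0 F.span_zero by (metis imageI)
  next
    fix x y assume "x \<in> \<phi> ` F.span H" "y \<in> \<phi> ` F.span H"
    then show "x + y \<in> \<phi> ` F.span H" using c \<phi>_add F.span_add by (smt (verit) image_iff subset_eq)
  next
    fix a x assume "x \<in> \<phi> ` F.span H"
    then show "scl L a x \<in> \<phi> ` F.span H" using c \<phi>_scl F.span_scale by (smt (verit) image_iff subset_eq)
  qed
  moreover have "\<phi> ` H \<subseteq> \<phi> ` F.span H" using F.span_superset by blast
  ultimately show ?thesis using L.span_minimal assms(2) by blast
qed

lemma \<phi>_lower_central: "x \<in> lower_central F k \<Longrightarrow> \<phi> x \<in> lower_central L k"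
proof -
  have "lower_central F k \<subseteq> pre (lower_central L k)"
  proof (induction k)
    case 0 then show ?case using \<phi>_carr by (auto simp: pre_def)
  next
    case (Suc k)
    show ?case
      unfolding lower_central.simps
    proof (rule F.brk_span_least[OF subspace_pre[OF L.subspace_brk_span]])
      fix a b assume a: "a \<in> carr F" "b \<in> lower_central F k"
      then have "b \<in> carr F" "\<phi> b \<in> lower_central L k" using Suc unfolding pre_def by auto
      then show "brk F a b \<in> pre (brk_span L (carr L) (lower_central L k))"
        unfolding pre_def using a \<phi>_carr by (auto simp: \<phi>_brk F.brk_carr intro: L.brk_spanI)
    qed
  qed
  then show "x \<in> lower_central F k \<Longrightarrow> \<phi> x \<in> lower_central L k" unfolding pre_def by blast
qed

lemma \<phi>_derived: "x \<in> derived F \<Longrightarrow> \<phi> x \<in> derived L"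
  using \<phi>_lower_central[of x 1] by (simp add: derived_def)

lemma derived_lift:
  assumes "y \<in> derived L"
  shows "\<exists>x\<in>derived F. \<phi> x = y"
proof -
  let ?H = "{brk F a b | a b. a \<in> carr F \<and> b \<in> carr F}"
  have "{brk L a b | a b. a \<in> carr L \<and> b \<in> carr L} \<subseteq> \<phi> ` ?H"
  proof
    fix x assume "x \<in> {brk L a b | a b. a \<in> carr L \<and> b \<in> carr L}"
    then obtain a b where "x = brk L (\<phi> a) (\<phi> b)" "a \<in> carr F" "b \<in> carr F"
      using surj by (smt (verit) image_iff mem_Collect_eq)
    then show "x \<in> \<phi> ` ?H" by (auto simp: \<phi>_brk[symmetric])
  qed
  then have "y \<in> L.span (\<phi> ` ?H)"
    using assms L.span_mono unfolding derived_def brk_span_def by blast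
  moreover have "?H \<subseteq> carr F" using F.brk_carr by blast
  ultimately show ?thesis
    using span_lift[of ?H y] unfolding derived_def brk_span_def by blast
qed

text \<open>The kernel disappears under \<open>\<phi>\<close>, so a relation modulo it becomes a
  relation between images; injectivity on \<open>Z\<close> keeps \<open>\<phi> z\<close> apart from
  the other images.\<close>

lemma indep_mod_ker:
  assumes Z: "Z \<subseteq> carr F" "inj_on \<phi> Z" "L.independent (\<phi> ` Z)"
  shows "indep_mod (scl F) (ker_in F \<phi>) Z"
  unfolding indep_mod_def
proof (intro ballI notI)
  fix z assume z: "z \<in> Z" "z \<in> F.span (ker_in F \<phi> \<union> (Z - {z}))"
  have "\<phi> z \<in> L.span (\<phi> ` (ker_in F \<phi> \<union> (Z - {z})))"
    by (rule \<phi>_span[OF _ z(2)]) (use Z pre_carr ker_eq_pre in auto)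
  moreover have "L.span (\<phi> ` (ker_in F \<phi> \<union> (Z - {z}))) \<subseteq> L.span (\<phi> ` Z - {\<phi> z})"
  proof (rule L.span_minimal[OF _ L.subspace_span])
    show "\<phi> ` (ker_in F \<phi> \<union> (Z - {z})) \<subseteq> L.span (\<phi> ` Z - {\<phi> z})"
    proof (rule image_subsetI)
      fix x assume "x \<in> ker_in F \<phi> \<union> (Z - {z})"
      then show "\<phi> x \<in> L.span (\<phi> ` Z - {\<phi> z})"
      proof
        assume "x \<in> Z - {z}"
        then show ?thesis using Z(2) z(1) by (intro L.span_base) (auto dest: inj_onD)
      qed (simp add: ker_in_def L.span_zero)
    qed
  qed
  ultimately show False using Z(3) z(1) unfolding L.dependent_def by blast
qed

end

section \<open>The upper bound\<close>

context lie_superalgebra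
begin

lemma subspace_brk_left:
  assumes "subspace Q" "c \<in> carr L"
  shows "subspace {x \<in> carr L. brk L x c \<in> Q}"
  by (rule subspaceI)
    (use assms in \<open>auto simp: brk_0 brk_add_left brk_scl_left carr_0 carr_add carr_scl
      intro: subspace_0 subspace_add subspace_scale\<close>)

lemma subspace_brk_right:
  assumes "subspace Q" "c \<in> carr L"
  shows "subspace {x \<in> carr L. brk L c x \<in> Q}"
  by (rule subspaceI)
    (use assms in \<open>auto simp: brk_0 brk_add_right brk_scl_right carr_0 carr_add carr_scl
      intro: subspace_0 subspace_add subspace_scale\<close>)

lemma brk_span_span:
  assumes Q: "subspace Q" and A: "A \<subseteq> carr L" "B \<subseteq> carr L"
    and h: "\<And>a b. a \<in> A \<Longrightarrow> b \<in> B \<Longrightarrow> brk L a b \<in> Q"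
    and x: "x \<in> span A" "y \<in> span B"
  shows "brk L x y \<in> Q"
proof -
  have y: "brk L a y \<in> Q" if a: "a \<in> A" for a
  proof -
    have "span B \<subseteq> {x \<in> carr L. brk L a x \<in> Q}"
      by (rule span_minimal[OF _ subspace_brk_right[OF Q]]) (use A h a in auto)
    then show ?thesis using x by blast
  qed
  have "span A \<subseteq> {x \<in> carr L. brk L x y \<in> Q}"
    by (rule span_minimal[OF _ subspace_brk_left[OF Q]]) (use A y x carr_span[OF A(2)] in auto)
  then show ?thesis using x by blast
qed

lemma brk_even_self:
  assumes "(2::'k) \<noteq> 0" "x \<in> part L 0"
  shows "brk L x x = 0"
proof -
  have "brk L x x = - brk L x x" using brk_skew[OF assms(2,2)] by (simp add: koszul_def)
  then have "brk L x x + brk L x x = 0" by (simp add: eq_neg_iff_add_eq_0)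
  then have "scl L 2 (brk L x x) = 0"
    using scale_left_distrib[of 1 1 "brk L x x"] by simp
  then show ?thesis using assms(1) by simp
qed

text \<open>The graded Jacobi identity moves $[x,[u,v]]$ to $[[x,u],v]$ and $[u,[x,v]]$, whose inner
  brackets are multiples of $[u,v]$ modulo \<open>S\<close>.\<close>

lemma brk_derived_mod:
  assumes u: "u \<in> part L i" and v: "v \<in> part L j" and Q: "subspace Q"
    and S: "S \<subseteq> carr L" "graded L S" "brk_span L (carr L) S \<subseteq> Q"
    and D: "\<And>y. y \<in> derived L \<Longrightarrow> \<exists>c. y - scl L c (brk L u v) \<in> S"
    and uQ: "brk L u (brk L u v) \<in> Q" and vQ: "brk L v (brk L u v) \<in> Q"
    and x: "x \<in> carr L"
  shows "brk L x (brk L u v) \<in> Q"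
proof -
  let ?z = "brk L u v"
  note c = part_carr[OF u] part_carr[OF v]
  have z: "?z \<in> carr L" "?z \<in> part L (i + j)" using brk_part[OF u v] part_carr by blast+
  have SQ: "brk L s y \<in> Q" "brk L y s \<in> Q" if "s \<in> S" "y \<in> carr L" for s y
    using brk_swap[OF S(2) graded_carr S(1) order_refl that] brk_spanI[of y "carr L" s S] that S(3) by auto
  \<comment> \<open>In [[x,u],v] the factor \<open>v\<close> stands to the right of a multiple of
    [u,v]; skew-symmetry moves it to the left, where \<open>vQ\<close> applies.\<close>
  have zv: "brk L ?z v \<in> Q"
    using brk_skew[OF z(2) v] vQ subspace_neg[OF Q] subspace_scale[OF Q] by metis
  have h: "brk L x ?z \<in> Q" if x: "x \<in> part L k" for x k
  proof -
    note xc = part_carr[OF x]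
    obtain a where a: "brk L x u - scl L a ?z \<in> S" using D brk_derived[OF xc c(1)] by blast
    obtain b where b: "brk L x v - scl L b ?z \<in> S" using D brk_derived[OF xc c(2)] by blast
    have "brk L (brk L x u) v = brk L (brk L x u - scl L a ?z) v + scl L a (brk L ?z v)"
      using c xc z by (simp add: brk_diff_left brk_carr carr_scl brk_scl_left)
    then have 1: "brk L (brk L x u) v \<in> Q"
      using SQ(1)[OF a c(2)] zv subspace_add[OF Q] subspace_scale[OF Q] by metis
    have "brk L u (brk L x v) = brk L u (brk L x v - scl L b ?z) + scl L b (brk L u ?z)"
      using c xc z by (simp add: brk_diff_right brk_carr carr_scl brk_scl_right)
    then have 2: "brk L u (brk L x v) \<in> Q"
      using SQ(2)[OF b c(1)] uQ subspace_add[OF Q] subspace_scale[OF Q] by metis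
    show ?thesis
      unfolding brk_jacobi_carr[OF x u c(2)] using 1 2 Q by (intro subspace_add subspace_scale)
  qed
  obtain a b where ab: "x = a + b" "a \<in> part L 0" "b \<in> part L 1" using x unfolding carr_def by blast
  then show ?thesis
    using h[OF ab(2)] h[OF ab(3)] part_carr z(1) subspace_add[OF Q] by (simp add: brk_add_left)
qed

end

context lsa_epimorphism
begin

abbreviation "R \<equiv> ker_in F \<phi>"
abbreviation "FR \<equiv> brk_span F (carr F) R"

lemma R_carr: "R \<subseteq> carr F"
  unfolding ker_in_def by blast

lemma subspace_R: "F.subspace R"
  unfolding ker_eq_pre by (rule subspace_pre) simp

lemma graded_R: "graded F R"
  unfolding ker_eq_pre
  by (rule graded_pre) (use L.subspace_0[OF L.subspace_part] in \<open>auto simp: graded_def\<close>)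

lemma FR_R: "FR \<subseteq> R"
  by (rule F.brk_span_least[OF subspace_R])
    (auto simp: ker_in_def F.brk_carr \<phi>_brk L.brk_0 \<phi>_carr)

lemma FR_derived: "FR \<subseteq> derived F"
  unfolding derived_def by (rule F.brk_span_mono) (use R_carr in auto)

lemma brk_R_left: "x \<in> R \<Longrightarrow> y \<in> carr F \<Longrightarrow> brk F x y \<in> FR"
  by (rule F.brk_swap[OF graded_R F.graded_carr R_carr order_refl])

lemma brk_R_right: "x \<in> carr F \<Longrightarrow> y \<in> R \<Longrightarrow> brk F x y \<in> FR"
  by (rule F.brk_spanI)

text \<open>The preimage of L' is F' + R: an element and a lift in F' of its image differ by an
  element of the kernel.\<close>

lemma derived_decompose:
  assumes "x \<in> carr F" "\<phi> x \<in> derived L"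
  shows "\<exists>y\<in>derived F. x - y \<in> R"
proof -
  obtain y where y: "y \<in> derived F" "\<phi> y = \<phi> x" using derived_lift assms(2) by blast
  then have "y \<in> carr F" using F.derived_carr by blast
  then have "x - y \<in> R" using y assms(1) by (simp add: ker_in_def F.carr_diff \<phi>_diff)
  then show ?thesis using y by blast
qed

text \<open>Nilpotency of \<open>L\<close> enters here: rewriting $[[a,b],c]$ by the Jacobi identity pushes \<open>c\<close> down the
  lower central series of \<open>F\<close>, which eventually lies in the kernel.\<close>

lemma brk_ideal_mod:
  assumes nil: "lower_central L k = {0}" "k > 0"
    and S: "S \<subseteq> carr F" "F.subspace S" "R \<subseteq> S" "\<And>x. x \<in> S \<Longrightarrow> \<phi> x \<in> derived L"
    and ideal: "\<And>x c. x \<in> carr F \<Longrightarrow> c \<in> S \<Longrightarrow> brk F x c \<in> S"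
    and W: "W \<subseteq> carr F" "\<And>x. x \<in> carr F \<Longrightarrow> \<exists>w\<in>W. \<phi> (x - w) \<in> derived L"
    and Q: "F.subspace Q" "FR \<subseteq> Q" "\<And>w c. w \<in> W \<Longrightarrow> c \<in> S \<Longrightarrow> c \<in> derived F \<Longrightarrow> brk F w c \<in> Q"
  shows "brk_span F (carr F) S \<subseteq> Q"
proof -
  have main: "\<forall>c\<in>S \<inter> lower_central F (Suc 0). \<forall>a\<in>carr F. brk F a c \<in> Q"
  \<comment> \<open>Descending induction from \<open>k\<close> to 1. At level \<open>k\<close> the
    image of \<open>c\<close> lies in the \<open>k\<close>-th term of the lower central series of
    \<open>L\<close>, which is 0, so \<open>c\<close> is in R.\<close>
  proof (rule inc_induct[of "Suc 0" k "\<lambda>j. \<forall>c\<in>S \<inter> lower_central F j. \<forall>a\<in>carr F. brk F a c \<in> Q"])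
    show "Suc 0 \<le> k" using nil by simp
  next
    show "\<forall>c\<in>S \<inter> lower_central F k. \<forall>a\<in>carr F. brk F a c \<in> Q"
    proof (intro ballI)
      fix c a assume c: "c \<in> S \<inter> lower_central F k" "a \<in> carr F"
      then have "\<phi> c = 0" using \<phi>_lower_central[of c k] nil(1) by auto
      then have "c \<in> R" using c S(1) by (auto simp: ker_in_def)
      then show "brk F a c \<in> Q" using brk_R_right c Q by blast
    qed
  next
    fix j assume j: "Suc 0 \<le> j" and
      IH: "\<forall>c\<in>S \<inter> lower_central F (Suc j). \<forall>a\<in>carr F. brk F a c \<in> Q"
    show "\<forall>c\<in>S \<inter> lower_central F j. \<forall>a\<in>carr F. brk F a c \<in> Q"
    proof (intro ballI)
      fix c a assume c: "c \<in> S \<inter> lower_central F j" and a: "a \<in> carr F"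
      have cc: "c \<in> carr F" using c S by blast
      have cd: "c \<in> derived F"
        using c F.lower_central_antimono[OF j] by (auto simp: derived_def)
      obtain w where w: "w \<in> W" "\<phi> (a - w) \<in> derived L" using W(2) a by blast
      have wc: "w \<in> carr F" using w W by blast
      obtain f where f: "f \<in> derived F" "a - w - f \<in> R"
        using derived_decompose[OF F.carr_diff[OF a wc] w(2)] by blast
      have fc: "f \<in> carr F" using f F.derived_carr by blast
      have S': "brk F x c \<in> S \<inter> lower_central F (Suc j)" if "x \<in> carr F" for x
        using that c ideal by (auto intro: F.brk_spanI)
      \<comment> \<open>For fixed \<open>c\<close>, [[x,y],c] is a combination of [x,[y,c]] and
        [y,[x,c]]; the inner brackets lie in the ideal \<open>S\<close> one level further down,
        where the induction hypothesis holds.\<close>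
      have "derived F \<subseteq> {x \<in> carr F. brk F x c \<in> Q}"
        unfolding derived_def
      proof (rule F.brk_span_homogeneous_least[OF F.graded_carr F.graded_carr order_refl order_refl
            F.subspace_brk_left[OF Q(1) cc]])
        fix x y i l assume xy: "x \<in> carr F" "x \<in> part F i" "y \<in> carr F" "y \<in> part F l"
        have "brk F (brk F x y) c = brk F x (brk F y c) - scl F (koszul i l) (brk F y (brk F x c))"
          using F.brk_jacobi_carr[OF xy(2,4) cc] by simp
        moreover have "brk F x (brk F y c) \<in> Q" "brk F y (brk F x c) \<in> Q"
          using IH S' xy by blast+
        ultimately have "brk F (brk F x y) c \<in> Q"
          using Q(1) by (simp add: F.subspace_diff F.subspace_scale)
        then show "brk F x y \<in> {x \<in> carr F. brk F x c \<in> Q}" using xy F.brk_carr by blast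
      qed
      then have "brk F f c \<in> Q" using f by blast
      moreover have "brk F w c \<in> Q" using Q(3) w c cd by blast
      moreover have "brk F (a - w - f) c \<in> Q" using brk_R_left f cc Q(2) by blast
      moreover have "brk F a c = brk F w c + (brk F f c + brk F (a - w - f) c)"
        using a wc fc cc by (simp add: F.brk_diff_left F.carr_diff)
      ultimately show "brk F a c \<in> Q" using Q(1) by (simp add: F.subspace_add)
    qed
  qed
  show ?thesis
  proof (rule F.brk_span_least[OF Q(1)])
    fix a c assume a: "a \<in> carr F" "c \<in> S"
    have cc: "c \<in> carr F" using a S(1) by blast
    \<comment> \<open>The induction covers only \<open>c\<close> in F'; a general element of
      \<open>S\<close> differs from such an element by one of R, and R lies in
      \<open>S\<close>.\<close>
    obtain y where y: "y \<in> derived F" "c - y \<in> R" using derived_decompose[OF cc S(4)] a by blast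
    have "c - (c - y) \<in> S" using y S(2,3) a F.subspace_diff by blast
    then have "brk F a y \<in> Q" using main y a by (simp add: derived_def)
    moreover have "brk F a (c - y) \<in> Q" using brk_R_right a y Q by blast
    moreover have "brk F a c = brk F a y + brk F a (c - y)"
      using a cc y F.derived_carr by (auto simp: F.brk_diff_right)
    ultimately show "brk F a c \<in> Q" using Q(1) by (simp add: F.subspace_add)
  qed
qed

text \<open>The brackets are absorbed into \<open>Q\<close> in stages. With \<open>S\<close> the
  preimage of the hyperplane, [F,S] comes from \<open>brk_ideal_mod\<close>; for t = [u,v], [F,t]
  comes from \<open>brk_derived_mod\<close>; together they give [F, F' + R]. Modulo F' + R every
  element of \<open>F\<close> is a combination of lifts of \<open>E\<close>, so only brackets of two
  such lifts remain, and \<open>P\<close> lists these up to order and up to even squares, which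
  vanish.\<close>

lemma derived_spanning:
  assumes nil: "nilpotent_lsa L" and two: "(2::'k) \<noteq> 0"
    and E: "E \<subseteq> part L 0 \<union> part L 1" and D: "D \<subseteq> part L 0 \<union> part L 1"
    and spD: "L.span D = derived L" and spE: "L.span (E \<union> D) = carr L"
    and u: "u \<in> part F i" and v: "v \<in> part F j" and z: "brk L (\<phi> u) (\<phi> v) = z" "z \<in> D"
    and L2: "brk_span L (carr L) (derived L) \<subseteq> L.span (D - {z})"
    and \<sigma>E: "\<And>e l. e \<in> E \<Longrightarrow> e \<in> part L l \<Longrightarrow> \<sigma> e \<in> part F l \<and> \<phi> (\<sigma> e) = e"
    and \<sigma>D: "\<And>e. e \<in> D \<Longrightarrow> \<sigma> e \<in> carr F \<and> \<phi> (\<sigma> e) = e"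
    and P: "\<And>a b. a \<in> E \<Longrightarrow> b \<in> E \<Longrightarrow> (a, b) \<in> P \<or> (b, a) \<in> P \<or> a = b \<and> a \<in> part L 0"
    and T: "\<And>a b. (a, b) \<in> P \<Longrightarrow> brk F (\<sigma> a) (\<sigma> b) \<in> T"
      "\<And>a b. a \<in> E \<Longrightarrow> b \<in> D - {z} \<Longrightarrow> brk F (\<sigma> a) (\<sigma> b) \<in> T"
      "brk F u (brk F u v) \<in> F.span (FR \<union> T)" "brk F v (brk F u v) \<in> F.span (FR \<union> T)"
  shows "derived F \<subseteq> F.span (FR \<union> T)"
proof -
  define Q where "Q = F.span (FR \<union> T)"
  have Q: "F.subspace Q" "FR \<subseteq> Q" "T \<subseteq> Q"
    unfolding Q_def using F.span_superset[of "FR \<union> T"] by auto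
  obtain k where k: "lower_central L k = {0}" "k > 0" using nil unfolding nilpotent_lsa_def by blast
  have c: "E \<subseteq> carr L" "D \<subseteq> carr L" using E D L.part_carr by auto
  have \<sigma>E': "\<exists>l. e \<in> part L l \<and> \<sigma> e \<in> part F l \<and> \<phi> (\<sigma> e) = e" if "e \<in> E" for e
    using \<sigma>E[OF that] E that by blast
  have \<sigma>c: "\<sigma> ` E \<subseteq> carr F" "\<sigma> ` D \<subseteq> carr F" using \<sigma>E' \<sigma>D F.part_carr by blast+
  have \<sigma>im: "\<phi> ` \<sigma> ` A = A" if "A \<subseteq> E \<or> A \<subseteq> D" for A
    using that \<sigma>E' \<sigma>D by (force simp: image_iff)
  \<comment> \<open>Since \<open>J\<close> contains [L,L'] and lies in L', it is an ideal of
    \<open>L\<close>; its preimage \<open>S\<close> is an ideal of \<open>F\<close> containing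
    R.\<close>
  define J where "J = L.span (D - {z})"
  have J: "L.subspace J" "graded L J" "J \<subseteq> derived L"
    unfolding J_def using D L.span_mono[of "D - {z}" D] spD by (auto intro: L.graded_span)
  define S where "S = pre J"
  have S: "S \<subseteq> carr F" "F.subspace S" "R \<subseteq> S" "graded F S"
    unfolding S_def using pre_carr subspace_pre[OF J(1)] graded_pre[OF J(2,1)] L.subspace_0[OF J(1)]
    by (auto simp: pre_def ker_in_def)
  define W where "W = F.span (\<sigma> ` E)"
  have W: "W \<subseteq> carr F" unfolding W_def using \<sigma>c by (intro F.carr_span)
  have Wx: "\<exists>w\<in>W. \<phi> (x - w) \<in> derived L" if x: "x \<in> carr F" for x
  proof -
    have "\<phi> x \<in> {a + b | a b. a \<in> L.span E \<and> b \<in> L.span D}"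
      using \<phi>_carr[OF x] spE L.span_Un[of E D] by simp
    then obtain a b where ab: "\<phi> x = a + b" "a \<in> L.span E" "b \<in> L.span D" by blast
    then obtain w where w: "w \<in> W" "\<phi> w = a"
      using span_lift[OF \<sigma>c(1), of a] \<sigma>im[of E] unfolding W_def by auto
    have "\<phi> (x - w) = b" using w W x ab(1) by (auto simp: \<phi>_diff subset_iff)
    then show ?thesis using w ab(3) spD by auto
  qed
  have FS: "brk_span F (carr F) S \<subseteq> Q"
  proof (rule brk_ideal_mod[OF k S(1-3) _ _ W Wx Q(1,2)])
    show "\<phi> x \<in> derived L" if "x \<in> S" for x using that J unfolding S_def pre_def by blast
    show "brk F x c \<in> S" if "x \<in> carr F" "c \<in> S" for x c
    proof -
      have "c \<in> carr F" "\<phi> c \<in> derived L" using that J unfolding S_def pre_def by blast+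
      moreover from this have "brk L (\<phi> x) (\<phi> c) \<in> J"
        using L2 L.brk_spanI[of "\<phi> x" "carr L" "\<phi> c" "derived L"] \<phi>_carr that unfolding J_def by blast
      ultimately show ?thesis using that unfolding S_def pre_def by (simp add: \<phi>_brk F.brk_carr)
    qed
    show "brk F w c \<in> Q" if w: "w \<in> W" and cS: "c \<in> S" for w c
    proof -
      have c: "c \<in> carr F" "\<phi> c \<in> J" using cS unfolding S_def pre_def by auto
      have D': "\<sigma> ` (D - {z}) \<subseteq> carr F" using \<sigma>c by blast
      obtain y where y: "y \<in> F.span (\<sigma> ` (D - {z}))" "\<phi> y = \<phi> c"
        using span_lift[OF D', of "\<phi> c"] c \<sigma>im[of "D - {z}"] unfolding J_def by auto
      have yc: "y \<in> carr F" using F.carr_span[OF D'] y by blast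
      then have "c - y \<in> R" using c y by (simp add: ker_in_def F.carr_diff \<phi>_diff)
      then have 1: "brk F w (c - y) \<in> Q" using brk_R_right w W Q by blast
      have 2: "brk F w y \<in> Q"
      proof (rule F.brk_span_span[OF Q(1) \<sigma>c(1) D' _ _ y(1)])
        show "w \<in> F.span (\<sigma> ` E)" using w unfolding W_def .
        show "brk F a b \<in> Q" if "a \<in> \<sigma> ` E" "b \<in> \<sigma> ` (D - {z})" for a b
          using that T(2) Q(3) by blast
      qed
      have "brk F w c = brk F w y + brk F w (c - y)"
        using w W yc c by (auto simp: F.brk_diff_right subset_iff)
      then show ?thesis using 1 2 Q(1) by (simp add: F.subspace_add)
    qed
  qed
  define t where "t = brk F u v"
  have uc: "u \<in> carr F" "v \<in> carr F" using u v F.part_carr by auto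
  have t: "t \<in> carr F" "\<phi> t = z" unfolding t_def using uc z by (auto simp: F.brk_carr \<phi>_brk)
  \<comment> \<open>F' + R is the sum of \<open>S\<close> and the line of \<open>t\<close>, so after
    [F,S] only the brackets with \<open>t\<close> are missing.\<close>
  have modS: "\<exists>a. y - scl F a t \<in> S" if y: "y \<in> carr F" "\<phi> y \<in> derived L" for y
  proof -
    have "\<phi> y \<in> L.span (insert z (D - {z}))" using y spD z(2) by (simp add: insert_absorb)
    then obtain a where "\<phi> y - scl L a z \<in> J"
      using L.span_breakdown_eq[of "\<phi> y" z "D - {z}"] unfolding J_def by blast
    then have "y - scl F a t \<in> S"
      using y t unfolding S_def pre_def by (simp add: F.carr_diff F.carr_scl \<phi>_diff \<phi>_scl)
    then show ?thesis by blast
  qed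
  have tQ: "brk F x t \<in> Q" if x: "x \<in> carr F" for x
    unfolding t_def
  proof (rule F.brk_derived_mod[OF u v Q(1) S(1,4) FS _ _ _ x])
    show "\<exists>c. y - scl F c (brk F u v) \<in> S" if "y \<in> derived F" for y
      using modS[of y] that F.derived_carr \<phi>_derived unfolding t_def by blast
  qed (use T(3,4) in \<open>auto simp: Q_def\<close>)
  have TQ: "brk F x y \<in> Q" if x: "x \<in> carr F" and y: "y \<in> pre (derived L)" for x y
  proof -
    have yc: "y \<in> carr F" using y pre_carr by blast
    obtain a where a: "y - scl F a t \<in> S" using modS y unfolding pre_def by blast
    have "brk F x (y - scl F a t) \<in> Q" using a FS F.brk_spanI[OF x a] by blast
    moreover have "brk F x y = brk F x (y - scl F a t) + scl F a (brk F x t)"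
      using x yc t by (simp add: F.brk_diff_right F.brk_scl_right F.carr_scl)
    ultimately show ?thesis using tQ[OF x] Q(1) by (simp add: F.subspace_add F.subspace_scale)
  qed
  have TQ': "brk F y x \<in> Q" if x: "x \<in> carr F" and y: "y \<in> pre (derived L)" for x y
  proof -
    have "brk_span F (carr F) (pre (derived L)) \<subseteq> Q"
      by (rule F.brk_span_least[OF Q(1)]) (rule TQ)
    then show ?thesis
      using F.brk_swap[OF graded_pre[OF L.graded_derived L.subspace_derived] F.graded_carr pre_carr order_refl y x]
      by blast
  qed
  have EE: "brk F (\<sigma> a) (\<sigma> b) \<in> Q" if a: "a \<in> E" and b: "b \<in> E" for a b
  proof -
    obtain l l' where l: "\<sigma> a \<in> part F l" "\<sigma> b \<in> part F l'" using \<sigma>E' a b by blast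
    consider "(a, b) \<in> P" | "(b, a) \<in> P" | "a = b" "a \<in> part L 0" using P[OF a b] by blast
    then show ?thesis
    proof cases
      case 1 then show ?thesis using T(1) Q by blast
    next
      case 2
      then have "brk F (\<sigma> b) (\<sigma> a) \<in> Q" using T(1) Q by blast
      then show ?thesis
        using F.brk_skew[OF l] F.subspace_neg[OF Q(1)] F.subspace_scale[OF Q(1)] by metis
    next
      case 3
      then have "brk F (\<sigma> a) (\<sigma> b) = 0" using F.brk_even_self[OF two] \<sigma>E[OF a] by blast
      then show ?thesis using F.subspace_0[OF Q(1)] by simp
    qed
  qed
  have WW: "brk F w w' \<in> Q" if "w \<in> W" "w' \<in> W" for w w'
    using F.brk_span_span[OF Q(1) \<sigma>c(1) \<sigma>c(1)] EE that unfolding W_def by blast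
  show ?thesis
    unfolding derived_def Q_def[symmetric]
  proof (rule F.brk_span_least[OF Q(1)])
    fix a b assume a: "a \<in> carr F" and b: "b \<in> carr F"
    obtain w w' where w: "w \<in> W" "\<phi> (a - w) \<in> derived L" and w': "w' \<in> W" "\<phi> (b - w') \<in> derived L"
      using Wx a b by blast
    have wc: "w \<in> carr F" "w' \<in> carr F" using w w' W by auto
    have "a - w \<in> pre (derived L)" "b - w' \<in> pre (derived L)"
      using w w' wc a b unfolding pre_def by (auto simp: F.carr_diff)
    then have "brk F (a - w) b \<in> Q" "brk F w (b - w') \<in> Q" using TQ TQ' wc b by auto
    moreover have "brk F a b = brk F (a - w) b + (brk F w (b - w') + brk F w w')"
      using a b wc by (simp add: F.brk_diff_left F.brk_diff_right)
    ultimately show "brk F a b \<in> Q" using WW[OF w(1) w'(1)] Q(1) by (simp add: F.subspace_add)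
  qed
qed

text \<open>\<open>H\<close> stays a parameter because it measures the slack: the general bound
  takes the two elements [u,[u,v]] and [v,[u,v]], while the extremal case derives a contradiction
  from an \<open>H\<close> with one element.\<close>

lemma multiplier_bound:
  assumes nil: "nilpotent_lsa L" and two: "(2::'k) \<noteq> 0"
    and fin: "finite E" "finite D" "finite H" and indep: "L.independent (E \<union> D)" and disj: "E \<inter> D = {}"
    and E: "E \<subseteq> part L 0 \<union> part L 1" and D: "D \<subseteq> part L 0 \<union> part L 1"
    and spD: "L.span D = derived L" and spE: "L.span (E \<union> D) = carr L"
    and u: "u \<in> part F i" and v: "v \<in> part F j" and z: "brk L (\<phi> u) (\<phi> v) = z" "z \<in> D"
    and L2: "brk_span L (carr L) (derived L) \<subseteq> L.span (D - {z})"
    and P: "P \<subseteq> E \<times> E"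
      "\<And>a b. a \<in> E \<Longrightarrow> b \<in> E \<Longrightarrow> (a, b) \<in> P \<or> (b, a) \<in> P \<or> a = b \<and> a \<in> part L 0"
    and H: "brk F u (brk F u v) \<in> F.span (FR \<union> H)" "brk F v (brk F u v) \<in> F.span (FR \<union> H)"
  shows "multiplier_fin_dim F \<phi> \<and>
    multiplier_dim F \<phi> + card D \<le> card P + card E * (card D - 1) + card H"
proof -
  \<comment> \<open>Two kinds of lift are needed: homogeneous ones on \<open>E\<close>, so that
    skew-symmetry applies to their brackets, and lifts inside F' on \<open>D\<close>, so that they
    count against the part of F' outside R.\<close>
  have "\<exists>f. (e \<in> E \<longrightarrow> (\<forall>l. e \<in> part L l \<longrightarrow> f \<in> part F l \<and> \<phi> f = e)) \<and>
      (e \<in> D \<longrightarrow> f \<in> derived F \<and> \<phi> f = e)" for e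
  proof (cases "e \<in> D")
    case True
    then have "e \<notin> E" "e \<in> derived L" using disj spD L.span_base by auto
    then show ?thesis using derived_lift by blast
  next
    case False
    show ?thesis
    proof (cases "e \<in> E")
      case True
      then obtain l where l: "e \<in> part L l" using E by blast
      obtain f where f: "f \<in> part F l" "\<phi> f = e" using \<phi>_part_surj[OF l] by blast
      have "f \<in> part F l'" if "e \<in> part L l'" for l'
      proof (cases "l = l'")
        case neq: False
        then have "e = 0" using l that L.part_disjoint bit_cases[of l] bit_cases[of l'] by auto
        then show ?thesis using True indep L.dependent_zero by blast
      qed (use f in simp)
      then show ?thesis using f False by blast
    qed (use False in blast)
  qed
  then obtain \<sigma> where \<sigma>: "\<And>e l. e \<in> E \<Longrightarrow> e \<in> part L l \<Longrightarrow> \<sigma> e \<in> part F l \<and> \<phi> (\<sigma> e) = e"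
      "\<And>e. e \<in> D \<Longrightarrow> \<sigma> e \<in> derived F \<and> \<phi> (\<sigma> e) = e"
    by metis
  define T where "T = (\<lambda>(a, b). brk F (\<sigma> a) (\<sigma> b)) ` P \<union> (\<lambda>(a, b). brk F (\<sigma> a) (\<sigma> b)) ` (E \<times> (D - {z})) \<union> H"
  have finP: "finite P" using P(1) fin by (meson finite_SigmaI finite_subset)
  have finT: "finite T" unfolding T_def using fin finP by simp
  have "card T \<le> card P + card (E \<times> (D - {z})) + card H"
    unfolding T_def using fin finP
    by (intro order_trans[OF card_Un_le] add_mono card_image_le) auto
  also have "card (E \<times> (D - {z})) = card E * (card D - 1)"
    using z fin by (simp add: card_cartesian_product)
  finally have cT: "card T \<le> card P + card E * (card D - 1) + card H" .
  have HT: "F.span (FR \<union> H) \<subseteq> F.span (FR \<union> T)" by (rule F.span_mono) (auto simp: T_def)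
  have span: "derived F \<subseteq> F.span (FR \<union> T)"
    by (rule derived_spanning[OF nil two E D spD spE u v z L2 \<sigma>(1) _ P(2)])
      (use \<sigma>(2) F.derived_carr H HT in \<open>force simp: T_def\<close>)+
  have \<phi>\<sigma>: "\<phi> (\<sigma> e) = e" if "e \<in> D" for e using \<sigma>(2) that by blast
  have \<sigma>D: "inj_on \<sigma> D" by (rule inj_on_inverseI) (rule \<phi>\<sigma>)
  have \<phi>\<sigma>D: "\<phi> ` \<sigma> ` D = D" "inj_on \<phi> (\<sigma> ` D)"
    using \<phi>\<sigma> by (auto simp: image_image inj_on_def)
  have "indep_mod (scl F) R (\<sigma> ` D)"
    by (rule indep_mod_ker)
      (use \<phi>\<sigma>D \<sigma>(2) F.derived_carr L.independent_mono[OF indep, of D] in auto)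
  moreover have "F.span (derived F \<inter> R \<union> X) \<subseteq> F.span (R \<union> X)" for X
    by (rule F.span_mono) blast
  ultimately have Z: "indep_mod (scl F) (derived F \<inter> R) (\<sigma> ` D)"
    unfolding indep_mod_def by blast
  have "quot_fin_dim (scl F) (derived F \<inter> R) FR \<and>
    quot_dim (scl F) (derived F \<inter> R) FR + card (\<sigma> ` D) \<le> card T"
    by (rule F.quot_dim_bound[of FR "derived F \<inter> R" "derived F" T "\<sigma> ` D"])
      (use F.subspace_brk_span FR_R FR_derived F.subspace_derived subspace_R finT span Z \<sigma>(2)
        in \<open>auto intro: F.subspace_inter\<close>)
  then show ?thesis
    using cT \<sigma>D unfolding multiplier_fin_dim_def multiplier_dim_def by (simp add: card_image)
qed

end

text \<open>\<open>P\<close> orients every unordered pair once and contains diagonal pairs only over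
  \<open>U\<close>. For \<open>U\<close> the odd part these are the squares [b,b] that skew-symmetry
  does not kill; they account for the summand n - s. Induction on \<open>E\<close> avoids choosing a
  linear order.\<close>

lemma ordered_pairs_exist:
  fixes E U :: "'a set"
  assumes "finite E"
  obtains P where "P \<subseteq> E \<times> E"
    "\<And>a b. a \<in> E \<Longrightarrow> b \<in> E \<Longrightarrow> (a, b) \<in> P \<or> (b, a) \<in> P \<or> a = b \<and> a \<notin> U"
    "\<And>a b. (a, b) \<in> P \<Longrightarrow> (b, a) \<in> P \<Longrightarrow> a = b" "\<And>a. (a, a) \<in> P \<Longrightarrow> a \<in> U"
    "2 * card P = card E * (card E - 1) + 2 * card (E \<inter> U)"
proof -
  have "\<exists>P. P \<subseteq> E \<times> E \<and> (\<forall>a\<in>E. \<forall>b\<in>E. (a, b) \<in> P \<or> (b, a) \<in> P \<or> a = b \<and> a \<notin> U) \<and>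
      (\<forall>a b. (a, b) \<in> P \<longrightarrow> (b, a) \<in> P \<longrightarrow> a = b) \<and> (\<forall>a. (a, a) \<in> P \<longrightarrow> a \<in> U) \<and>
      2 * card P = card E * (card E - 1) + 2 * card (E \<inter> U)"
    using assms
  proof (induction E)
    case (insert e E)
    then obtain P where P: "P \<subseteq> E \<times> E" "\<forall>a\<in>E. \<forall>b\<in>E. (a, b) \<in> P \<or> (b, a) \<in> P \<or> a = b \<and> a \<notin> U"
      "\<forall>a b. (a, b) \<in> P \<longrightarrow> (b, a) \<in> P \<longrightarrow> a = b" "\<forall>a. (a, a) \<in> P \<longrightarrow> a \<in> U"
      "2 * card P = card E * (card E - 1) + 2 * card (E \<inter> U)" by auto
    define D where "D = (if e \<in> U then {(e, e)} else {})"
    define P' where "P' = P \<union> {e} \<times> E \<union> D"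
    have fin: "finite P" using P(1) insert by (meson finite_SigmaI finite_subset)
    have "card (P \<union> {e} \<times> E) = card P + card E"
      using P(1) insert fin by (subst card_Un_disjoint) (auto simp: card_cartesian_product)
    moreover have "card P' = card (P \<union> {e} \<times> E) + card D"
      unfolding P'_def using P(1) insert fin by (intro card_Un_disjoint) (auto simp: D_def)
    moreover have "card (insert e E \<inter> U) = card (E \<inter> U) + card D"
      using insert by (auto simp: D_def)
    ultimately have "2 * card P' = card E * (card E - 1) + 2 * card E + 2 * card (insert e E \<inter> U)"
      using P(5) by simp
    also have "card E * (card E - 1) + 2 * card E = card (insert e E) * (card (insert e E) - 1)"
      using insert by (cases "card E") auto
    finally have "2 * card P' = card (insert e E) * (card (insert e E) - 1) + 2 * card (insert e E \<inter> U)" .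
    moreover have "P' \<subseteq> insert e E \<times> insert e E" unfolding P'_def D_def using P(1) by auto
    moreover have "\<forall>a\<in>insert e E. \<forall>b\<in>insert e E. (a, b) \<in> P' \<or> (b, a) \<in> P' \<or> a = b \<and> a \<notin> U"
      unfolding P'_def D_def using P(2) by auto
    moreover have "\<forall>a b. (a, b) \<in> P' \<longrightarrow> (b, a) \<in> P' \<longrightarrow> a = b" "\<forall>a. (a, a) \<in> P' \<longrightarrow> a \<in> U"
      unfolding P'_def D_def using P(1,3,4) insert(2) by (auto split: if_splits)
    ultimately show ?case by blast
  qed auto
  then show thesis using that by metis
qed

section \<open>Homogeneous bases adapted to L' and [L,L'], and the numerical bound\<close>

context lie_superalgebra
begin

text \<open>If all homogeneous brackets lay in [L,L'], then L' = [L,L'] would be contained in every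
  term of the lower central series, against nilpotency.\<close>

lemma nilpotent_bracket_exists:
  assumes nil: "nilpotent_lsa L" and ne: "derived L \<noteq> {0}"
  obtains i j u v where "u \<in> part L i" "v \<in> part L j" "brk L u v \<notin> brk_span L (carr L) (derived L)"
proof -
  have "\<exists>i j u v. u \<in> part L i \<and> v \<in> part L j \<and> brk L u v \<notin> brk_span L (carr L) (derived L)"
  proof (rule ccontr)
    assume "\<not> ?thesis"
    then have "derived L \<subseteq> brk_span L (carr L) (derived L)"
      unfolding derived_def[of L]
      by (intro brk_span_homogeneous_least[OF graded_carr graded_carr order_refl order_refl subspace_brk_span])
        (auto simp: derived_def)
    then have "derived L \<subseteq> lower_central L k" for k
    proof (induction k)
      case 0 then show ?case by (simp add: derived_carr)
    next
      case (Suc k)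
      then show ?case
        using brk_span_mono[of "carr L" "carr L" "derived L" "lower_central L k"] by auto
    qed
    then have "derived L \<subseteq> {0}" using nil unfolding nilpotent_lsa_def by metis
    then show False using ne subspace_0[OF subspace_derived] by blast
  qed
  then show thesis using that by blast
qed

text \<open>In each parity \<open>e\<close> there is a chain of bases
  \<open>C \<subseteq> B \<subseteq> B'\<close> of the \<open>e\<close>-parts of [L,L'], L' and
  \<open>L\<close>. The homogeneous element [u,v] is made a member of \<open>B\<close> outside
  \<open>C\<close>, so that deleting it from \<open>D\<close> still leaves a spanning set of a space
  containing [L,L'].\<close>

lemma adapted_basis:
  assumes fin: "fin_dim L" and u: "u \<in> part L i" and v: "v \<in> part L j"
    and z: "brk L u v \<notin> brk_span L (carr L) (derived L)"
  obtains D E where "finite D" "finite E" "D \<subseteq> part L 0 \<union> part L 1" "E \<subseteq> part L 0 \<union> part L 1"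
    "E \<inter> D = {}" "independent (E \<union> D)" "span D = derived L" "span (E \<union> D) = carr L"
    "brk L u v \<in> D" "brk_span L (carr L) (derived L) \<subseteq> span (D - {brk L u v})"
    "card D = dim (derived L \<inter> part L 0) + dim (derived L \<inter> part L 1)"
    "card (E \<union> D) = dim (carr L \<inter> part L 0) + dim (carr L \<inter> part L 1)"
    "card (E \<inter> part L 1) + dim (derived L \<inter> part L 1) = dim (carr L \<inter> part L 1)"
proof -
  let ?z = "brk L u v" and ?M = "brk_span L (carr L) (derived L)"
  have Mc: "?M \<subseteq> derived L"
    unfolding derived_def[of L]
    by (intro brk_span_mono) (use derived_carr in \<open>auto simp: derived_def\<close>)
  have gM: "graded L ?M" using graded_brk_span[OF graded_carr graded_derived] derived_carr by blast
  have zl: "?z \<in> part L (i + j)" using brk_part[OF u v] .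
  have zd: "?z \<in> derived L" using brk_derived part_carr u v by blast
  have "\<exists>C B B'. C \<subseteq> B \<and> span C = ?M \<inter> part L e \<and> B \<subseteq> B' \<and> independent B' \<and> B' \<subseteq> part L e \<and>
      span B = derived L \<inter> part L e \<and> span B' = part L e \<and> (e = i + j \<longrightarrow> ?z \<in> B)" for e
  proof -
    obtain C where C: "C \<subseteq> ?M \<inter> part L e" "independent C" "?M \<inter> part L e = span C"
      by (rule basis_extending[OF subspace_inter[OF subspace_brk_span subspace_part] empty_subsetI
            independent_empty])
    \<comment> \<open>[u,v] has parity \<open>i + j\<close>, so it is adjoined in that parity only,
      before \<open>C\<close> is extended to a basis of the \<open>e\<close>-part of L'.\<close>
    define A where "A = (if e = i + j then insert ?z C else C)"
    have "?z \<notin> span C" using z C(3) by blast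
    then have A: "independent A" unfolding A_def using C(2) by (simp add: independent_insertI)
    have A': "A \<subseteq> derived L \<inter> part L e" unfolding A_def using C(1) Mc zd zl by auto
    obtain B where B: "A \<subseteq> B" "B \<subseteq> derived L \<inter> part L e" "independent B"
        "derived L \<inter> part L e = span B"
      by (rule basis_extending[OF subspace_inter[OF subspace_derived subspace_part] A' A])
    have "B \<subseteq> part L e" using B(2) by blast
    then obtain B' where B': "B \<subseteq> B'" "B' \<subseteq> part L e" "independent B'" "part L e = span B'"
      by (rule basis_extending[OF subspace_part _ B(3)])
    have "C \<subseteq> B" "e = i + j \<longrightarrow> ?z \<in> B" using B(1) unfolding A_def by (auto split: if_splits)
    then show ?thesis using B B' C by (intro exI[of _ C] exI[of _ B] exI[of _ B']) simp
  qed
  then obtain C B B' where cB: "\<And>e. C e \<subseteq> B e" and sC: "\<And>e. span (C e) = ?M \<inter> part L e"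
    and BB': "\<And>e. B e \<subseteq> B' e" and iB': "\<And>e. independent (B' e)" and B': "\<And>e. B' e \<subseteq> part L e"
    and sB: "\<And>e. span (B e) = derived L \<inter> part L e" and sB': "\<And>e. span (B' e) = part L e"
    and zB: "?z \<in> B (i + j)"
    by metis
  define D where "D = B 0 \<union> B 1"
  define E where "E = (B' 0 \<union> B' 1) - D"
  have B: "B e \<subseteq> part L e" for e using BB' B' by blast
  have iB: "independent (B e)" for e using independent_mono[OF iB' BB'] .
  have ED: "E \<union> D = B' 0 \<union> B' 1" unfolding E_def D_def using BB' by blast
  note ind = homogeneous_Un_independent[OF B' B' iB' iB']
  have fin': "finite (B' e)" for e
    using finite_independent_carr[OF fin _ iB'] B' part_carr by blast
  have finB: "finite (B e)" for e using finite_subset[OF BB' fin'] .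
  have cp: "carr L \<inter> part L e = part L e" for e using part_carr by blast
  have D: "span D = derived L"
    unfolding D_def by (rule graded_eq_span[OF graded_derived subspace_derived, symmetric]) (simp_all add: sB)
  have "span (E \<union> D) = carr L"
    unfolding ED by (rule graded_eq_span[OF graded_carr subspace_carr, symmetric]) (simp_all add: sB' cp)
  moreover have "finite D" "finite E" unfolding D_def E_def using fin' finB by auto
  moreover have "D \<subseteq> part L 0 \<union> part L 1" "E \<subseteq> part L 0 \<union> part L 1"
    using B B' by (auto simp: D_def E_def)
  moreover have "E \<inter> D = {}" unfolding E_def by blast
  moreover have "independent (E \<union> D)" unfolding ED by (rule ind)
  moreover have "?z \<in> D" using zB bit_cases[of "i + j"] unfolding D_def by auto
  moreover have "?M \<subseteq> span (D - {?z})"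
  proof -
    have "?M = span (C 0 \<union> C 1)"
      by (rule graded_eq_span[OF gM subspace_brk_span]) (simp_all add: sC)
    moreover have "?z \<notin> C e" for e using sC[of e] z span_base[of ?z "C e"] by blast
    then have "C 0 \<union> C 1 \<subseteq> D - {?z}" unfolding D_def using cB by blast
    ultimately show ?thesis using span_mono by metis
  qed
  moreover have dB: "dim (derived L \<inter> part L e) = card (B e)" for e
    using dim_span_eq_card_independent[OF iB] sB by metis
  moreover have "card D = card (B 0) + card (B 1)"
    unfolding D_def using finB homogeneous_Un_independent[OF B B iB iB] by (intro card_Un_disjoint) auto
  moreover have dB': "dim (carr L \<inter> part L e) = card (B' e)" for e
    using dim_span_eq_card_independent[OF iB'] sB' cp by metis
  moreover have "card (E \<union> D) = card (B' 0) + card (B' 1)"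
    unfolding ED using fin' ind by (intro card_Un_disjoint) auto
  moreover have "card (E \<inter> part L 1) + card (B 1) = card (B' 1)"
  proof -
    have "0 \<notin> B' e" for e using iB' dependent_zero by blast
    then have "B' 0 \<inter> part L 1 = {}" using B'[of 0] part_disjoint by blast
    then have "E \<inter> part L 1 = B' 1 - B 1"
      unfolding E_def D_def using B'[of 1] B[of 0] BB'[of 0] by blast
    then show ?thesis using card_Diff_subset[OF finB BB', of 1] card_mono[OF fin' BB', of 1] by simp
  qed
  ultimately show thesis using D by (intro that[of D E]) simp_all
qed

end

context lsa_epimorphism
begin

text \<open>With g = |E| and d = r + s, the spanning set has g(g-1)/2 + (n - s) + g(d-1) + |H|
  elements, of which d are spent on L'. Rewriting this by m + n = g + d gives the stated form, in
  which |H| = 2 cancels the summand 2 and \<open>s\<close> remains as a gain.\<close>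

lemma multiplier_dim_bound:
  assumes nil: "nilpotent_lsa L" and two: "(2::'k) \<noteq> 0" and fin: "fin_dim L"
    and mn: "sdim L (carr L) = (m, n)" and rs: "sdim L (derived L) = (r, s)"
    and u: "u \<in> part F i" and v: "v \<in> part F j"
    and z: "brk L (\<phi> u) (\<phi> v) \<notin> brk_span L (carr L) (derived L)"
    and H: "finite H" "brk F u (brk F u v) \<in> F.span (FR \<union> H)" "brk F v (brk F u v) \<in> F.span (FR \<union> H)"
  shows "multiplier_fin_dim F \<phi>"
    and "real (multiplier_dim F \<phi>) + real s + 2 \<le>
      1 / 2 * ((real m + real n + real r + real s - 2) * (real m + real n - real r - real s - 1))
         + real n + 1 + real (card H)"
proof -
  obtain D E where D: "finite D" "finite E" "D \<subseteq> part L 0 \<union> part L 1" "E \<subseteq> part L 0 \<union> part L 1"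
    "E \<inter> D = {}" "L.independent (E \<union> D)" "L.span D = derived L" "L.span (E \<union> D) = carr L"
    "brk L (\<phi> u) (\<phi> v) \<in> D"
    "brk_span L (carr L) (derived L) \<subseteq> L.span (D - {brk L (\<phi> u) (\<phi> v)})"
    and cd: "card D = L.dim (derived L \<inter> part L 0) + L.dim (derived L \<inter> part L 1)"
    "card (E \<union> D) = L.dim (carr L \<inter> part L 0) + L.dim (carr L \<inter> part L 1)"
    "card (E \<inter> part L 1) + L.dim (derived L \<inter> part L 1) = L.dim (carr L \<inter> part L 1)"
    by (rule L.adapted_basis[OF fin \<phi>_part[OF u] \<phi>_part[OF v] z])
  have c: "card D = r + s" "card E + (r + s) = m + n" "card (E \<inter> part L 1) + s = n"
    using cd mn rs card_Un_disjoint[OF D(2,1,5)] unfolding sdim_def by auto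
  obtain P where P: "P \<subseteq> E \<times> E"
    "\<And>a b. a \<in> E \<Longrightarrow> b \<in> E \<Longrightarrow> (a, b) \<in> P \<or> (b, a) \<in> P \<or> a = b \<and> a \<notin> part L 1"
    "2 * card P = card E * (card E - 1) + 2 * card (E \<inter> part L 1)"
    using ordered_pairs_exist[OF D(2), of "part L 1"] by metis
  have P2: "(a, b) \<in> P \<or> (b, a) \<in> P \<or> a = b \<and> a \<in> part L 0" if "a \<in> E" "b \<in> E" for a b
    using P(2)[OF that] D(4) that by blast
  have b: "multiplier_fin_dim F \<phi> \<and>
    multiplier_dim F \<phi> + card D \<le> card P + card E * (card D - 1) + card H"
    by (rule multiplier_bound[OF nil two D(2,1) H(1) D(6,5,4,3,7,8) u v refl D(9,10) P(1) P2 H(2,3)])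
  then show "multiplier_fin_dim F \<phi>" by blast
  define g where "g = card E"
  \<comment> \<open>This makes the truncated \<open>card D - 1\<close> an honest difference before
    passing to the reals.\<close>
  have "card D \<ge> 1" using D(1,9) card_gt_0_iff[of D] by fastforce
  then have "real (multiplier_dim F \<phi>) + real (card D) \<le> real (card P) + real g * (real (card D) - 1) + real (card H)"
    using b of_nat_mono[of "multiplier_dim F \<phi> + card D" _, where 'a=real] unfolding g_def[symmetric]
    by (fastforce simp: of_nat_diff)
  moreover have "2 * real (card P) = real g * (real g - 1) + 2 * real (card (E \<inter> part L 1))"
  proof -
    have "real (2 * card P) = real (g * (g - 1) + 2 * card (E \<inter> part L 1))"
      using P(3) unfolding g_def by simp
    then show ?thesis by (cases g) (auto simp: algebra_simps)
  qed
  moreover have "real m + real n = real g + (real r + real s)" using c unfolding g_def by linarith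
  moreover have "real (card (E \<inter> part L 1)) = real n - real s" using c by linarith
  moreover have "real (card D) = real r + real s" using c by simp
  ultimately show "real (multiplier_dim F \<phi>) + real s + 2 \<le>
      1 / 2 * ((real m + real n + real r + real s - 2) * (real m + real n - real r - real s - 1))
         + real n + 1 + real (card H)"
    by (simp add: algebra_simps)
qed

end

section \<open>Algebras attaining the bound\<close>

text \<open>The internal form of a decomposition into H(1,0) and an abelian summand:
  \<open>y\<close>, \<open>w\<close> and [y,w] span the Heisenberg part, and \<open>A\<close>
  together with the odd part of \<open>L\<close> is the abelian one. Being free of bases and
  isomorphisms, it can be reached both from extremality and from a given isomorphism.\<close>

locale heisenberg_split = lie_superalgebra L
  for L :: "('k::field, 'a::ab_group_add) superalgebra" +
  fixes y w :: 'a and A :: "'a set"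
  assumes y: "y \<in> part L 0" and w: "w \<in> part L 0" and A: "subspace A" "A \<subseteq> part L 0"
    and central: "\<lbrakk>a \<in> A \<or> a \<in> part L 1 \<or> a = brk L y w; x \<in> carr L\<rbrakk> \<Longrightarrow> brk L a x = 0"
    and split: "x \<in> part L 0 \<Longrightarrow>
      \<exists>b c d. \<exists>a\<in>A. x = scl L b y + scl L c w + scl L d (brk L y w) + a"
    and split_unique: "\<lbrakk>a \<in> A; scl L b y + scl L c w + scl L d (brk L y w) + a = 0\<rbrakk>
      \<Longrightarrow> b = 0 \<and> c = 0 \<and> d = 0"
begin

abbreviation "z \<equiv> brk L y w"

lemma z: "z \<in> part L 0"
  using brk_part[OF y w] by simp

text \<open>A basis of \<open>A\<close> is enlarged by z, w, y in turn. If one of them lay in the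
  span of the earlier ones, its difference with that combination would be a vanishing sum in which
  it has coefficient 1, contrary to \<open>split_unique\<close>.\<close>

lemma basis_exists:
  assumes fin: "fin_dim L"
  obtains B where "finite B" "independent B" "span B = carr L" "B \<subseteq> part L 0 \<union> part L 1"
    "{y, w, z} \<subseteq> B" "part L 0 = span (B \<inter> part L 0)" "part L 1 = span (B \<inter> part L 1)"
    "A = span (B \<inter> part L 0 - {y, w, z})"
    "card (B \<inter> part L 0) = dim (carr L \<inter> part L 0)" "card (B \<inter> part L 1) = dim (carr L \<inter> part L 1)"
    "y \<noteq> w" "y \<noteq> z" "w \<noteq> z"
proof -
  obtain C where C: "C \<subseteq> A" "independent C" "A = span C"
    by (rule basis_extending[OF A(1) empty_subsetI independent_empty])
  have zC: "z \<notin> span C"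
  proof
    assume "z \<in> span C"
    then have "- z \<in> A" using C(3) span_neg by blast
    then show False using split_unique[of "- z" 0 0 1] by simp
  qed
  have wC: "w \<notin> span (insert z C)"
  proof
    assume "w \<in> span (insert z C)"
    then obtain k where "w - scl L k z \<in> A" unfolding span_breakdown_eq C(3) by blast
    then have "- (w - scl L k z) \<in> A" using A(1) subspace_neg by blast
    then show False using split_unique[of "- (w - scl L k z)" 0 1 "- k"] by simp
  qed
  have yC: "y \<notin> span (insert w (insert z C))"
  proof
    assume "y \<in> span (insert w (insert z C))"
    then obtain k l where "y - scl L k w - scl L l z \<in> A" unfolding span_breakdown_eq C(3) by blast
    then have "- (y - scl L k w - scl L l z) \<in> A" using A(1) subspace_neg by blast
    then show False using split_unique[of "- (y - scl L k w - scl L l z)" 1 "- k" "- l"] by simp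
  qed
  define B0 where "B0 = insert y (insert w (insert z C))"
  have iB0: "independent B0"
    unfolding B0_def using yC wC zC C(2) by (intro independent_insertI)
  have B0: "B0 \<subseteq> part L 0" unfolding B0_def using y w z C(1) A by blast
  have sB0: "span B0 = part L 0"
  proof
    show "span B0 \<subseteq> part L 0" using B0 subspace_part by (rule span_minimal)
    show "part L 0 \<subseteq> span B0"
    proof
      fix x assume "x \<in> part L 0"
      then obtain b c d a where x: "a \<in> A" "x = scl L b y + scl L c w + scl L d z + a" using split by blast
      have "a \<in> span B0" using x(1) C(3) span_mono[of C B0] unfolding B0_def by blast
      moreover have "y \<in> span B0" "w \<in> span B0" "z \<in> span B0"
        unfolding B0_def by (auto intro: span_base)
      ultimately show "x \<in> span B0" unfolding x(2) by (intro span_add span_scale)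
    qed
  qed
  obtain B1 where B1: "B1 \<subseteq> part L 1" "independent B1" "part L 1 = span B1"
    by (rule basis_extending[OF subspace_part[of 1] empty_subsetI independent_empty])
  note u = homogeneous_Un_independent[OF B0 B1(1) iB0 B1(2)]
  have cp: "carr L \<inter> part L e = part L e" for e using part_carr by blast
  have nz: "0 \<notin> B0" "0 \<notin> B1" using iB0 B1(2) dependent_zero by blast+
  have B01: "(B0 \<union> B1) \<inter> part L 0 = B0" "(B0 \<union> B1) \<inter> part L 1 = B1"
    using B0 B1(1) nz part_disjoint by blast+
  have fin': "finite (B0 \<union> B1)"
    using B0 B1(1) part_carr by (intro finite_independent_carr[OF fin _ u(1)]) blast
  have dist: "y \<noteq> w" "y \<noteq> z" "w \<noteq> z" using yC wC span_base[of _ "insert w (insert z C)"]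
      span_base[of _ "insert z C"] by blast+
  have BC: "B0 - {y, w, z} = C"
    using yC wC zC span_base[of _ C] span_mono[of C "insert z C"] span_mono[of C "insert w (insert z C)"]
    unfolding B0_def by blast
  have sp: "span (B0 \<union> B1) = carr L"
    by (rule graded_eq_span[OF graded_carr subspace_carr, symmetric]) (simp_all add: cp sB0 B1(3)[symmetric])
  show thesis
  proof (rule that[OF fin' u(1) sp])
    show "B0 \<union> B1 \<subseteq> part L 0 \<union> part L 1" using B0 B1 by blast
    show "{y, w, z} \<subseteq> B0 \<union> B1" unfolding B0_def by blast
    show "card ((B0 \<union> B1) \<inter> part L 0) = dim (carr L \<inter> part L 0)"
      using dim_span_eq_card_independent[OF iB0] by (simp only: B01 cp sB0)
    show "card ((B0 \<union> B1) \<inter> part L 1) = dim (carr L \<inter> part L 1)"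
      using dim_span_eq_card_independent[OF B1(2)] by (simp only: B01 cp B1(3)[symmetric])
  qed (use B01 B1 BC C sB0 dist in simp_all)
qed

end

section \<open>Superalgebras whose derived subalgebra is an even line\<close>

context lie_superalgebra
begin

lemma dim_one_line:
  assumes "fin_dim L" "subspace V" "V \<subseteq> carr L" "dim V = 1"
  obtains z where "z \<noteq> 0" "V = span {z}"
proof -
  obtain B where B: "B \<subseteq> V" "independent B" "V = span B"
    by (rule basis_extending[OF assms(2) empty_subsetI independent_empty])
  then have "card B = 1" using assms(4) dim_span_eq_card_independent by simp
  then obtain z where "B = {z}" using card_1_singletonE by blast
  then show thesis using that B by auto
qed

text \<open>\<open>dim\<close> takes the value 0 on infinite-dimensional spaces as well;
  \<open>fin_dim\<close> rules these out, so that the basis is empty.\<close>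

lemma dim_zero_trivial:
  assumes "fin_dim L" "subspace V" "V \<subseteq> carr L" "dim V = 0"
  shows "V = {0}"
proof -
  obtain B where B: "B \<subseteq> V" "independent B" "V = span B"
    by (rule basis_extending[OF assms(2) empty_subsetI independent_empty])
  then have "card B = 0" using assms(4) dim_span_eq_card_independent by simp
  moreover have "finite B" using finite_independent_carr[OF assms(1) _ B(2)] B(1) assms(3) by blast
  ultimately show ?thesis using B by simp
qed

lemma derived_even_line:
  assumes fin: "fin_dim L" and d: "sdim L (derived L) = (1, 0)"
  shows "derived L \<subseteq> part L 0" and "\<lbrakk>x \<in> derived L; x \<noteq> 0\<rbrakk> \<Longrightarrow> derived L = span {x}"
    and "derived L \<noteq> {0}"
proof -
  have sub: "subspace (derived L \<inter> part L e)" for e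
    using subspace_derived subspace_part by (rule subspace_inter)
  have c: "derived L \<inter> part L e \<subseteq> carr L" for e using part_carr by blast
  have d': "dim (derived L \<inter> part L 0) = 1" "dim (derived L \<inter> part L 1) = 0"
    using d unfolding sdim_def by auto
  have t: "derived L \<inter> part L 1 = {0}" by (rule dim_zero_trivial[OF fin sub c d'(2)])
  show sub0: "derived L \<subseteq> part L 0"
  proof
    fix x assume "x \<in> derived L"
    then obtain a b where "a \<in> derived L" "a \<in> part L 0" "b \<in> derived L" "b \<in> part L 1" "x = a + b"
      using graded_derived by (auto elim: gradedE)
    moreover from this have "b = 0" using t by blast
    ultimately show "x \<in> part L 0" by simp
  qed
  obtain z where z: "z \<noteq> 0" "derived L \<inter> part L 0 = span {z}"
    by (rule dim_one_line[OF fin sub c d'(1)])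
  then have dz: "derived L = span {z}" using sub0 by blast
  show "derived L \<noteq> {0}" using dz z(1) span_base[of z "{z}"] by auto
  show "derived L = span {x}" if x: "x \<in> derived L" "x \<noteq> 0"
  proof -
    obtain k where k: "x = scl L k z" using x(1) unfolding dz span_singleton by blast
    then have "k \<noteq> 0" using x(2) by auto
    then have "z = scl L (inverse k) x" using k by simp
    then have "z \<in> span {x}" using span_base[of x "{x}"] span_scale by (metis singletonI)
    then have "span {z} \<subseteq> span {x}" by (intro span_minimal) auto
    moreover have "span {x} \<subseteq> span {z}" using x(1) dz by (intro span_minimal) auto
    ultimately show ?thesis using dz by simp
  qed
qed

text \<open>A nonzero subspace [L,L'] of the line L' would be all of L', which nilpotency
  forbids.\<close>

lemma derived_even_line_central:
  assumes fin: "fin_dim L" and nil: "nilpotent_lsa L" and d: "sdim L (derived L) = (1, 0)"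
  shows "brk_span L (carr L) (derived L) = {0}"
proof (rule ccontr)
  let ?M = "brk_span L (carr L) (derived L)"
  assume "?M \<noteq> {0}"
  then obtain x where x: "x \<in> ?M" "x \<noteq> 0" using subspace_0[OF subspace_brk_span] by blast
  have "?M \<subseteq> derived L"
    unfolding derived_def[of L] by (intro brk_span_mono) (use derived_carr in \<open>auto simp: derived_def\<close>)
  then have "derived L = span {x}" using derived_even_line(2)[OF fin d] x by blast
  also have "\<dots> \<subseteq> ?M" using x(1) by (intro span_minimal subspace_brk_span) auto
  finally have sub: "derived L \<subseteq> ?M" .
  obtain i j u v where "u \<in> part L i" "v \<in> part L j" "brk L u v \<notin> ?M"
    using nilpotent_bracket_exists[OF nil derived_even_line(3)[OF fin d]] by metis
  then show False using sub brk_derived part_carr by blast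
qed

text \<open>Extremality will supply \<open>odd\<close> and \<open>rank\<close>. The latter says that
  an even element orthogonal to one hyperbolic pair \<open>y\<close>, \<open>w\<close> is orthogonal
  to all even elements, so the bracket form on the even part has rank two.\<close>

lemma heisenberg_splitI:
  assumes two: "(2::'k) \<noteq> 0" and fin: "fin_dim L" and nil: "nilpotent_lsa L"
    and d: "sdim L (derived L) = (1, 0)"
    and odd: "\<And>b. b \<in> part L 1 \<Longrightarrow> brk L b b = 0"
    and rank: "\<And>u v y w. \<lbrakk>u \<in> part L 0; v \<in> part L 0; y \<in> part L 0; w \<in> part L 0; brk L y w \<noteq> 0;
        brk L u y = 0; brk L u w = 0\<rbrakk> \<Longrightarrow> brk L u v = 0"
  shows "\<exists>y w A. heisenberg_split L y w A"
proof -
  note line = derived_even_line[OF fin d]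
  have skew_0: "brk L b a = 0" if "brk L a b = 0" "a \<in> part L i" "b \<in> part L j" for a b i j
    using brk_skew[OF that(3,2)] that(1) by simp
  \<comment> \<open>Polarisation: on odd elements the bracket is symmetric, so its squares determine
    it up to the factor 2.\<close>
  have oddodd: "brk L a b = 0" if ab: "a \<in> part L 1" "b \<in> part L 1" for a b
  proof -
    have c: "a \<in> carr L" "b \<in> carr L" using ab part_carr by auto
    have "brk L (a + b) (a + b) = 0" using odd subspace_add[OF subspace_part ab] by blast
    moreover have "brk L (a + b) (a + b) = brk L a b + brk L b a"
      using c odd ab by (simp add: brk_add_left brk_add_right carr_add)
    moreover have "brk L b a = brk L a b" using brk_skew[OF ab(2,1)] by (simp add: koszul_def)
    ultimately have "scl L 2 (brk L a b) = 0" using scale_left_distrib[of 1 1 "brk L a b"] by simp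
    then show ?thesis using two by simp
  qed
  \<comment> \<open>Such a bracket is odd, whereas L' is even.\<close>
  have evenodd: "brk L a b = 0" if ab: "a \<in> part L 0" "b \<in> part L 1" for a b
    using brk_part[OF ab] brk_derived[of a b] line(1) part_carr[OF ab(1)] part_carr[OF ab(2)] part_disjoint
    by auto
  have odd_central: "brk L b x = 0" if b: "b \<in> part L 1" and x: "x \<in> carr L" for b x
  proof -
    obtain p q where pq: "x = p + q" "p \<in> part L 0" "q \<in> part L 1" using x unfolding carr_def by blast
    have "brk L b p = 0" using skew_0[OF evenodd[OF pq(2) b] pq(2) b] .
    then show ?thesis using pq b oddodd part_carr by (simp add: brk_add_right)
  qed
  obtain y w where yw: "y \<in> part L 0" "w \<in> part L 0" "brk L y w \<noteq> 0"
  proof -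
    have "\<exists>y\<in>part L 0. \<exists>w\<in>part L 0. brk L y w \<noteq> 0"
    proof (rule ccontr)
      assume n: "\<not> ?thesis"
      have "derived L \<subseteq> {0}"
        unfolding derived_def
      proof (rule brk_span_homogeneous_least[OF graded_carr graded_carr order_refl order_refl])
        fix a b i j assume ab: "a \<in> carr L" "a \<in> part L i" "b \<in> carr L" "b \<in> part L j"
        consider "i = 1" | "i = 0" "j = 0" | "i = 0" "j = 1" using bit_cases by blast
        then show "brk L a b \<in> {0}"
          using n ab odd_central evenodd by cases auto
      qed simp
      then show False using line(3) subspace_0[OF subspace_derived] by blast
    qed
    then show thesis using that by blast
  qed
  let ?z = "brk L y w"
  have yc: "y \<in> carr L" "w \<in> carr L" using yw part_carr by auto
  have zd: "?z \<in> derived L" using brk_derived yc by blast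
  have z0: "?z \<in> part L 0" using zd line(1) by blast
  have zc: "?z \<in> carr L" using z0 part_carr by blast
  have cz: "brk L x ?z = 0" if "x \<in> carr L" for x
    using derived_even_line_central[OF fin nil d] brk_spanI[OF that zd] by auto
  have cz': "brk L ?z x = 0" if x: "x \<in> carr L" for x
  proof -
    obtain p q where pq: "x = p + q" "p \<in> part L 0" "q \<in> part L 1" using x unfolding carr_def by blast
    have "brk L ?z p = 0" "brk L ?z q = 0"
      using skew_0[OF cz[OF part_carr[OF pq(2)]] pq(2) z0] skew_0[OF cz[OF part_carr[OF pq(3)]] pq(3) z0]
      by blast+
    then show ?thesis using pq part_carr zc by (simp add: brk_add_right)
  qed
  \<comment> \<open>The orthogonal complement of the hyperbolic pair in the even part; by
    \<open>rank\<close> it is central. It contains [y,w], and \<open>A\<close> below is a complement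
    of that line in it.\<close>
  define Z where "Z = {x \<in> part L 0. brk L x y = 0 \<and> brk L x w = 0}"
  have Zsub: "subspace Z"
    by (rule subspaceI)
      (auto simp: Z_def subspace_0[OF subspace_part] subspace_add[OF subspace_part] subspace_scale[OF subspace_part]
        brk_0 yc brk_add_left brk_scl_left part_carr)
  have Zcentral: "brk L a x = 0" if a: "a \<in> Z" and x: "x \<in> carr L" for a x
  proof -
    obtain p q where pq: "x = p + q" "p \<in> part L 0" "q \<in> part L 1" using x unfolding carr_def by blast
    have a0: "a \<in> part L 0" using a unfolding Z_def by blast
    have "brk L a p = 0" using rank[OF a0 pq(2) yw] a unfolding Z_def by blast
    moreover have "brk L a q = 0" using evenodd a0 pq by blast
    ultimately show ?thesis using pq a0 part_carr by (simp add: brk_add_right)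
  qed
  have "?z \<in> Z" using z0 cz' yc unfolding Z_def by blast
  then have zZ: "{?z} \<subseteq> Z" by simp
  have zi: "independent {?z}" using yw(3) by simp
  obtain B where B: "{?z} \<subseteq> B" "B \<subseteq> Z" "independent B" "Z = span B"
    by (rule basis_extending[OF Zsub zZ zi])
  define A where "A = span (B - {?z})"
  have AZ: "A \<subseteq> Z" unfolding A_def using B(4) span_mono[of "B - {?z}" B] by blast
  have ybr: "brk L y y = 0" "brk L w w = 0" using brk_even_self[OF two] yw by auto
  have wy: "brk L w y = - ?z" using brk_skew[OF yw(2,1)] by (simp add: koszul_def)
  have "heisenberg_split L y w A"
  proof unfold_locales
    show "y \<in> part L 0" "w \<in> part L 0" using yw by auto
    show "subspace A" unfolding A_def by (rule subspace_span)
    show "A \<subseteq> part L 0" using AZ unfolding Z_def by blast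
    show "brk L a x = 0" if "a \<in> A \<or> a \<in> part L 1 \<or> a = ?z" "x \<in> carr L" for a x
      using that Zcentral odd_central cz' AZ by blast
    show "\<exists>b c d. \<exists>a\<in>A. x = scl L b y + scl L c w + scl L d ?z + a" if x: "x \<in> part L 0" for x
    proof -
      have xc: "x \<in> carr L" using x part_carr by blast
      have sp: "derived L = span {?z}" using line(2) zd yw(3) by blast
      obtain b where b: "brk L x w = scl L b ?z"
        using brk_derived[OF xc yc(2)] unfolding sp span_singleton by blast
      obtain c where c: "brk L x y = scl L c ?z"
        using brk_derived[OF xc yc(1)] unfolding sp span_singleton by blast
      \<comment> \<open>The projection of \<open>x\<close> to the orthogonal complement of
        \<open>y\<close>, \<open>w\<close>. The coefficient of \<open>w\<close> enters with a plus
        sign because [w,y] = -[y,w].\<close>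
      define t where "t = x - scl L b y + scl L c w"
      have "t \<in> part L 0"
        unfolding t_def using x yw subspace_part
        by (intro subspace_add[OF subspace_part] subspace_diff[OF subspace_part] subspace_scale[OF subspace_part])
      moreover have "brk L t y = 0" "brk L t w = 0"
        unfolding t_def using xc yc b c wy ybr
        by (simp_all add: brk_add_left brk_diff_left brk_scl_left carr_scl carr_diff)
      ultimately have "t \<in> span (insert ?z (B - {?z}))"
        using B(1,4) unfolding Z_def by (auto simp: insert_absorb)
      then obtain e where "t - scl L e ?z \<in> A" unfolding span_breakdown_eq A_def by blast
      moreover have "x = scl L b y + scl L (- c) w + scl L e ?z + (t - scl L e ?z)"
        unfolding t_def by simp
      ultimately show ?thesis by blast
    qed
    show "b = 0 \<and> c = 0 \<and> e = 0" if a: "a \<in> A" and e: "scl L b y + scl L c w + scl L e ?z + a = 0" for a b c e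
    proof -
      have aZ: "a \<in> Z" "a \<in> carr L" using a AZ part_carr unfolding Z_def by auto
      have "brk L (scl L b y + scl L c w + scl L e ?z + a) w = 0" using e brk_0 yc by simp
      then have "scl L b ?z = 0"
        using aZ yc ybr zc cz' Zcentral by (simp add: brk_add_left brk_scl_left carr_scl carr_add)
      then have b: "b = 0" using yw(3) by simp
      have "brk L (scl L b y + scl L c w + scl L e ?z + a) y = 0" using e brk_0 yc by simp
      then have "scl L c ?z = 0"
        using aZ yc ybr zc cz' Zcentral wy by (simp add: brk_add_left brk_scl_left carr_scl carr_add)
      then have c: "c = 0" using yw(3) by simp
      have "e = 0"
      proof (rule ccontr)
        assume "e \<noteq> 0"
        have "scl L e ?z = - a" using e b c by (simp add: eq_neg_iff_add_eq_0)
        then have "?z = scl L (inverse e) (- a)" using \<open>e \<noteq> 0\<close> scale_scale[of "inverse e" e ?z] by simp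
        then have "?z \<in> A" using a unfolding A_def by (metis span_neg span_scale)
        then show False using B(1,3) unfolding A_def dependent_def by blast
      qed
      then show ?thesis using b c by simp
    qed
  qed
  then show ?thesis by blast
qed

end

section \<open>Equality in the bound forces rank two\<close>

context lsa_epimorphism
begin

lemma extremal_imp_heisenberg_split:
  assumes nil: "nilpotent_lsa L" and two: "(2::'k) \<noteq> 0" and three: "(3::'k) \<noteq> 0" and fin: "fin_dim L"
    and mn: "sdim L (carr L) = (m, n)" and rs: "sdim L (derived L) = (1, 0)"
    and eq: "real (multiplier_dim F \<phi>) =
      1 / 2 * ((real m + real n - 1) * (real m + real n - 2)) + real n + 1"
  shows "\<exists>y w A. heisenberg_split L y w A"
proof -
  note M2 = L.derived_even_line_central[OF fin nil rs]
  \<comment> \<open>Otherwise [v,[u,v]] alone would serve as \<open>H\<close>, and the bound would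
    drop below the assumed value by 1.\<close>
  have key: "brk F u (brk F u v) \<notin> FR"
    if u: "u \<in> part F i" and v: "v \<in> part F j" and nz: "brk L (\<phi> u) (\<phi> v) \<noteq> 0" for u v i j
  proof
    assume "brk F u (brk F u v) \<in> FR"
    then have "brk F u (brk F u v) \<in> F.span (FR \<union> {brk F v (brk F u v)})" by (intro F.span_base) simp
    moreover have "brk F v (brk F u v) \<in> F.span (FR \<union> {brk F v (brk F u v)})" by (intro F.span_base) simp
    moreover have "brk L (\<phi> u) (\<phi> v) \<notin> brk_span L (carr L) (derived L)" using nz M2 by simp
    ultimately have "real (multiplier_dim F \<phi>) + real 0 + 2 \<le>
      1 / 2 * ((real m + real n + real 1 + real 0 - 2) * (real m + real n - real 1 - real 0 - 1))
         + real n + 1 + real (card {brk F v (brk F u v)})"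
      by (intro multiplier_dim_bound(2)[OF nil two fin mn rs u v]) simp_all
    then show False using eq by (simp add: algebra_simps)
  qed
  show ?thesis
  proof (rule L.heisenberg_splitI[OF two fin nil rs])
    fix b assume b: "b \<in> part L 1"
    show "brk L b b = 0"
    proof (rule ccontr)
      assume nz: "brk L b b \<noteq> 0"
      obtain f where f: "f \<in> part F 1" "\<phi> f = b" using \<phi>_part_surj[OF b] by blast
      let ?t = "brk F f (brk F f f)"
      have ff: "brk F f f \<in> part F 0" using F.brk_part[OF f(1) f(1)] by simp
      have "brk F (brk F f f) f = - ?t" using F.brk_skew[OF ff f(1)] by (simp add: koszul_def)
      \<comment> \<open>For odd \<open>f\<close> the Jacobi identity for f, f, f turns into 3
        [f,[f,f]] = 0, so the element that \<open>key\<close> keeps out of [F,R] would be 0.\<close>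
      then have "?t = - ?t - ?t" using F.brk_jacobi[OF f(1) f(1) f(1)] by (simp add: koszul_def)
      moreover have "t + t + t = 0" if "t = - t - t" for t :: 'f
      proof -
        have "(- t - t) + t + t = 0" by (simp add: algebra_simps)
        then show ?thesis by (simp only: that[symmetric])
      qed
      ultimately have "?t + ?t + ?t = 0" by blast
      then have "scl F 3 ?t = 0"
        using F.scale_left_distrib[of 1 2 ?t] F.scale_left_distrib[of 1 1 ?t] by (simp add: add.assoc)
      then have "?t = 0" using three by simp
      then have "?t \<in> FR" using F.subspace_0[OF F.subspace_brk_span] by simp
      then show False using key[OF f(1) f(1)] nz f(2) by simp
    qed
  next
    fix u v y w
    assume p: "u \<in> part L 0" "v \<in> part L 0" "y \<in> part L 0" "w \<in> part L 0"
      and nz: "brk L y w \<noteq> 0" and z: "brk L u y = 0" "brk L u w = 0"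
    show "brk L u v = 0"
    proof (rule ccontr)
      assume uv: "brk L u v \<noteq> 0"
      obtain u' v' y' w' where f: "u' \<in> part F 0" "\<phi> u' = u" "v' \<in> part F 0" "\<phi> v' = v"
        "y' \<in> part F 0" "\<phi> y' = y" "w' \<in> part F 0" "\<phi> w' = w"
        using \<phi>_part_surj p by metis
      note c = F.part_carr[OF f(1)] F.part_carr[OF f(3)] F.part_carr[OF f(5)] F.part_carr[OF f(7)]
      have pc: "u \<in> carr L" "v \<in> carr L" "y \<in> carr L" "w \<in> carr L" using p L.part_carr by auto
      have "brk L u v \<in> L.span {brk L y w}"
        using L.derived_even_line(2)[OF fin rs L.brk_derived[OF pc(3,4)] nz] L.brk_derived[OF pc(1,2)] by simp
      then obtain k where k: "brk L u v = scl L k (brk L y w)" unfolding L.span_singleton by blast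
      \<comment> \<open>L' is a line, so [u',v'] equals k [y',w'] up to an element \<open>t\<close>
        of R. Since [u',y'] and [u',w'] lie in R, the Jacobi identity puts [u',[y',w']] into [F,R],
        hence also [u',[u',v']], against \<open>key\<close>.\<close>
      define t where "t = brk F u' v' - scl F k (brk F y' w')"
      have t: "t \<in> R"
        unfolding ker_in_def t_def using c f k
        by (simp add: F.carr_diff F.carr_scl F.brk_carr \<phi>_diff \<phi>_scl \<phi>_brk)
      have "brk F u' y' \<in> R" "brk F u' w' \<in> R"
        unfolding ker_in_def using c f z by (simp_all add: F.brk_carr \<phi>_brk)
      then have "brk F (brk F u' y') w' \<in> FR" "brk F y' (brk F u' w') \<in> FR"
        using brk_R_left brk_R_right c by auto
      then have "brk F u' (brk F y' w') \<in> FR"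
        using F.brk_jacobi[OF f(1,5,7)] F.subspace_add[OF F.subspace_brk_span]
          F.subspace_scale[OF F.subspace_brk_span] by metis
      moreover have "brk F u' t \<in> FR" using brk_R_right c t by blast
      moreover have "brk F u' (brk F u' v') = brk F u' t + scl F k (brk F u' (brk F y' w'))"
        unfolding t_def using c by (simp add: F.brk_diff_right F.carr_scl F.brk_carr F.brk_scl_right)
      ultimately have "brk F u' (brk F u' v') \<in> FR"
        using F.subspace_add[OF F.subspace_brk_span] F.subspace_scale[OF F.subspace_brk_span] by metis
      then show False using key[OF f(1,3)] f uv by simp
    qed
  qed
qed

end

section \<open>Scalar cocycles and the lower bound\<close>

text \<open>A homogeneous 2-cocycle with values in the trivial one-dimensional module placed in
  parity \<open>q\<close>; \<open>f_parity\<close> says that as a map into this module it has degree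
  0.\<close>

locale scalar_cocycle = lie_superalgebra L
  for L :: "('k::field, 'a::ab_group_add) superalgebra" +
  fixes f :: "'a \<Rightarrow> 'a \<Rightarrow> 'k" and q :: bit
  assumes f_add_left: "\<lbrakk>x \<in> carr L; y \<in> carr L; z \<in> carr L\<rbrakk> \<Longrightarrow> f (x + y) z = f x z + f y z"
    and f_add_right: "\<lbrakk>x \<in> carr L; y \<in> carr L; z \<in> carr L\<rbrakk> \<Longrightarrow> f x (y + z) = f x y + f x z"
    and f_scl_left: "\<lbrakk>x \<in> carr L; y \<in> carr L\<rbrakk> \<Longrightarrow> f (scl L c x) y = c * f x y"
    and f_scl_right: "\<lbrakk>x \<in> carr L; y \<in> carr L\<rbrakk> \<Longrightarrow> f x (scl L c y) = c * f x y"
    and f_parity: "\<lbrakk>x \<in> part L i; y \<in> part L j; i + j \<noteq> q\<rbrakk> \<Longrightarrow> f x y = 0"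
    and f_skew: "\<lbrakk>x \<in> part L i; y \<in> part L j\<rbrakk> \<Longrightarrow> f x y = - (koszul i j * f y x)"
    and f_cocycle: "\<lbrakk>x \<in> part L i; y \<in> part L j; z \<in> part L k\<rbrakk> \<Longrightarrow>
      f x (brk L y z) = f (brk L x y) z + koszul i j * f y (brk L x z)"
begin

text \<open>The central extension of \<open>L\<close> by a line of parity \<open>q\<close>; its
  Jacobi identity is \<open>f_cocycle\<close> in the second coordinate.\<close>

definition extension :: "('k, 'a \<times> 'k) superalgebra" where
  "extension = \<lparr>scl = (\<lambda>c (x, a). (scl L c x, c * a)), brk = (\<lambda>(x, a) (y, b). (brk L x y, f x y)),
    part = (\<lambda>i. part L i \<times> (if i = q then UNIV else {0}))\<rparr>"

lemma extension_simps [simp]: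
  "scl extension c (x, a) = (scl L c x, c * a)" "brk extension (x, a) (y, b) = (brk L x y, f x y)"
  "part extension i = part L i \<times> (if i = q then UNIV else {0})"
  by (simp_all add: extension_def)

lemma carr_extension: "carr extension \<subseteq> carr L \<times> UNIV"
  by (auto simp: carr_def)

lemma lie_superalgebra_extension: "lie_superalgebra extension"
proof -
  have E: "vector_space (scl extension)"
    by unfold_locales (auto simp: algebra_simps scale_right_distrib scale_left_distrib)
  interpret E: vector_space "scl extension" by (rule E)
  have c: "fst x \<in> carr L" if "x \<in> carr extension" for x using that carr_extension by force
  have e: "brk extension u v = (brk L (fst u) (fst v), f (fst u) (fst v))"
    "scl extension c u = (scl L c (fst u), c * snd u)" for u v c
    by (cases u; cases v; simp)+
  show ?thesis
  proof (intro lie_superalgebra.intro E lie_superalgebra_axioms.intro)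
    show "E.subspace (part extension i)" for i
      by (rule E.subspaceI)
        (auto simp: subspace_0[OF subspace_part] subspace_add[OF subspace_part]
          subspace_scale[OF subspace_part] zero_prod_def)
    show "part extension 0 \<inter> part extension 1 = {0}"
      by (auto simp: zero_prod_def subspace_0[OF subspace_part] dest: part_disjoint split: if_splits)
  next
    fix x y z assume "x \<in> carr extension" "y \<in> carr extension" "z \<in> carr extension"
    then show "brk extension (x + y) z = brk extension x z + brk extension y z"
      "brk extension x (y + z) = brk extension x y + brk extension x z"
      by (simp_all add: e c brk_add_left brk_add_right f_add_left f_add_right)
  next
    fix x y a assume "x \<in> carr extension" "y \<in> carr extension"
    then show "brk extension (scl extension a x) y = scl extension a (brk extension x y)"
      "brk extension x (scl extension a y) = scl extension a (brk extension x y)"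
      by (simp_all add: e c brk_scl_left brk_scl_right f_scl_left f_scl_right)
  next
    fix x y i j assume "x \<in> part extension i" "y \<in> part extension j"
    then have p: "fst x \<in> part L i" "fst y \<in> part L j" by auto
    show "brk extension x y \<in> part extension (i + j)"
      using brk_part[OF p] f_parity[OF p] unfolding e extension_simps(3) by auto
    show "brk extension x y = - scl extension (koszul i j) (brk extension y x)"
      using brk_skew[OF p] f_skew[OF p] unfolding e by simp
  next
    fix x y z i j k assume "x \<in> part extension i" "y \<in> part extension j" "z \<in> part extension k"
    then have p: "fst x \<in> part L i" "fst y \<in> part L j" "fst z \<in> part L k" by auto
    show "brk extension x (brk extension y z) =
        brk extension (brk extension x y) z + scl extension (koszul i j) (brk extension y (brk extension x z))"
      using brk_jacobi[OF p] f_cocycle[OF p] unfolding e by simp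
  qed
qed

text \<open>Freeness of \<open>F\<close> enters here: \<open>\<phi>\<close> on the generators, with
  second coordinate 0, extends to a homomorphism \<open>\<psi>\<close> from \<open>F\<close> to the
  central extension, and the second coordinate of \<open>\<psi>\<close> is the functional.\<close>

lemma cocycle_functional:
  assumes pres: "free_presentation F X p \<iota> \<phi> L"
  obtains l where "\<And>x y. x \<in> carr F \<Longrightarrow> y \<in> carr F \<Longrightarrow> l (x + y) = l x + l y"
    "\<And>c x. x \<in> carr F \<Longrightarrow> l (scl F c x) = c * l x"
    "\<And>x y. x \<in> carr F \<Longrightarrow> y \<in> carr F \<Longrightarrow> l (brk F x y) = f (\<phi> x) (\<phi> y)"
proof -
  have free: "free_lsa_on F X p \<iota>" and \<phi>: "lsa_hom F L \<phi>"
    using pres unfolding free_presentation_def by auto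
  interpret F: lie_superalgebra F using free unfolding free_lsa_on_def by blast
  have \<iota>: "\<iota> x \<in> part F (p x)" if "x \<in> X" for x using free that unfolding free_lsa_on_def by blast
  have g: "(\<phi> (\<iota> x), 0) \<in> part extension (p x)" if "x \<in> X" for x
    using \<iota>[OF that] \<phi> unfolding lsa_hom_def by auto
  obtain \<psi> where \<psi>: "lsa_hom F extension \<psi>" "\<forall>x\<in>X. \<psi> (\<iota> x) = (\<phi> (\<iota> x), 0)"
    using free_lsa_on_universal[OF free lie_superalgebra_extension, of "\<lambda>x. (\<phi> (\<iota> x), 0)"] g by blast
  have hadd: "\<psi> (x + y) = \<psi> x + \<psi> y" if "x \<in> carr F" "y \<in> carr F" for x y
    using \<psi>(1) that unfolding lsa_hom_def by blast
  have hscl: "\<psi> (scl F c x) = scl extension c (\<psi> x)" if "x \<in> carr F" for c x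
    using \<psi>(1) that unfolding lsa_hom_def by blast
  have hbrk: "\<psi> (brk F x y) = brk extension (\<psi> x) (\<psi> y)" if "x \<in> carr F" "y \<in> carr F" for x y
    using \<psi>(1) that unfolding lsa_hom_def by blast
  have hpart: "\<psi> x \<in> part extension i" if "x \<in> part F i" for x i
    using \<psi>(1) that unfolding lsa_hom_def by blast
  have e: "brk extension u v = (brk L (fst u) (fst v), f (fst u) (fst v))"
    "scl extension c u = (scl L c (fst u), c * snd u)" for u v c
    by (cases u; cases v; simp)+
  have fst: "lsa_hom F L (\<lambda>x. fst (\<psi> x))"
    unfolding lsa_hom_def using hpart by (auto simp: hadd hscl hbrk e mem_Times_iff)
  \<comment> \<open>Only the uniqueness half of the universal property is needed: the first
    coordinate of \<open>\<psi>\<close> and \<open>\<phi>\<close> agree on generators, hence on all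
    of \<open>F\<close>.\<close>
  obtain \<theta> where \<theta>: "\<forall>\<psi>. lsa_hom F L \<psi> \<and> (\<forall>x\<in>X. \<psi> (\<iota> x) = \<phi> (\<iota> x)) \<longrightarrow> (\<forall>y\<in>carr F. \<psi> y = \<theta> y)"
    using free_lsa_on_universal[OF free lie_superalgebra_axioms, of "\<lambda>x. \<phi> (\<iota> x)"] \<iota> \<phi>
    unfolding lsa_hom_def by blast
  have eq: "fst (\<psi> x) = \<phi> x" if "x \<in> carr F" for x
    using \<theta>[rule_format, of "\<lambda>x. fst (\<psi> x)" x] \<theta>[rule_format, of \<phi> x] fst \<phi> \<psi>(2) that by simp
  show thesis
    by (rule that[of "\<lambda>x. snd (\<psi> x)"]) (simp_all add: hadd hscl hbrk e eq)
qed

end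

context lsa_epimorphism
begin

text \<open>A dual family: \<open>l i\<close> vanishes on \<open>C\<close> and on every
  \<open>r j\<close> except \<open>r i\<close>, so it separates \<open>r i\<close> from the span of
  the rest.\<close>

lemma indep_mod_by_functionals:
  assumes r: "\<And>i. i \<in> I \<Longrightarrow> r i \<in> carr F"
    and l_add: "\<And>i x y. i \<in> I \<Longrightarrow> x \<in> carr F \<Longrightarrow> y \<in> carr F \<Longrightarrow> l i (x + y) = l i x + l i y"
    and l_scl: "\<And>i c x. i \<in> I \<Longrightarrow> x \<in> carr F \<Longrightarrow> l i (scl F c x) = c * l i x"
    and l_C: "\<And>i x. i \<in> I \<Longrightarrow> x \<in> C \<Longrightarrow> l i x = 0" and C: "C \<subseteq> carr F"
    and l_r: "\<And>i. i \<in> I \<Longrightarrow> l i (r i) \<noteq> (0::'k)"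
      "\<And>i j. i \<in> I \<Longrightarrow> j \<in> I \<Longrightarrow> i \<noteq> j \<Longrightarrow> l i (r j) = 0"
  shows "inj_on r I" "indep_mod (scl F) C (r ` I)"
proof -
  show inj: "inj_on r I" by (rule inj_onI) (metis l_r)
  show "indep_mod (scl F) C (r ` I)"
    unfolding indep_mod_def
  proof (rule ballI)
    fix s assume "s \<in> r ` I"
    then obtain i where i: "i \<in> I" "s = r i" by blast
    have l0: "l i 0 = 0" using l_scl[OF i(1) F.carr_0, of 0] by simp
    have "F.span (C \<union> (r ` I - {s})) \<subseteq> {x \<in> carr F. l i x = 0}"
    proof (rule F.span_minimal)
      have "l i (r j) = 0" if "j \<in> I" "r j \<noteq> s" for j using l_r(2)[OF i(1) that(1)] that(2) i(2) by auto
      then show "C \<union> (r ` I - {s}) \<subseteq> {x \<in> carr F. l i x = 0}" using C l_C[OF i(1)] r by auto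
      show "F.subspace {x \<in> carr F. l i x = 0}"
        by (rule F.subspaceI) (use i(1) l0 in \<open>auto simp: l_add l_scl F.carr_0 F.carr_add F.carr_scl\<close>)
    qed
    then show "s \<notin> F.span (C \<union> (r ` I - {s}))" using l_r(1) i by blast
  qed
qed

text \<open>If a and b commute in \<open>L\<close>, the bracket of their lifts lies in F' and in R,
  and the functional of a cocycle \<open>f\<close> takes the value \<open>f a b\<close> on it. These
  functionals vanish on [F,R] since \<open>f\<close> vanishes when its second argument is 0, so a
  dual family of cocycles and commuting pairs yields independent classes of the multiplier.\<close>

lemma multiplier_dim_ge_cocycles:
  assumes pres: "free_presentation F X p \<iota> \<phi> L" and fin: "multiplier_fin_dim F \<phi>"
    and cocycle: "\<And>i. i \<in> I \<Longrightarrow> scalar_cocycle L (f i) (q i)"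
    and ab: "\<And>i. i \<in> I \<Longrightarrow> a i \<in> carr L" "\<And>i. i \<in> I \<Longrightarrow> b i \<in> carr L"
      "\<And>i. i \<in> I \<Longrightarrow> brk L (a i) (b i) = 0"
    and nz: "\<And>i. i \<in> I \<Longrightarrow> f i (a i) (b i) \<noteq> 0"
    and zr: "\<And>i j. i \<in> I \<Longrightarrow> j \<in> I \<Longrightarrow> i \<noteq> j \<Longrightarrow> f i (a j) (b j) = 0"
  shows "card I \<le> multiplier_dim F \<phi>"
proof -
  have "\<exists>x. i \<in> I \<longrightarrow> x \<in> carr F \<and> \<phi> x = a i" "\<exists>x. i \<in> I \<longrightarrow> x \<in> carr F \<and> \<phi> x = b i" for i
    using ab surj by (metis imageE)+
  then obtain a' b' where a': "\<And>i. i \<in> I \<Longrightarrow> a' i \<in> carr F \<and> \<phi> (a' i) = a i"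
      and b': "\<And>i. i \<in> I \<Longrightarrow> b' i \<in> carr F \<and> \<phi> (b' i) = b i"
    by metis
  define r where "r i = brk F (a' i) (b' i)" for i
  have "\<exists>l. i \<in> I \<longrightarrow> (\<forall>x\<in>carr F. \<forall>y\<in>carr F. l (x + y) = l x + l y) \<and>
    (\<forall>c. \<forall>x\<in>carr F. l (scl F c x) = c * l x) \<and>
    (\<forall>x\<in>carr F. \<forall>y\<in>carr F. l (brk F x y) = f i (\<phi> x) (\<phi> y))" for i
  proof (cases "i \<in> I")
    case True
    interpret scalar_cocycle L "f i" "q i" by (rule cocycle[OF True])
    show ?thesis using cocycle_functional[OF pres] by metis
  qed auto
  then obtain l where l: "\<And>i. i \<in> I \<longrightarrow> (\<forall>x\<in>carr F. \<forall>y\<in>carr F. l i (x + y) = l i x + l i y) \<and>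
    (\<forall>c. \<forall>x\<in>carr F. l i (scl F c x) = c * l i x) \<and>
    (\<forall>x\<in>carr F. \<forall>y\<in>carr F. l i (brk F x y) = f i (\<phi> x) (\<phi> y))"
    by metis
  then have l_add: "l i (x + y) = l i x + l i y" and l_scl: "l i (scl F c x) = c * l i x"
      and l_brk: "l i (brk F x y) = f i (\<phi> x) (\<phi> y)"
    if "i \<in> I" "x \<in> carr F" "y \<in> carr F" for i x y c
    using that by blast+
  have rc: "r i \<in> derived F \<inter> R" "r i \<in> carr F" if "i \<in> I" for i
    unfolding r_def using a'[OF that] b'[OF that] ab that
    by (auto simp: ker_in_def F.brk_carr \<phi>_brk F.brk_derived)
  have FRc: "FR \<subseteq> carr F" using FR_R R_carr by blast
  have l_FR: "l i x = 0" if i: "i \<in> I" and x: "x \<in> FR" for i x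
  proof -
    interpret c: scalar_cocycle L "f i" "q i" by (rule cocycle[OF i])
    have l0: "l i 0 = 0" using l_scl[OF i F.carr_0 F.carr_0, of 0] by simp
    have "f i u 0 = 0" if "u \<in> carr L" for u using c.f_scl_right[OF that L.carr_0, of 0] by simp
    then have "FR \<subseteq> {x \<in> carr F. l i x = 0}"
      using i l0
      by (intro F.brk_span_least F.subspaceI)
        (auto simp: l_add l_scl l_brk F.carr_0 F.carr_add F.carr_scl F.brk_carr ker_in_def \<phi>_carr)
    then show ?thesis using x by blast
  qed
  have l_r: "l i (r j) = f i (a j) (b j)" if "i \<in> I" "j \<in> I" for i j
    unfolding r_def using a'[OF that(2)] b'[OF that(2)] l_brk[OF that(1)] by auto
  have ind: "inj_on r I" "indep_mod (scl F) FR (r ` I)"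
    using indep_mod_by_functionals[of I r l FR] rc l_add l_scl l_FR FRc l_r nz zr by auto
  have "card (r ` I) \<le> quot_dim (scl F) (derived F \<inter> R) FR"
    by (rule F.quot_dim_ge[OF _ _ ind(2)]) (use fin rc in \<open>auto simp: multiplier_fin_dim_def\<close>)
  then show ?thesis using ind(1) unfolding multiplier_dim_def by (simp add: card_image)
qed

end

section \<open>Exterior products of coordinate forms as cocycles\<close>

lemma koszul_commute: "koszul i j = koszul j i"
  unfolding koszul_def by auto

locale heisenberg_split_basis = heisenberg_split L y w A
  for L :: "('k::field, 'a::ab_group_add) superalgebra" and y w A +
  fixes B :: "'a set"
  assumes finite_B: "finite B" and indep_B: "independent B" and span_B: "span B = carr L"
    and B_part: "B \<subseteq> part L 0 \<union> part L 1" and ywz_B: "{y, w, z} \<subseteq> B"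
    and part_0: "part L 0 = span (B \<inter> part L 0)" and part_1: "part L 1 = span (B \<inter> part L 1)"
    and A_span: "A = span (B \<inter> part L 0 - {y, w, z})"
    and distinct_ywz: "y \<noteq> w" "y \<noteq> z" "w \<noteq> z"
    and two: "(2::'k) \<noteq> 0"
begin

abbreviation coord :: "'a \<Rightarrow> 'a \<Rightarrow> 'k" where
  "coord b x \<equiv> representation B x b"

definition parity :: "'a \<Rightarrow> bit" where
  "parity b = (if b \<in> part L 0 then 0 else 1)"

lemma parity_part: "b \<in> B \<Longrightarrow> b \<in> part L (parity b)"
  using B_part unfolding parity_def by auto

lemma ywz_carr: "y \<in> carr L" "w \<in> carr L" "z \<in> carr L"
  using y w z part_carr by auto

lemma coord_add: "x \<in> carr L \<Longrightarrow> x' \<in> carr L \<Longrightarrow> coord b (x + x') = coord b x + coord b x'"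
  using representation_add[OF indep_B] span_B by simp

lemma coord_scl: "x \<in> carr L \<Longrightarrow> coord b (scl L c x) = c * coord b x"
  using representation_scale[OF indep_B] span_B by simp

lemma coord_basis: "b \<in> B \<Longrightarrow> coord b' b = (if b' = b then 1 else 0)"
  using representation_basis[OF indep_B] by auto

lemma coord_outside:
  assumes "C \<subseteq> B" "x \<in> span C" "b \<notin> C"
  shows "coord b x = 0"
proof -
  have "coord b x = representation C x b" using representation_extend[OF indep_B assms(2,1)] by simp
  then show ?thesis using representation_ne_zero[of C x b] assms(3) by metis
qed

lemma coord_parity:
  assumes x: "x \<in> part L i" and b: "b \<in> B" and c: "coord b x \<noteq> 0"
  shows "i = parity b"
proof -
  have "x \<in> span (B \<inter> part L i)" using x part_0 part_1 bit_cases[of i] by auto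
  then have "b \<in> part L i" using coord_outside[of "B \<inter> part L i" x b] c by blast
  moreover have "b \<noteq> 0" using b indep_B dependent_zero by blast
  ultimately show ?thesis
    using part_disjoint parity_part[OF b] bit_cases[of i] bit_cases[of "parity b"] by auto
qed

lemma coord_mult_parity:
  assumes "x \<in> part L i" "x' \<in> part L j" "a \<in> B" "b \<in> B" "coord a x * coord b x' \<noteq> 0"
  shows "i = parity a" "j = parity b"
  using assms coord_parity by auto

lemma coord_A: "a \<in> A \<Longrightarrow> b \<in> {y, w, z} \<Longrightarrow> coord b a = 0"
  using coord_outside[of "B \<inter> part L 0 - {y, w, z}" a b] A_span by blast

lemma parity_ywz: "parity y = 0" "parity w = 0" "parity z = 0"
  using y w z unfolding parity_def by auto

lemma coord_odd: "x \<in> part L 1 \<Longrightarrow> b \<in> {y, w, z} \<Longrightarrow> coord b x = 0"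
  using coord_parity[of x 1 b] parity_ywz ywz_B by (cases "coord b x = 0") auto

lemma central_right:
  assumes a: "a \<in> A \<or> a \<in> part L 1 \<or> a = z" and x: "x \<in> carr L"
  shows "brk L x a = 0"
proof -
  obtain i where i: "a \<in> part L i" using a A(2) z by blast
  obtain p q where x: "x = p + q" "p \<in> part L 0" "q \<in> part L 1" using x unfolding carr_def by blast
  have "brk L p a = 0" "brk L q a = 0"
    using brk_skew[OF x(2) i] brk_skew[OF x(3) i] central[OF a] part_carr x by auto
  then show ?thesis using x i part_carr by (simp add: brk_add_left)
qed

text \<open>The coefficients provided by \<open>split\<close> are coordinates in \<open>B\<close>,
  because \<open>A\<close> and the odd part have no component along \<open>y\<close>,
  \<open>w\<close> and \<open>z\<close>.\<close>

lemma decompose: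
  assumes "x \<in> carr L"
  obtains a t where "a \<in> A" "t \<in> part L 1"
    "x = scl L (coord y x) y + scl L (coord w x) w + scl L (coord z x) z + (a + t)"
proof -
  obtain p t where x: "x = p + t" "p \<in> part L 0" "t \<in> part L 1" using assms unfolding carr_def by blast
  obtain b c d a where p: "a \<in> A" "p = scl L b y + scl L c w + scl L d z + a" using split[OF x(2)] by blast
  have ac: "a \<in> carr L" "t \<in> carr L" using p A(2) x part_carr by auto
  have "coord e x = coord e (scl L b y + scl L c w + scl L d z)" if "e \<in> {y, w, z}" for e
    unfolding x(1) p(2)
    using ac ywz_carr coord_A[OF p(1) that] coord_odd[OF x(3) that] by (simp add: coord_add carr_add carr_scl)
  then have "coord y x = b" "coord w x = c" "coord z x = d"
    using ywz_carr ywz_B distinct_ywz by (simp_all add: coord_add coord_scl carr_add carr_scl coord_basis)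
  then have "x = scl L (coord y x) y + scl L (coord w x) w + scl L (coord z x) z + (a + t)"
    using x p by (simp add: add.assoc)
  then show thesis using that p(1) x(3) by blast
qed

text \<open>The structure form y* \<and> w* of the bracket; that it is a single product of two
  coordinates expresses rank two.\<close>

definition form :: "'a \<Rightarrow> 'a \<Rightarrow> 'k" where
  "form x x' = coord y x * coord w x' - coord w x * coord y x'"

lemma brk_form:
  assumes x: "x \<in> carr L" "x' \<in> carr L"
  shows "brk L x x' = scl L (form x x') z"
proof -
  obtain a t where at: "a \<in> A" "t \<in> part L 1"
    and e: "x = scl L (coord y x) y + scl L (coord w x) w + scl L (coord z x) z + (a + t)"
    using decompose[OF x(1)] .
  obtain a' t' where at': "a' \<in> A" "t' \<in> part L 1"
    and e': "x' = scl L (coord y x') y + scl L (coord w x') w + scl L (coord z x') z + (a' + t')"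
    using decompose[OF x(2)] .
  have c: "a \<in> carr L" "t \<in> carr L" "a' \<in> carr L" "t' \<in> carr L" using at at' A(2) part_carr by auto
  have "y \<in> part L 0" "brk L w y = - z" using y brk_skew[OF w y] by (simp_all add: koszul_def)
  moreover have "brk L y y = 0" "brk L w w = 0"
    using brk_even_self[OF two] y w by auto
  moreover have "brk L u a' = 0" "brk L u t' = 0" "brk L u z = 0" if "u \<in> carr L" for u
    using central_right that at' by blast+
  moreover have "brk L a u = 0" "brk L t u = 0" "brk L z u = 0" if "u \<in> carr L" for u
    using central that at by blast+
  ultimately have "brk L (scl L (coord y x) y + scl L (coord w x) w + scl L (coord z x) z + (a + t))
      (scl L (coord y x') y + scl L (coord w x') w + scl L (coord z x') z + (a' + t')) =
    scl L (form x x') z"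
    using c ywz_carr unfolding form_def
    by (simp add: brk_add_left brk_add_right brk_scl_left brk_scl_right carr_add carr_scl scale_left_diff_distrib
        mult.commute)
  then show ?thesis using e e' by metis
qed

text \<open>The graded exterior product of two coordinate forms. On an even diagonal pair it
  vanishes; on an odd one it is twice a square, which is why \<open>two\<close> is needed.\<close>

definition wedge :: "'a \<times> 'a \<Rightarrow> 'a \<Rightarrow> 'a \<Rightarrow> 'k" where
  "wedge = (\<lambda>(a, b) x x'. coord a x * coord b x' -
    koszul (parity a) (parity b) * (coord b x * coord a x'))"

lemma wedge_basis:
  assumes "a \<in> B" "b \<in> B"
  shows "wedge (c, d) a b = (if c = a \<and> d = b then 1 else 0) -
    koszul (parity c) (parity d) * (if d = a \<and> c = b then 1 else 0)"
proof -
  have "(if p then 1 else 0) * (if q then 1 else 0) = (if p \<and> q then 1 else (0::'k))" for p q by simp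
  then show ?thesis
    unfolding wedge_def prod.case coord_basis[OF assms(1)] coord_basis[OF assms(2)] by (simp only:)
qed

lemma form_parity: "\<lbrakk>x \<in> part L i; x' \<in> part L j; i = 1 \<or> j = 1\<rbrakk> \<Longrightarrow> form x x' = 0"
  unfolding form_def using coord_odd[of x] coord_odd[of x'] by auto

lemma coord_brk:
  assumes "x \<in> carr L" "x' \<in> carr L"
  shows "coord b (brk L x x') = (if b = z then form x x' else 0)"
  using ywz_carr ywz_B by (simp add: brk_form[OF assms] coord_scl coord_basis)

text \<open>L' is the line of \<open>z\<close>, so a product of coordinates other than that of
  \<open>z\<close> vanishes on brackets and is trivially closed. For a* \<and> z* the obstruction is
  a* \<and> y* \<and> w*, which is 0 when \<open>a\<close> is \<open>y\<close> or
  \<open>w\<close>.\<close>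

lemma scalar_cocycle_wedge:
  assumes ab: "a \<in> B" "b \<in> B" and z: "a \<noteq> z \<and> b \<noteq> z \<or> a \<in> {y, w} \<and> b = z"
  shows "scalar_cocycle L (wedge (a, b)) (parity a + parity b)"
proof unfold_locales
  fix x x' x'' assume "x \<in> carr L" "x' \<in> carr L" "x'' \<in> carr L"
  then show "wedge (a, b) (x + x') x'' = wedge (a, b) x x'' + wedge (a, b) x' x''"
    "wedge (a, b) x (x' + x'') = wedge (a, b) x x' + wedge (a, b) x x''"
    by (simp_all add: wedge_def coord_add algebra_simps)
next
  fix x x' c assume "x \<in> carr L" "x' \<in> carr L"
  then show "wedge (a, b) (scl L c x) x' = c * wedge (a, b) x x'"
    "wedge (a, b) x (scl L c x') = c * wedge (a, b) x x'"
    by (simp_all add: wedge_def coord_scl algebra_simps)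
next
  fix x x' i j assume x: "x \<in> part L i" "x' \<in> part L j" and n: "i + j \<noteq> parity a + parity b"
  have "coord a x * coord b x' = 0"
    using coord_mult_parity[OF x ab] n by blast
  moreover have "coord b x * coord a x' = 0"
    using coord_mult_parity[OF x ab(2,1)] n add.commute by metis
  ultimately show "wedge (a, b) x x' = 0" by (simp add: wedge_def del: mult_eq_0_iff)
next
  fix x x' i j assume x: "x \<in> part L i" "x' \<in> part L j"
  let ?k = "koszul (parity a) (parity b) :: 'k"
  show "wedge (a, b) x x' = - (koszul i j * wedge (a, b) x' x)"
  proof (cases "koszul i j = ?k")
    case True
    have sq: "?k * ?k = 1" unfolding koszul_def by (auto split: if_split)
    have "?k * (s - ?k * t) = ?k * s - t" for s t
      unfolding right_diff_distrib mult.assoc[symmetric] sq by simp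
    moreover have "wedge (a, b) x' x = coord b x * coord a x' - ?k * (coord a x * coord b x')"
      by (simp only: wedge_def prod.case mult.commute)
    moreover have "wedge (a, b) x x' = coord a x * coord b x' - ?k * (coord b x * coord a x')"
      by (simp add: wedge_def)
    ultimately show ?thesis unfolding True by simp
  next
    \<comment> \<open>If the signs differ, the parities of \<open>x\<close>, \<open>x'\<close> match
      those of \<open>a\<close>, \<open>b\<close> in neither order, so all products of coordinates
      vanish.\<close>
    case False
    have "coord a x * coord b x' = 0"
      using coord_mult_parity[OF x ab] False by metis
    moreover have "coord b x * coord a x' = 0"
      using coord_mult_parity[OF x ab(2,1)] False koszul_commute by metis
    moreover have "coord a x' * coord b x = 0" "coord b x' * coord a x = 0"
      using calculation by (simp_all only: mult.commute)
    ultimately show ?thesis by (simp add: wedge_def del: mult_eq_0_iff)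
  qed
next
  fix x x' x'' i j k assume x: "x \<in> part L i" "x' \<in> part L j" "x'' \<in> part L k"
  note c = part_carr[OF x(1)] part_carr[OF x(2)] part_carr[OF x(3)]
  show "wedge (a, b) x (brk L x' x'') = wedge (a, b) (brk L x x') x'' + koszul i j * wedge (a, b) x' (brk L x x'')"
  proof (cases "b = z")
    case False
    then have "a \<noteq> z" using z by blast
    then show ?thesis using False c by (simp add: wedge_def coord_brk)
  next
    case True
    then have a: "a \<in> {y, w}" using z by blast
    then have az: "a \<noteq> z" using distinct_ywz by auto
    have "koszul (parity a) (parity b) = (1::'k)" using True parity_ywz by (simp add: koszul_def)
    then have w: "wedge (a, b) u v = coord a u * coord z v - coord z u * coord a v" for u v
      by (simp add: wedge_def True)
    show ?thesis
    proof (cases "i = 1 \<or> j = 1")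
      \<comment> \<open>Both \<open>form\<close> and the coordinate of \<open>a\<close> vanish on
        odd arguments, so every term is 0.\<close>
      case True
      then have "form x x' = 0" "form x' x'' = 0 \<or> coord a x = 0" "form x x'' = 0 \<or> coord a x' = 0"
        using form_parity[OF x(1,2)] form_parity[OF x(1,3)] form_parity[OF x(2,3)] coord_odd[of x] coord_odd[of x']
          x a by blast+
      then show ?thesis using c az by (auto simp: w coord_brk)
    next
      case False
      \<comment> \<open>With trivial signs the identity is the vanishing of a* \<and> y* \<and> w*,
        evaluated on x, x', x''.\<close>
      then have "koszul i j = (1::'k)" by (simp add: koszul_def)
      then show ?thesis using c az a by (auto simp: w coord_brk form_def algebra_simps)
    qed
  qed
qed

end

context lsa_epimorphism
begin

text \<open>With \<open>E\<close> the basis without \<open>z\<close> and g = |E| = m + n - 1, the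
  set \<open>P\<close> has g(g-1)/2 + n pairs. The pair of \<open>y\<close> and \<open>w\<close>
  must go, since its bracket does not vanish, and (y,z), (w,z) are added; the total is one more than
  |P|, which is the bound for d = 1.\<close>

lemma heisenberg_split_lower_bound:
  assumes split: "heisenberg_split L y w A" and two: "(2::'k) \<noteq> 0" and fin: "fin_dim L"
    and mn: "sdim L (carr L) = (m, n)"
    and pres: "free_presentation F X p \<iota> \<phi> L" and mfin: "multiplier_fin_dim F \<phi>"
  shows "1 / 2 * ((real m + real n - 1) * (real m + real n - 2)) + real n + 1 \<le> real (multiplier_dim F \<phi>)"
    and "3 \<le> m"
proof -
  interpret H: heisenberg_split L y w A by (rule split)
  obtain B where B: "finite B" "L.independent B" "L.span B = carr L" "B \<subseteq> part L 0 \<union> part L 1"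
    "{y, w, H.z} \<subseteq> B" "part L 0 = L.span (B \<inter> part L 0)" "part L 1 = L.span (B \<inter> part L 1)"
    "A = L.span (B \<inter> part L 0 - {y, w, H.z})"
    and cB: "card (B \<inter> part L 0) = L.dim (carr L \<inter> part L 0)" "card (B \<inter> part L 1) = L.dim (carr L \<inter> part L 1)"
    and dist: "y \<noteq> w" "y \<noteq> H.z" "w \<noteq> H.z"
    using H.basis_exists[OF fin] by metis
  interpret H: heisenberg_split_basis L y w A B
    by unfold_locales (use B dist two in auto)
  have c: "card (B \<inter> part L 0) = m" "card (B \<inter> part L 1) = n" using cB mn unfolding sdim_def by auto
  have "{y, w, H.z} \<subseteq> B \<inter> part L 0" using H.y H.w H.z B(5) by blast
  then have "card {y, w, H.z} \<le> m" using card_mono[of "B \<inter> part L 0"] B(1) c by auto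
  then show "3 \<le> m" using dist by simp
  have nz: "0 \<notin> B" using B(2) L.dependent_zero by blast
  have "card B = m + n"
  proof -
    have "B = (B \<inter> part L 0) \<union> (B \<inter> part L 1)" using B(4) by blast
    moreover have "(B \<inter> part L 0) \<inter> (B \<inter> part L 1) = {}" using nz L.part_disjoint by blast
    ultimately show ?thesis using card_Un_disjoint[of "B \<inter> part L 0" "B \<inter> part L 1"] B(1) c by simp
  qed
  define E where "E = B - {H.z}"
  have zB: "H.z \<in> B" using B(5) by blast
  have E: "finite E" "card E + 1 = m + n" "E \<inter> part L 1 = B \<inter> part L 1" "y \<in> E" "w \<in> E" "E \<subseteq> B"
  proof -
    have "H.z \<notin> part L 1" using L.part_disjoint[OF H.z] zB nz by metis
    then show "E \<inter> part L 1 = B \<inter> part L 1" unfolding E_def by blast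
    show "card E + 1 = m + n" unfolding E_def using \<open>card B = m + n\<close> zB B(1)
      by (metis Suc_eq_plus1 card_Suc_Diff1)
  qed (use B dist in \<open>auto simp: E_def\<close>)
  obtain P where P: "P \<subseteq> E \<times> E"
    "\<And>a b. a \<in> E \<Longrightarrow> b \<in> E \<Longrightarrow> (a, b) \<in> P \<or> (b, a) \<in> P \<or> a = b \<and> a \<notin> part L 1"
    "\<And>a b. (a, b) \<in> P \<Longrightarrow> (b, a) \<in> P \<Longrightarrow> a = b" "\<And>a. (a, a) \<in> P \<Longrightarrow> a \<in> part L 1"
    "2 * card P = card E * (card E - 1) + 2 * card (E \<inter> part L 1)"
    using ordered_pairs_exist[OF E(1), of "part L 1"] by metis
  have finP: "finite P" using P(1) E(1) by (meson finite_SigmaI finite_subset)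
  \<comment> \<open>\<open>P\<close> contains exactly one orientation of this pair, so a single
    element is removed.\<close>
  define P' where "P' = P - {(y, w), (w, y)}"
  define I where "I = P' \<union> {(y, H.z), (w, H.z)}"
  have "card P = card P' + 1"
  proof -
    have "\<exists>c\<in>P. P' = P - {c}"
    proof (cases "(y, w) \<in> P")
      case True
      then have "(w, y) \<notin> P" using P(3) dist(1) by blast
      then have "P' = P - {(y, w)}" unfolding P'_def by auto
      then show ?thesis using True by blast
    next
      case False
      then have "P' = P - {(w, y)}" "(w, y) \<in> P" using P(2)[OF E(4,5)] dist(1) unfolding P'_def by auto
      then show ?thesis by blast
    qed
    then show ?thesis using finP by (metis Suc_eq_plus1 card_Suc_Diff1)
  qed
  moreover have "card I = card P' + 2"
  proof -
    have "P' \<inter> {(y, H.z), (w, H.z)} = {}" unfolding P'_def using P(1) by (auto simp: E_def)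
    then show ?thesis unfolding I_def using finP dist by (subst card_Un_disjoint) (auto simp: P'_def)
  qed
  moreover have "card I \<le> multiplier_dim F \<phi>"
  proof (rule multiplier_dim_ge_cocycles[OF pres mfin, of I H.wedge "\<lambda>(a, b). H.parity a + H.parity b" fst snd])
    have IB: "a \<in> B \<and> b \<in> B \<and> (a \<noteq> H.z \<and> b \<noteq> H.z \<or> a \<in> {y, w} \<and> b = H.z)" if "(a, b) \<in> I" for a b
    proof -
      have "(a, b) \<in> E \<times> E \<or> b = H.z \<and> a \<in> {y, w}" using that P(1) unfolding I_def P'_def by blast
      then show ?thesis using B(5) unfolding E_def by blast
    qed
    have IB': "fst i \<in> B" "snd i \<in> B" if "i \<in> I" for i using IB[of "fst i" "snd i"] that by auto
    have wb: "H.wedge i (fst j) (snd j) = (if fst i = fst j \<and> snd i = snd j then 1 else 0) -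
        koszul (H.parity (fst i)) (H.parity (snd i)) * (if snd i = fst j \<and> fst i = snd j then 1 else 0)"
      if "j \<in> I" for i j
      using H.wedge_basis[OF IB'[OF that], of "fst i" "snd i"] by (simp only: prod.collapse)
    show "scalar_cocycle L (H.wedge i) ((\<lambda>(a, b). H.parity a + H.parity b) i)" if "i \<in> I" for i
      using IB[of "fst i" "snd i"] H.scalar_cocycle_wedge[of "fst i" "snd i"] that by (cases i) simp
    show "fst i \<in> carr L" "snd i \<in> carr L" if "i \<in> I" for i
      using IB'[OF that] B(3) L.span_base by auto
    show "brk L (fst i) (snd i) = 0" if "i \<in> I" for i
    proof -
      have "\<not> (fst i = y \<and> snd i = w)" "\<not> (fst i = w \<and> snd i = y)"
        using that dist unfolding I_def P'_def by (cases i; simp; blast)+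
      then have f: "H.form (fst i) (snd i) = 0"
        unfolding H.form_def H.coord_basis[OF IB'(1)[OF that]] H.coord_basis[OF IB'(2)[OF that]] by auto
      show ?thesis
        using H.brk_form[of "fst i" "snd i"] f IB'[OF that] B(3) L.span_base by auto
    qed
    show "H.wedge i (fst i) (snd i) \<noteq> 0" if i: "i \<in> I" for i
    proof (cases "fst i = snd i")
      case True
      \<comment> \<open>A diagonal pair in \<open>P\<close> is odd, and there the form takes the
        value 1 - (-1) = 2.\<close>
      then have "fst i \<in> part L 1" using i P(4) dist unfolding I_def P'_def by (cases i) auto
      then have "fst i \<notin> part L 0" using IB'[OF i] nz L.part_disjoint by metis
      then have "koszul (H.parity (fst i)) (H.parity (snd i)) = (-1 :: 'k)"
        using True by (simp add: H.parity_def koszul_def)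
      then show ?thesis
        using wb[OF i, of i] True two by simp
    next
      case False
      then show ?thesis using not_sym[OF False] unfolding wb[OF i] by simp
    qed
    show "H.wedge i (fst j) (snd j) = 0" if ij: "i \<in> I" "j \<in> I" "i \<noteq> j" for i j
    proof -
      \<comment> \<open>The second term of the wedge could only see the reversed pair;
        \<open>P\<close> has no reversed pairs off the diagonal, and \<open>z\<close> does not occur
        in \<open>P\<close> at all.\<close>
      have "\<not> (snd i = fst j \<and> fst i = snd j)"
      proof
        assume s: "snd i = fst j \<and> fst i = snd j"
        obtain a b where ab: "i = (a, b)" "j = (b, a)" using s by (cases i; cases j) auto
        have zP: "(c, H.z) \<notin> P" "(H.z, c) \<notin> P" for c using P(1) unfolding E_def by auto
        have "(a, b) \<in> P \<or> b = H.z \<and> a \<in> {y, w}" "(b, a) \<in> P \<or> a = H.z \<and> b \<in> {y, w}"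
          using ij(1,2) unfolding ab I_def P'_def by blast+
        moreover have "b \<noteq> H.z" "a \<noteq> H.z" using calculation zP dist by auto
        ultimately have "(a, b) \<in> P" "(b, a) \<in> P" by simp_all
        then have "a = b" by (rule P(3))
        then show False using ij(3) ab by simp
      qed
      moreover have "\<not> (fst i = fst j \<and> snd i = snd j)" using ij(3) by (simp add: prod_eq_iff)
      ultimately show ?thesis unfolding wb[OF ij(2)] by (simp only: if_False mult_zero_right diff_self)
    qed
  qed
  ultimately have "card P + 1 \<le> multiplier_dim F \<phi>" by simp
  then have "real (card P) + 1 \<le> real (multiplier_dim F \<phi>)" by linarith
  moreover have "2 * real (card P) = real (card E) * (real (card E) - 1) + 2 * real n"
  proof -
    have "real (2 * card P) = real (card E * (card E - 1) + 2 * card (E \<inter> part L 1))" using P(5) by simp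
    then show ?thesis using E(3) c by (cases "card E") (auto simp: algebra_simps)
  qed
  moreover have "real (card E) = real m + real n - 1" using E(2) by linarith
  ultimately show "1 / 2 * ((real m + real n - 1) * (real m + real n - 2)) + real n + 1 \<le> real (multiplier_dim F \<phi>)"
    by simp
qed

end

section \<open>Direct sums with Heisenberg superalgebras\<close>

lemma carr_direct_sum: "carr (direct_sum L K) = carr L \<times> carr K"
proof
  show "carr (direct_sum L K) \<subseteq> carr L \<times> carr K"
    unfolding carr_def direct_sum_def by auto
  show "carr L \<times> carr K \<subseteq> carr (direct_sum L K)"
  proof
    fix u assume "u \<in> carr L \<times> carr K"
    then obtain a b c d where "u = (a + b, c + d)" "a \<in> part L 0" "b \<in> part L 1" "c \<in> part K 0" "d \<in> part K 1"
      unfolding carr_def by blast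
    then have "u = (a, c) + (b, d)" "(a, c) \<in> part (direct_sum L K) 0" "(b, d) \<in> part (direct_sum L K) 1"
      by (simp_all add: direct_sum_def)
    then show "u \<in> carr (direct_sum L K)" unfolding carr_def by blast
  qed
qed

lemma direct_sum_simps:
  "scl (direct_sum L K) c u = (scl L c (fst u), scl K c (snd u))"
  "brk (direct_sum L K) u v = (brk L (fst u) (fst v), brk K (snd u) (snd v))"
  "part (direct_sum L K) i = part L i \<times> part K i"
  by (simp_all add: direct_sum_def case_prod_beta)

lemma lookup_sum_left: "Poly_Mapping.lookup (\<Sum>i\<in>I. f i) k = (\<Sum>i\<in>I. Poly_Mapping.lookup (f i) k)"
  by (induction I rule: infinite_finite_induct) (auto simp: lookup_add)

text \<open>Summing over a fixed finite set instead of the supports makes the bracket visibly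
  bilinear and computable by expanding the three basis vectors of H(1,0).\<close>

lemma brk_basis_superalgebra:
  fixes f g :: "'i \<Rightarrow>\<^sub>0 'k::field"
  assumes "finite S" "Poly_Mapping.keys f \<subseteq> S" "Poly_Mapping.keys g \<subseteq> S"
  shows "brk (basis_superalgebra I d c) f g =
    (\<Sum>i\<in>S. \<Sum>j\<in>S. pscale (Poly_Mapping.lookup f i * Poly_Mapping.lookup g j) (c i j))"
proof -
  have 0: "pscale 0 u = 0" for u :: "'i \<Rightarrow>\<^sub>0 'k" by (rule poly_mapping_eqI) simp
  have "(\<Sum>j\<in>Poly_Mapping.keys g. pscale (Poly_Mapping.lookup f i * Poly_Mapping.lookup g j) (c i j)) =
      (\<Sum>j\<in>S. pscale (Poly_Mapping.lookup f i * Poly_Mapping.lookup g j) (c i j))" for i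
    using assms(1,3) by (intro sum.mono_neutral_left) (auto simp: in_keys_iff 0)
  moreover have "(\<Sum>i\<in>Poly_Mapping.keys f. \<Sum>j\<in>S. pscale (Poly_Mapping.lookup f i * Poly_Mapping.lookup g j) (c i j)) =
      (\<Sum>i\<in>S. \<Sum>j\<in>S. pscale (Poly_Mapping.lookup f i * Poly_Mapping.lookup g j) (c i j))"
    using assms(1,2) by (intro sum.mono_neutral_left) (auto simp: in_keys_iff 0)
  ultimately show ?thesis by (simp add: basis_superalgebra_def)
qed

text \<open>Keeps \<open>HX 1\<close> from being rewritten to \<open>HX (Suc 0)\<close>.\<close>

declare One_nat_def [simp del]

abbreviation "hx1 \<equiv> HX 1"
abbreviation "hx2 \<equiv> HX 2"

lemma heis_basis_1_0: "heis_basis 1 0 = {hx1, hx2, HZ}"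
proof -
  have "{1..2 * 1} = {1, 2::nat}" by auto
  then show ?thesis by (auto simp: heis_basis_def)
qed

lemma carr_heisenberg: "carr (heisenberg 1 0) = {f. Poly_Mapping.keys f \<subseteq> {hx1, hx2, HZ}}"
  unfolding heisenberg_def carr_basis heis_basis_1_0 ..

lemma scl_heisenberg: "scl (heisenberg m n) = pscale"
  by (simp add: heisenberg_def basis_superalgebra_def)

lemma part_heisenberg:
  "part (heisenberg 1 0) 0 = {f :: heis_index \<Rightarrow>\<^sub>0 'k::field. Poly_Mapping.keys f \<subseteq> {hx1, hx2, HZ}}"
  "part (heisenberg 1 0) 1 = {0 :: heis_index \<Rightarrow>\<^sub>0 'k}"
proof -
  show "part (heisenberg 1 0) 0 = {f :: heis_index \<Rightarrow>\<^sub>0 'k. Poly_Mapping.keys f \<subseteq> {hx1, hx2, HZ}}"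
    unfolding heisenberg_def basis_superalgebra_def heis_basis_1_0 by auto
  have "Poly_Mapping.keys f = {}" if "\<forall>i\<in>Poly_Mapping.keys f. i \<in> {hx1, hx2, HZ} \<and> heis_parity i = 1"
    for f :: "heis_index \<Rightarrow>\<^sub>0 'k" using that by fastforce
  then show "part (heisenberg 1 0) 1 = ({0} :: (heis_index \<Rightarrow>\<^sub>0 'k) set)"
    unfolding heisenberg_def basis_superalgebra_def heis_basis_1_0 by auto
qed

lemma brk_heisenberg:
  assumes "f \<in> carr (heisenberg 1 0)" "g \<in> carr (heisenberg 1 0)"
  shows "brk (heisenberg 1 0) f g = Poly_Mapping.single HZ
    (Poly_Mapping.lookup f hx1 * Poly_Mapping.lookup g hx2 - Poly_Mapping.lookup f hx2 * Poly_Mapping.lookup g hx1)"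
proof -
  have k: "Poly_Mapping.keys f \<subseteq> {hx1, hx2, HZ}" "Poly_Mapping.keys g \<subseteq> {hx1, hx2, HZ}"
    using assms unfolding carr_heisenberg by auto
  show ?thesis
    unfolding heisenberg_def
    by (subst brk_basis_superalgebra[OF _ k], simp, rule poly_mapping_eqI)
      (simp add: lookup_add lookup_sum_left lookup_single when_def)
qed

lemma in_carr_heisenberg_eqI:
  assumes "f \<in> carr (heisenberg 1 0)" "g \<in> carr (heisenberg 1 0)"
    "Poly_Mapping.lookup f hx1 = Poly_Mapping.lookup g hx1" "Poly_Mapping.lookup f hx2 = Poly_Mapping.lookup g hx2"
    "Poly_Mapping.lookup f HZ = Poly_Mapping.lookup g HZ"
  shows "f = g"
proof (rule poly_mapping_eqI)
  fix k
  show "Poly_Mapping.lookup f k = Poly_Mapping.lookup g k"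
  proof (cases "k \<in> {hx1, hx2, HZ}")
    case False
    then have "k \<notin> Poly_Mapping.keys f" "k \<notin> Poly_Mapping.keys g"
      using assms(1,2) unfolding carr_heisenberg by blast+
    then show ?thesis by (simp add: in_keys_iff)
  qed (use assms in auto)
qed

definition heis_elem :: "'k \<Rightarrow> 'k \<Rightarrow> 'k \<Rightarrow> (heis_index \<Rightarrow>\<^sub>0 'k::field)" where
  "heis_elem a b c = Poly_Mapping.single hx1 a + Poly_Mapping.single hx2 b + Poly_Mapping.single HZ c"

lemma lookup_heis_elem [simp]:
  "Poly_Mapping.lookup (heis_elem a b c) hx1 = a" "Poly_Mapping.lookup (heis_elem a b c) hx2 = b"
  "Poly_Mapping.lookup (heis_elem a b c) HZ = c"
  by (simp_all add: heis_elem_def lookup_add lookup_single)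

lemma heis_elem_carr: "heis_elem a b c \<in> carr (heisenberg 1 0)"
  unfolding carr_heisenberg by (auto simp: heis_elem_def in_keys_iff lookup_add lookup_single when_def split: if_splits)

lemma heis_elem_part: "heis_elem a b c \<in> part (heisenberg 1 0) 0"
  using heis_elem_carr unfolding part_heisenberg carr_heisenberg by blast

lemma heis_elem_add: "heis_elem (a + a') (b + b') (c + c') = heis_elem a b c + heis_elem a' b' c'"
  by (simp add: heis_elem_def single_add)

lemma heis_elem_scl: "heis_elem (t * a) (t * b) (t * c) = pscale t (heis_elem a b c)"
  by (rule poly_mapping_eqI) (simp add: heis_elem_def lookup_add lookup_single when_def algebra_simps)

lemma heis_elem_0: "heis_elem 0 0 0 = 0"
  by (simp add: heis_elem_def)

lemma heis_elem_surj:
  assumes "f \<in> carr (heisenberg 1 0)"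
  shows "f = heis_elem (Poly_Mapping.lookup f hx1) (Poly_Mapping.lookup f hx2) (Poly_Mapping.lookup f HZ)"
  by (rule in_carr_heisenberg_eqI[OF assms heis_elem_carr]) simp_all

lemma brk_heis_elem:
  "brk (heisenberg 1 0) (heis_elem a b c) (heis_elem a' b' c') = heis_elem 0 0 (a * b' - b * a')"
  by (simp add: brk_heisenberg[OF heis_elem_carr heis_elem_carr]) (simp add: heis_elem_def)

section \<open>Identification with H(1,0) plus an abelian summand\<close>

context heisenberg_split_basis
begin

text \<open>The summand spanned by \<open>A\<close> and the odd part, kept in the ambient type of
  \<open>L\<close> as the theorem asks. Its bracket can be set to 0 outright because both pieces are
  central in \<open>L\<close>.\<close>

definition abelian_part :: "('k, 'a) superalgebra" where
  "abelian_part = \<lparr>scl = scl L, brk = (\<lambda>_ _. 0), part = (\<lambda>i. if i = 0 then A else part L 1)\<rparr>"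

lemma abelian_part_simps [simp]:
  "scl abelian_part = scl L" "brk abelian_part x x' = 0" "part abelian_part 0 = A" "part abelian_part 1 = part L 1"
  by (simp_all add: abelian_part_def)

lemma carr_abelian_part: "carr abelian_part \<subseteq> carr L"
  using A(2) by (auto simp: carr_def)

lemma lie_superalgebra_abelian_part: "lie_superalgebra abelian_part"
proof -
  have s: "subspace (part abelian_part i)" for i
    using A(1) subspace_part bit_cases[of i] by auto
  show ?thesis
    by unfold_locales
      (use s A part_disjoint in \<open>auto simp: scale_right_distrib scale_left_distrib scale_scale
        subspace_0[OF A(1)] subspace_0[OF subspace_part] subspace_0[OF s]\<close>)
qed

lemma abelian_part_props:
  assumes fin: "fin_dim L" and mn: "sdim L (carr L) = (m, n)"
  shows "abelian_lsa abelian_part" "fin_dim abelian_part" "sdim abelian_part (carr abelian_part) = (m - 3, n)"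
proof -
  show "abelian_lsa abelian_part" by (simp add: abelian_lsa_def)
  show "fin_dim abelian_part"
    using fin carr_abelian_part unfolding fin_dim_def by auto
  interpret P: lie_superalgebra abelian_part by (rule lie_superalgebra_abelian_part)
  have c: "carr abelian_part \<inter> part abelian_part i = part abelian_part i" for i using P.part_carr by blast
  have c': "carr L \<inter> part L i = part L i" for i using part_carr by blast
  let ?B = "B \<inter> part L 0"
  have ind: "independent (?B - {y, w, z})" "independent ?B"
    by (rule independent_mono[OF indep_B], blast)+
  have "dim A = card (?B - {y, w, z})"
    unfolding A_span by (rule dim_span_eq_card_independent[OF ind(1)])
  also have "\<dots> = card ?B - card {y, w, z}"
    using ywz_B y w z finite_B by (intro card_Diff_subset) auto
  also have "card {y, w, z} = 3" using distinct_ywz by simp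
  also have "card ?B = dim (part L 0)"
    using dim_span_eq_card_independent[OF ind(2)] unfolding part_0[symmetric] by (rule sym)
  finally have "dim A = m - 3" using mn c' unfolding sdim_def by simp
  then show "sdim abelian_part (carr abelian_part) = (m - 3, n)"
    using mn unfolding sdim_def c c' by simp
qed

definition to_sum :: "'a \<Rightarrow> (heis_index \<Rightarrow>\<^sub>0 'k) \<times> 'a" where
  "to_sum x = (heis_elem (coord y x) (coord w x) (coord z x),
    x - (scl L (coord y x) y + scl L (coord w x) w + scl L (coord z x) z))"

definition from_sum :: "(heis_index \<Rightarrow>\<^sub>0 'k) \<times> 'a \<Rightarrow> 'a" where
  "from_sum u = scl L (Poly_Mapping.lookup (fst u) hx1) y + scl L (Poly_Mapping.lookup (fst u) hx2) w +
    scl L (Poly_Mapping.lookup (fst u) HZ) z + snd u"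

lemma to_sum_snd:
  assumes "x \<in> carr L"
  shows "snd (to_sum x) \<in> carr abelian_part"
proof -
  obtain a t where "a \<in> A" "t \<in> part L 1"
    "x = scl L (coord y x) y + scl L (coord w x) w + scl L (coord z x) z + (a + t)"
    using decompose[OF assms] .
  then have "snd (to_sum x) = a + t" "a \<in> part abelian_part 0" "t \<in> part abelian_part 1"
    unfolding to_sum_def by (metis add_diff_cancel_left' snd_conv, simp_all)
  then show ?thesis unfolding carr_def by blast
qed

text \<open>By \<open>brk_form\<close> every bracket is \<open>form\<close> times \<open>z\<close>,
  and \<open>form\<close> is the structure form of H(1,0) in the coordinates \<open>hx1\<close>,
  \<open>hx2\<close>; so a bracket has no component in the abelian summand.\<close>

lemma isomorphic_sum: "lsa_isomorphic L (direct_sum (heisenberg 1 0) abelian_part)"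
proof -
  let ?D = "direct_sum (heisenberg 1 0) abelian_part :: ('k, (heis_index \<Rightarrow>\<^sub>0 'k) \<times> 'a) superalgebra"
  have "bij_betw to_sum (carr L) (carr ?D)"
  proof (rule bij_betw_byWitness[where f' = from_sum])
    show "\<forall>x\<in>carr L. from_sum (to_sum x) = x" by (simp add: from_sum_def to_sum_def)
    show "\<forall>u\<in>carr ?D. to_sum (from_sum u) = u"
    proof
      fix u assume u: "u \<in> carr ?D"
      then have f: "fst u \<in> carr (heisenberg 1 0)" and "snd u \<in> carr abelian_part"
        unfolding carr_direct_sum by auto
      then obtain a t where at: "snd u = a + t" "a \<in> A" "t \<in> part L 1" unfolding carr_def by auto
      have c: "a \<in> carr L" "t \<in> carr L" using at A(2) part_carr by auto
      have "coord b (snd u) = 0" if "b \<in> {y, w, z}" for b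
        using c coord_A[OF at(2) that] coord_odd[OF at(3) that] by (simp add: at(1) coord_add)
      then have "coord y (from_sum u) = Poly_Mapping.lookup (fst u) hx1"
        "coord w (from_sum u) = Poly_Mapping.lookup (fst u) hx2" "coord z (from_sum u) = Poly_Mapping.lookup (fst u) HZ"
        using c ywz_carr ywz_B distinct_ywz carr_add[OF c] unfolding from_sum_def at(1)
        by (simp_all add: coord_add coord_scl carr_add carr_scl coord_basis)
      then show "to_sum (from_sum u) = u"
        using heis_elem_surj[OF f] unfolding to_sum_def by (cases u) (simp add: from_sum_def)
    qed
    show "to_sum ` carr L \<subseteq> carr ?D"
      using to_sum_snd heis_elem_carr unfolding carr_direct_sum by (auto simp: to_sum_def)
    show "from_sum ` carr ?D \<subseteq> carr L"
      using carr_abelian_part ywz_carr unfolding carr_direct_sum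
      by (auto simp: from_sum_def intro!: carr_add carr_scl)
  qed
  moreover have "lsa_hom L ?D to_sum"
    unfolding lsa_hom_def
  proof (intro conjI ballI allI)
    fix x x' assume x: "x \<in> carr L" "x' \<in> carr L"
    show "to_sum (x + x') = to_sum x + to_sum x'"
      using x by (simp add: to_sum_def coord_add heis_elem_add scale_left_distrib)
    have f: "fst (to_sum (brk L x x')) = heis_elem 0 0 (form x x')"
      unfolding to_sum_def using x distinct_ywz by (simp add: coord_brk)
    have s: "snd (to_sum (brk L x x')) = 0"
      unfolding to_sum_def using x distinct_ywz by (simp add: coord_brk) (simp add: brk_form)
    have g: "brk (heisenberg 1 0) (fst (to_sum x)) (fst (to_sum x')) = heis_elem 0 0 (form x x')"
      by (simp add: to_sum_def brk_heis_elem form_def)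
    show "to_sum (brk L x x') = brk ?D (to_sum x) (to_sum x')"
      unfolding prod_eq_iff direct_sum_simps f s g by simp
  next
    fix c x assume x: "x \<in> carr L"
    show "to_sum (scl L c x) = scl ?D c (to_sum x)"
      using x by (simp add: direct_sum_simps scl_heisenberg to_sum_def coord_scl heis_elem_scl scale_right_distrib
          scale_right_diff_distrib)
  next
    fix i x assume x: "x \<in> part L i"
    consider "i = 0" | "i = 1" using bit_cases by blast
    then show "to_sum x \<in> part ?D i"
    proof cases
      case 1
      obtain a t where at: "a \<in> A" "t \<in> part L 1"
        "x = scl L (coord y x) y + scl L (coord w x) w + scl L (coord z x) z + (a + t)"
        using decompose[OF part_carr[OF x]] .
      have s: "snd (to_sum x) = a + t" unfolding to_sum_def using at(3) by (metis add_diff_cancel_left' snd_conv)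
      \<comment> \<open>This exhibits the odd remainder \<open>t\<close> of the even element
        \<open>x\<close> as an even element, so that it is 0.\<close>
      have "t = x - (scl L (coord y x) y + scl L (coord w x) w + scl L (coord z x) z) - a"
        using at(3) by (metis add_diff_cancel_left')
      moreover have "\<dots> \<in> part L 0"
        using x 1 y w z at(1) A(2)
        by (intro subspace_diff[OF subspace_part] subspace_add[OF subspace_part] subspace_scale[OF subspace_part]) auto
      ultimately have "t = 0" using part_disjoint at(2) by metis
      then show ?thesis
        using s at(1) 1 by (simp add: direct_sum_simps mem_Times_iff) (simp add: to_sum_def heis_elem_part)
    next
      case 2
      then show ?thesis
        using x coord_odd[of x]
        by (simp add: to_sum_def direct_sum_simps heis_elem_0 part_heisenberg)
    qed
  qed
  ultimately show ?thesis unfolding lsa_isomorphic_def by blast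
qed

end

text \<open>The splitting is pulled back along \<open>\<chi>\<close>: \<open>y\<close> and
  \<open>w\<close> are preimages of the Heisenberg generators, and the functions \<open>u i\<close>,
  the Heisenberg coordinates of \<open>\<chi>\<close>, provide the coefficients.\<close>

lemma (in lie_superalgebra) isomorphic_sum_imp_split:
  assumes K: "lie_superalgebra K" "abelian_lsa K"
    and iso: "lsa_isomorphic L (direct_sum (heisenberg 1 0) K)"
  shows "\<exists>y w A. heisenberg_split L y w A"
proof -
  interpret K: lie_superalgebra K by (rule K)
  let ?D = "direct_sum (heisenberg 1 0) K"
  obtain \<chi> where h: "lsa_hom L ?D \<chi>" and bij: "bij_betw \<chi> (carr L) (carr ?D)"
    using iso unfolding lsa_isomorphic_def by blast
  have add: "\<chi> (x + x') = \<chi> x + \<chi> x'" and br: "\<chi> (brk L x x') = brk ?D (\<chi> x) (\<chi> x')"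
    if "x \<in> carr L" "x' \<in> carr L" for x x'
    using h that unfolding lsa_hom_def by blast+
  have sc: "\<chi> (scl L c x) = scl ?D c (\<chi> x)" if "x \<in> carr L" for c x
    using h that unfolding lsa_hom_def by blast
  have pt: "\<chi> x \<in> part ?D i" if "x \<in> part L i" for x i
    using h that unfolding lsa_hom_def by blast
  have inj: "x = x'" if "x \<in> carr L" "x' \<in> carr L" "\<chi> x = \<chi> x'" for x x'
    using bij that unfolding bij_betw_def inj_on_def by blast
  have \<chi>c: "fst (\<chi> x) \<in> carr (heisenberg 1 0)" "snd (\<chi> x) \<in> carr K" if "x \<in> carr L" for x
  proof -
    have "\<chi> x \<in> carr ?D" using bij that unfolding bij_betw_def by blast
    then show "fst (\<chi> x) \<in> carr (heisenberg 1 0)" "snd (\<chi> x) \<in> carr K"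
      unfolding carr_direct_sum by (auto simp: mem_Times_iff)
  qed
  have \<chi>0: "\<chi> 0 = 0" using add[OF carr_0 carr_0] by simp
  define u where "u i x = Poly_Mapping.lookup (fst (\<chi> x)) i" for i x
  have u_add: "u i (x + x') = u i x + u i x'" if "x \<in> carr L" "x' \<in> carr L" for i x x'
    using that by (simp add: u_def add lookup_add)
  have u_scl: "u i (scl L c x) = c * u i x" if "x \<in> carr L" for i c x
    using that by (simp add: u_def sc direct_sum_simps scl_heisenberg)
  have br': "\<chi> (brk L x x') = (heis_elem 0 0 (u hx1 x * u hx2 x' - u hx2 x * u hx1 x'), 0)"
    if "x \<in> carr L" "x' \<in> carr L" for x x'
  proof -
    have "fst (\<chi> (brk L x x')) = heis_elem 0 0 (u hx1 x * u hx2 x' - u hx2 x * u hx1 x')"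
      using brk_heisenberg[OF \<chi>c(1)[OF that(1)] \<chi>c(1)[OF that(2)]] that
      by (simp add: br direct_sum_simps u_def heis_elem_def)
    moreover have "snd (\<chi> (brk L x x')) = 0"
      using K(2) \<chi>c that unfolding abelian_lsa_def by (simp add: br direct_sum_simps)
    ultimately show ?thesis by (simp add: prod_eq_iff)
  qed
  \<comment> \<open>The preimage of an even element is even: the odd component \<open>q\<close> has
    no Heisenberg coordinate, since H(1,0) is even, and its \<open>K\<close>-coordinate is odd and,
    being minus that of \<open>p\<close>, also even. So \<open>\<chi>\<close> kills
    \<open>q\<close>.\<close>
  have even: "x \<in> part L 0" if x: "x \<in> carr L" "snd (\<chi> x) = 0" for x
  proof -
    obtain p q where pq: "x = p + q" "p \<in> part L 0" "q \<in> part L 1" using x unfolding carr_def by blast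
    have qc: "q \<in> carr L" "p \<in> carr L" using pq part_carr by auto
    have "snd (\<chi> q) \<in> part K 1" "snd (\<chi> p) \<in> part K 0" "fst (\<chi> q) = 0"
      using pt[OF pq(3)] pt[OF pq(2)] by (auto simp: direct_sum_simps part_heisenberg)
    moreover have "snd (\<chi> p) + snd (\<chi> q) = 0" using x(2) qc pq(1) by (simp add: add)
    then have "snd (\<chi> q) = - snd (\<chi> p)" by (simp add: eq_neg_iff_add_eq_0 add.commute)
    ultimately have "snd (\<chi> q) = 0"
      using K.part_disjoint K.subspace_neg[OF K.subspace_part] by metis
    then have "\<chi> q = \<chi> 0" using \<open>fst (\<chi> q) = 0\<close> \<chi>0 by (simp add: prod_eq_iff)
    then have "q = 0" using inj qc carr_0 by blast
    then show ?thesis using pq by simp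
  qed
  have ex: "\<exists>x\<in>part L 0. \<chi> x = (heis_elem a b c, 0)" for a b c
  proof -
    have "(heis_elem a b c, 0) \<in> \<chi> ` carr L"
      using bij heis_elem_carr K.carr_0 unfolding bij_betw_def carr_direct_sum by auto
    then obtain x where "x \<in> carr L" "\<chi> x = (heis_elem a b c, 0)" by force
    then show ?thesis using even[of x] by auto
  qed
  obtain y where y: "y \<in> part L 0" "\<chi> y = (heis_elem 1 0 0, 0)" using ex by blast
  obtain w where w: "w \<in> part L 0" "\<chi> w = (heis_elem 0 1 0, 0)" using ex by blast
  have c: "y \<in> carr L" "w \<in> carr L" using y w part_carr by auto
  let ?z = "brk L y w"
  have z: "\<chi> ?z = (heis_elem 0 0 1, 0)" using br'[OF c] y w by (simp add: u_def)
  have zc: "?z \<in> carr L" using c brk_carr by blast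
  \<comment> \<open>The even part of the abelian summand, pulled back along
    \<open>\<chi>\<close>.\<close>
  define A where "A = {x \<in> part L 0. u hx1 x = 0 \<and> u hx2 x = 0 \<and> u HZ x = 0}"
  have uv: "u hx1 y = 1" "u hx2 y = 0" "u HZ y = 0" "u hx1 w = 0" "u hx2 w = 1" "u HZ w = 0"
    "u hx1 ?z = 0" "u hx2 ?z = 0" "u HZ ?z = 1"
    using y z w by (simp_all add: u_def)
  note lin = u_add u_scl carr_add carr_scl part_carr
  have "heisenberg_split L y w A"
  proof unfold_locales
    show "y \<in> part L 0" "w \<in> part L 0" using y w by auto
    show "subspace A"
      unfolding A_def
      by (rule subspaceI)
        (auto simp: lin subspace_0[OF subspace_part] subspace_add[OF subspace_part] subspace_scale[OF subspace_part],
          simp_all add: u_def \<chi>0)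
    show "A \<subseteq> part L 0" unfolding A_def by blast
  next
    fix a x assume a: "a \<in> A \<or> a \<in> part L 1 \<or> a = ?z" and x: "x \<in> carr L"
    have ac: "a \<in> carr L" using a zc part_carr unfolding A_def by blast
    have "u hx1 a = 0 \<and> u hx2 a = 0"
    proof (cases "a \<in> part L 1")
      case True
      then have "fst (\<chi> a) = 0" using pt[OF True] by (auto simp: direct_sum_simps part_heisenberg)
      then show ?thesis by (simp add: u_def)
    qed (use a uv in \<open>auto simp: A_def\<close>)
    then have "\<chi> (brk L a x) = \<chi> 0" using br'[OF ac x] by (simp add: heis_elem_0 \<chi>0 zero_prod_def)
    then show "brk L a x = 0" using inj brk_carr[OF ac x] carr_0 by blast
  next
    fix x assume x: "x \<in> part L 0"
    have xc: "x \<in> carr L" using x part_carr by blast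
    define a where "a = x - (scl L (u hx1 x) y + scl L (u hx2 x) w + scl L (u HZ x) ?z)"
    have zp: "?z \<in> part L 0" using brk_part[OF y(1) w(1)] by simp
    have xa: "x = scl L (u hx1 x) y + scl L (u hx2 x) w + scl L (u HZ x) ?z + a" unfolding a_def by simp
    have ap: "a \<in> part L 0"
      unfolding a_def using x y w zp
      by (intro subspace_diff[OF subspace_part] subspace_add[OF subspace_part] subspace_scale[OF subspace_part])
    have "u i x = u hx1 x * u i y + u hx2 x * u i w + u HZ x * u i ?z + u i a" for i
      using c zc part_carr[OF ap] by (subst xa) (simp add: lin)
    from this[of hx1] this[of hx2] this[of HZ] have "a \<in> A" unfolding A_def using ap uv by simp
    then show "\<exists>b c d. \<exists>a\<in>A. x = scl L b y + scl L c w + scl L d ?z + a" using xa by blast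
  next
    fix a b e d assume a: "a \<in> A" and s: "scl L b y + scl L e w + scl L d ?z + a = 0"
    have ac: "a \<in> carr L" "u hx1 a = 0" "u hx2 a = 0" "u HZ a = 0" using a part_carr unfolding A_def by auto
    have u0: "u i 0 = 0" for i by (simp add: u_def \<chi>0)
    have "u i (scl L b y + scl L e w + scl L d ?z + a) = b * u i y + e * u i w + d * u i ?z + u i a" for i
      using c zc ac by (simp add: lin)
    from this[of hx1] this[of hx2] this[of HZ] show "b = 0 \<and> e = 0 \<and> d = 0"
      unfolding s u0 using uv ac by simp
  qed
  then show ?thesis by blast
qed

text \<open>In \<open>H(0,1)\<close> the square $[y,y]=z$ of the odd generator is even and nonzero.\<close>

lemma (in lie_superalgebra) not_isomorphic_odd_heisenberg_sum:
  assumes fin: "fin_dim L" and d: "dim (derived L \<inter> part L 0) = 0" and K: "lie_superalgebra K"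
  shows "\<not> lsa_isomorphic L (direct_sum (heisenberg 0 1) K)"
proof
  interpret K: lie_superalgebra K by (rule K)
  let ?D = "direct_sum (heisenberg 0 1) K"
  assume "lsa_isomorphic L ?D"
  then obtain \<chi> where h: "lsa_hom L ?D \<chi>" and bij: "bij_betw \<chi> (carr L) (carr ?D)"
    unfolding lsa_isomorphic_def by blast
  let ?y = "Poly_Mapping.single (HY 1) (1::'k)"
  have "?y \<in> carr (heisenberg 0 1)" unfolding heisenberg_def carr_basis by (auto simp: heis_basis_def)
  then have "(?y, 0) \<in> \<chi> ` carr L"
    using bij K.carr_0 unfolding bij_betw_def carr_direct_sum by auto
  then obtain x where x: "x \<in> carr L" "\<chi> x = (?y, 0)" by force
  have "\<chi> (brk L x x) = brk ?D (\<chi> x) (\<chi> x)" using h x(1) unfolding lsa_hom_def by blast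
  then have sq: "fst (\<chi> (brk L x x)) = Poly_Mapping.single HZ 1"
    unfolding x direct_sum_simps heisenberg_def
    by (simp add: basis_superalgebra_def) (rule poly_mapping_eqI, simp)
  have d0: "derived L \<inter> part L 0 = {0}"
    by (rule dim_zero_trivial[OF fin subspace_inter[OF subspace_derived subspace_part] _ d]) (use derived_carr in blast)
  obtain a b where ab: "a \<in> derived L" "a \<in> part L 0" "b \<in> part L 1" "brk L x x = a + b"
    by (rule gradedE[OF graded_derived brk_derived[OF x(1) x(1)]])
  have "a = 0" using d0 ab(1,2) by blast
  then have "brk L x x \<in> part L 1" using ab(3,4) by simp
  then have "\<chi> (brk L x x) \<in> part ?D 1" using h unfolding lsa_hom_def by blast
  then show False using sq by (auto simp: direct_sum_simps heisenberg_def basis_superalgebra_def)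
qed

theorem theorem5p1:
  fixes L :: "('k::{alg_closed_field, field_char_0}, 'a::ab_group_add) superalgebra"
    and F :: "('k, 'f::ab_group_add) superalgebra"
    and X :: "'x set" and p :: "'x \<Rightarrow> bit" and \<iota> :: "'x \<Rightarrow> 'f" and \<phi> :: "'f \<Rightarrow> 'a"
    and m n r s :: nat
  assumes "lie_superalgebra L" and "fin_dim L" and "nilpotent_lsa L"
    and "sdim L (carr L) = (m, n)" and "sdim L (derived L) = (r, s)" and "r + s \<ge> 1"
    and "free_presentation F X p \<iota> \<phi> L"
  shows "multiplier_fin_dim F \<phi> \<and>
    real (multiplier_dim F \<phi>)
      \<le> 1 / 2 * ((real m + real n + real r + real s - 2) * (real m + real n - real r - real s - 1))
         + real n + 1 \<and>
    (r + s = 1 \<longrightarrow>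
      (real (multiplier_dim F \<phi>)
        = 1 / 2 * ((real m + real n + real r + real s - 2) * (real m + real n - real r - real s - 1))
           + real n + 1
       \<longleftrightarrow>
       (r = 1 \<and> s = 0 \<and>
         (\<exists>A :: ('k, 'a) superalgebra. lie_superalgebra A \<and> abelian_lsa A \<and> fin_dim A \<and>
            3 \<le> m \<and> sdim A (carr A) = (m - 3, n) \<and>
            lsa_isomorphic L (direct_sum (heisenberg 1 0) A))) \<or>
       (r = 0 \<and> s = 1 \<and>
         (\<exists>A :: ('k, 'a) superalgebra. lie_superalgebra A \<and> abelian_lsa A \<and> fin_dim A \<and>
            1 \<le> m \<and> 1 \<le> n \<and> sdim A (carr A) = (m - 1, n - 1) \<and>
            lsa_isomorphic L (direct_sum (heisenberg 0 1) A)))))"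
proof -
  let ?B = "1 / 2 * ((real m + real n + real r + real s - 2) * (real m + real n - real r - real s - 1))
         + real n + 1"
  note fin = assms(2) and nil = assms(3) and mn = assms(4) and rs = assms(5) and pres = assms(7)
  interpret L: lie_superalgebra L by (rule assms(1))
  interpret lsa_epimorphism F L \<phi>
    using pres assms(1)
    by (simp add: free_presentation_def free_lsa_on_def lsa_epimorphism_def lsa_epimorphism_axioms_def)
  have two: "(2::'k) \<noteq> 0" and three: "(3::'k) \<noteq> 0" by simp_all
  have "derived L \<noteq> {0}"
  proof
    assume d: "derived L = {0}"
    have "derived L \<inter> part L i = L.span {}" for i
      using d L.subspace_0[OF L.subspace_part] by auto
    then have "L.dim (derived L \<inter> part L i) = 0" for i
      using L.dim_span_eq_card_independent[OF L.independent_empty] by simp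
    then show False using rs assms(6) unfolding sdim_def by simp
  qed
  then obtain i j u v where uv: "u \<in> part L i" "v \<in> part L j" "brk L u v \<notin> brk_span L (carr L) (derived L)"
    using L.nilpotent_bracket_exists[OF nil] by metis
  obtain u' v' where u': "u' \<in> part F i" "\<phi> u' = u" and v': "v' \<in> part F j" "\<phi> v' = v"
    using \<phi>_part_surj uv by metis
  define H where "H = {brk F u' (brk F u' v'), brk F v' (brk F u' v')}"
  have H: "finite H" "brk F u' (brk F u' v') \<in> F.span (FR \<union> H)" "brk F v' (brk F u' v') \<in> F.span (FR \<union> H)"
    unfolding H_def by (auto intro: F.span_base)
  \<comment> \<open>The two elements may coincide, for instance if u' = v', so only an inequality is
    available.\<close>
  have "card H \<le> 2" unfolding H_def by (simp add: card_insert_if)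
  note bound = multiplier_dim_bound[OF nil two fin mn rs u'(1) v'(1) _ H, unfolded u'(2) v'(2), OF uv(3)]
  have le: "real (multiplier_dim F \<phi>) + real s \<le> ?B"
    using bound(2) \<open>card H \<le> 2\<close> by linarith
  have "real (multiplier_dim F \<phi>) = ?B \<longleftrightarrow>
      (r = 1 \<and> s = 0 \<and>
         (\<exists>A :: ('k, 'a) superalgebra. lie_superalgebra A \<and> abelian_lsa A \<and> fin_dim A \<and>
            3 \<le> m \<and> sdim A (carr A) = (m - 3, n) \<and>
            lsa_isomorphic L (direct_sum (heisenberg 1 0) A))) \<or>
       (r = 0 \<and> s = 1 \<and>
         (\<exists>A :: ('k, 'a) superalgebra. lie_superalgebra A \<and> abelian_lsa A \<and> fin_dim A \<and>
            1 \<le> m \<and> 1 \<le> n \<and> sdim A (carr A) = (m - 1, n - 1) \<and>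
            lsa_isomorphic L (direct_sum (heisenberg 0 1) A)))" (is "_ \<longleftrightarrow> ?even \<or> ?odd")
    if "r + s = 1"
  proof (cases "s = 0")
    case True
    then have r: "r = 1" "s = 0" using that by auto
    have B: "?B = 1 / 2 * ((real m + real n - 1) * (real m + real n - 2)) + real n + 1"
      unfolding r by (simp add: algebra_simps)
    show ?thesis
    proof
      assume eq: "real (multiplier_dim F \<phi>) = ?B"
      obtain y w A where "heisenberg_split L y w A"
        using extremal_imp_heisenberg_split[OF nil two three fin mn rs[unfolded r] eq[unfolded B]] by blast
      note split = this
      interpret S: heisenberg_split L y w A by (rule split)
      obtain C where C: "finite C" "L.independent C" "L.span C = carr L" "C \<subseteq> part L 0 \<union> part L 1"
        "{y, w, S.z} \<subseteq> C" "part L 0 = L.span (C \<inter> part L 0)" "part L 1 = L.span (C \<inter> part L 1)"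
        "A = L.span (C \<inter> part L 0 - {y, w, S.z})" "y \<noteq> w" "y \<noteq> S.z" "w \<noteq> S.z"
        using S.basis_exists[OF fin] by metis
      interpret S: heisenberg_split_basis L y w A C
        by unfold_locales (use C two in auto)
      \<comment> \<open>This gives the truncated \<open>m - 3\<close> its intended meaning.\<close>
      have "3 \<le> m" by (rule heisenberg_split_lower_bound(2)[OF split two fin mn pres bound(1)])
      then have ?even
        using r S.lie_superalgebra_abelian_part S.abelian_part_props[OF fin mn] S.isomorphic_sum by blast
      then show "?even \<or> ?odd" ..
    next
      assume "?even \<or> ?odd"
      then obtain K :: "('k, 'a) superalgebra" where "lie_superalgebra K" "abelian_lsa K"
        "lsa_isomorphic L (direct_sum (heisenberg 1 0) K)"
        using r by auto
      then obtain y w A where "heisenberg_split L y w A" using L.isomorphic_sum_imp_split by blast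
      from heisenberg_split_lower_bound(1)[OF this two fin mn pres bound(1)]
      show "real (multiplier_dim F \<phi>) = ?B" unfolding B using le[unfolded B] by simp
    qed
  next
    case False
    \<comment> \<open>Both sides of the equivalence are false here: the summand s = 1 in
      \<open>le\<close> makes the bound strict, and an isomorphism with a sum involving H(0,1) would
      put a nonzero even square into L', which has no even part.\<close>
    then have r: "r = 0" "s = 1" using that by auto
    have "L.dim (derived L \<inter> part L 0) = 0" using rs r unfolding sdim_def by simp
    then have "\<not> ?odd" using L.not_isomorphic_odd_heisenberg_sum[OF fin] by blast
    moreover have "real (multiplier_dim F \<phi>) \<noteq> ?B" using le r by simp
    ultimately show ?thesis using r by simp
  qed
  moreover have "real (multiplier_dim F \<phi>) \<le> ?B" using le by simp
  ultimately show ?thesis using bound(1) by blast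
qed

end
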